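(* Let $f(x,y)=0$ be a reduced curve germ, with $f(0,0)=0$ and $f(0,y)\not\equiv0$, and let $B\in T(f)$. Let $N$ be the index of $\lambda_B$. Write $h(B)=\frac{m}{nN}$ and $q(B)=\frac{L}{M}$ where $m,n,L,M$ are positive integers with $\gcd(m,n)=\gcd(L,M)=1$. Let $H_B(t)$ be the unique polynomial with $H_B(z^n)=F_B(z)^M$. 1. If $H_B(t)$ has only one root (possibly multiple), then $\mathcal D_{\overline B}(u,v)$ is non-degenerate if and only if $(n-1)N=M$. 2. Otherwise $\mathcal D_{\overline B}(u,v)$ is non-degenerate if and only if $nN=M$ and all nonzero critical values of $H_B(t)$ are simple.
   Context: Puiseux series: $\mathbf C\{x\}^*$ is the ring of convergent Puiseux series in $x$ with nonnegative exponents; a fractional power series is one of positive order. For $\alpha,\gamma\in\mathbf C\{x\}^*$, $O(\alpha,\gamma)=\mathrm{ord}(\alpha(x)-\gamma(x))$. $\mathrm{Zer}\, g$ is the set of Newton–Puiseux roots of $g$, i.e. fractional power series $\gamma$ with $g(x,\gamma(x))=0$. The index of a fractional power series $\beta$ is the smallest positive integer $N$ with $\beta\in\mathbf C\{x^{1/N}\}$. "$+\cdots$" means plus higher order terms. Write $f=u\prod_{i=1}^p[y-\alpha_i(x)]$, $\frac{\partial f}{\partial y}=\tilde u\prod_{j=1}^{p-1}[y-\gamma_j(x)]$ with $u,\tilde u$ units and $\alpha_i,\gamma_j$ fractional power series (the $\alpha_i$ are distinct, the $\gamma_j$ are listed with multiplicity). Tree model: for $\alpha\in\mathbf C\{x\}^*$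 and rational $h>0$, the pseudo-ball is $B(\alpha,h)=\{\gamma\in\mathbf C\{x\}^*: O(\gamma,\alpha)\ge h\}$, of height $h(B)=h$. $T(f)=\{B(\alpha,O(\alpha,\alpha')):\alpha,\alpha'\in\mathrm{Zer} f,\ \alpha\ne\alpha'\}$. For $B\in T(f)$, $\lambda_B(x)$ is obtained from any $\alpha\in B$ by omitting all terms of order $\ge h(B)$. There are a polynomial $F_B(z)\in\mathbf C[z]$ (nonzero) and a rational number $q(B)$, determined by $f$ and $B$, such that for every $\gamma(x)=\lambda_B(x)+cx^{h(B)}+\cdots$ one has $f(x,\gamma(x))=F_B(c)x^{q(B)}+\cdots$. A root $\gamma_j$ leaves $T(f)$ at $B\in T(f)$ if $\gamma_j\in B$ and $h(B)=\max_i O(\alpha_i,\gamma_j)$. Conjugation: choose a positive integer $D$ such that all $\alpha_i,\gamma_j\in\mathbf C\{x^{1/D}\}$, and let $\mathbf U_D=\{\theta\in\mathbf C:\theta^D=1\}$ act by $\theta*\sum a_kx^{N_k/D}=\sum a_k\theta^{N_k}x^{N_k/D}$. It acts on $T(f)$ by $\theta*B(\alpha,h)=B(\theta*\alpha,h)$ ($\alpha\in\mathrm{Zer} f$); $\overline B$ denotes the orbit of $B$. Put $\mathcal D_B(u,v)=\prod_j(v-f(u,\gamma_j(u)))$, the product over all $j$ such that $\gamma_j$ leaves $T(f)$ at $B$, and $\mathcal D_{\overline B}=\prod_{B'\in\overline B}\mathcal D_{B'}$, which lies in $\mathbf C\{u\}[v]$. The polynomial $H_B$ with $H_B(z^n)=F_B(z)^M$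 exists and is unique. Writing $H_B'(t)=C(t-t_1)\cdots(t-t_r)$, "all nonzero critical values are simple" means that the numbers $H_B(t_j)$, over those $j\in\{1,\dots,r\}$ with $H_B(t_j)\ne0$, are pairwise different. Non-degeneracy: for $g=\sum a_{ij}u^iv^j\ne0$ the Newton diagram is the convex hull of $\{(i,j):a_{ij}\ne0\}+\mathbf R_{\ge 0}^2$. For a compact edge $S$, $g_S=\sum_{(i,j)\in S}a_{ij}u^iv^j=c\,u^kv^l\prod_{i=1}^r(v^{q_0}-a_iu^{p_0})^{s_i}$ with $p_0,q_0$ coprime positive integers, $c,a_i$ nonzero and the $a_i$ pairwise different; $g$ is non-degenerate if for every compact edge all $s_i=1$. *)

theory Defs
  imports
    "HOL-Analysis.Analysis"
    "HOL-Computational_Algebra.Polynomial_FPS"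
    "HOL-Library.Extended"
begin

unbundle no vec_syntax and fps_syntax
no_notation Pinf (\<open>\<infinity>\<close>)
no_notation Minf (\<open>-\<infinity>\<close>)

section \<open>Puiseux series with nonnegative exponents\<close>

text \<open>
  The type of formal Puiseux series over the complex numbers with nonnegative exponents; a series
  is given by its coefficient function. Convergence is expressed separately, by the set
  \<open>cpuiseux\<close> below.
\<close>

typedef puiseux =
  "{a :: rat \<Rightarrow> complex. \<exists>N>0. \<forall>r. a r \<noteq> 0 \<longrightarrow> r * of_nat N \<in> (\<nat> :: rat set)}"
  morphisms pcoeff Abs_puiseux
  by (rule exI[of _ "\<lambda>_. 0"]) auto

setup_lifting type_definition_puiseux

lemma puiseux_eqI: "(\<And>r. pcoeff a r = pcoeff b r) \<Longrightarrow> a = b"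
  by (simp add: pcoeff_inject[symmetric] fun_eq_iff)

text \<open>\<open>of_root N g\<close> is the series \<open>g(x\<^bsup>1/N\<^esup>)\<close>.\<close>

lift_definition of_root :: "nat \<Rightarrow> complex fps \<Rightarrow> puiseux" is
  "\<lambda>N g r. if N > 0 \<and> r * of_nat N \<in> \<nat> then g $ nat \<lfloor>r * of_nat N\<rfloor> else 0"
  subgoal for N g by (cases "N > 0") auto
  done

abbreviation of_fps :: "complex fps \<Rightarrow> puiseux" where
  "of_fps \<equiv> of_root 1"

lemma pcoeff_of_root:
  "N > 0 \<Longrightarrow> pcoeff (of_root N g) (of_nat k / of_nat N) = g $ k"
  by (simp add: of_root.rep_eq)

lemma pcoeff_of_root_eq_0:
  "r * of_nat N \<notin> \<nat> \<Longrightarrow> pcoeff (of_root N g) r = 0"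
  by (simp add: of_root.rep_eq)

lemma supp_imp_of_root:
  assumes "N > 0" "\<And>r. pcoeff a r \<noteq> 0 \<Longrightarrow> r * of_nat N \<in> \<nat>"
  shows "a = of_root N (Abs_fps (\<lambda>k. pcoeff a (of_nat k / of_nat N)))"
proof (rule puiseux_eqI)
  fix r
  show "pcoeff a r = pcoeff (of_root N (Abs_fps (\<lambda>k. pcoeff a (of_nat k / of_nat N)))) r"
  proof (cases "r * of_nat N \<in> \<nat>")
    case True
    then obtain k where "r * of_nat N = of_nat k" by (auto elim: Nats_cases)
    with assms(1) have "r = of_nat k / of_nat N" by (simp add: field_simps)
    then show ?thesis using assms(1) by (simp add: pcoeff_of_root)
  next
    case False
    then show ?thesis using assms(2)[of r] by (auto simp: pcoeff_of_root_eq_0)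
  qed
qed

lemma of_root_cases: obtains N g where "N > 0" "a = of_root N g"
proof -
  from pcoeff[of a] obtain N where "N > 0" "\<forall>r. pcoeff a r \<noteq> 0 \<longrightarrow> r * of_nat N \<in> \<nat>"
    by blast
  then show ?thesis using that supp_imp_of_root[of N a] by blast
qed

lemma of_root_mono:
  assumes "N > 0" "K > 0"
  shows "\<exists>h. of_root N g = of_root (N * K) h"
proof -
  have "r * of_nat (N * K) \<in> \<nat>" if "pcoeff (of_root N g) r \<noteq> 0" for r
  proof -
    have "r * of_nat N \<in> \<nat>" using that pcoeff_of_root_eq_0 by blast
    then have "r * of_nat N * of_nat K \<in> \<nat>" by (rule Nats_mult) simp
    then show ?thesis by (simp add: mult_ac)
  qed
  then show ?thesis using supp_imp_of_root[of "N * K" "of_root N g"] assms by auto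
qed

lemma of_root_cases2:
  obtains N g h where "N > 0" "a = of_root N g" "b = of_root N h"
proof -
  obtain N g where 1: "N > 0" "a = of_root N g" by (rule of_root_cases)
  obtain K h where 2: "K > 0" "b = of_root K h" by (rule of_root_cases)
  from of_root_mono[of N K g] of_root_mono[of K N h] 1 2 that[of "N * K"]
  show ?thesis by (metis mult.commute nat_0_less_mult_iff)
qed

lemma of_root_cases3:
  obtains N g h k where "N > 0" "a = of_root N g" "b = of_root N h" "c = of_root N k"
proof -
  obtain N g h where 1: "N > 0" "a = of_root N g" "b = of_root N h" by (rule of_root_cases2)
  obtain K k where 2: "K > 0" "c = of_root K k" by (rule of_root_cases)
  from of_root_mono[of N K g] of_root_mono[of N K h] of_root_mono[of K N k] 1 2 that[of "N * K"]
  show ?thesis by (metis mult.commute nat_0_less_mult_iff)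
qed

instantiation puiseux :: comm_ring_1
begin

lift_definition zero_puiseux :: puiseux is "\<lambda>_. 0" by (auto intro: exI[of _ 1])

definition one_puiseux :: puiseux where "1 = of_fps 1"

lift_definition uminus_puiseux :: "puiseux \<Rightarrow> puiseux" is "\<lambda>a r. - a r" by auto

lift_definition plus_puiseux :: "puiseux \<Rightarrow> puiseux \<Rightarrow> puiseux" is "\<lambda>a b r. a r + b r"
proof -
  fix a b :: "rat \<Rightarrow> complex"
  assume "\<exists>N>0. \<forall>r. a r \<noteq> 0 \<longrightarrow> r * of_nat N \<in> \<nat>" "\<exists>N>0. \<forall>r. b r \<noteq> 0 \<longrightarrow> r * of_nat N \<in> \<nat>"
  then obtain N K where N: "N > 0" "\<And>r. a r \<noteq> 0 \<Longrightarrow> r * of_nat N \<in> \<nat>"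
    and K: "K > 0" "\<And>r. b r \<noteq> 0 \<Longrightarrow> r * of_nat K \<in> \<nat>" by blast
  have "r * of_nat (N * K) \<in> \<nat>" if "a r + b r \<noteq> 0" for r
  proof -
    from that consider "a r \<noteq> 0" | "b r \<noteq> 0" by force
    then show ?thesis
    proof cases
      case 1
      have "r * of_nat N * of_nat K \<in> \<nat>" using N(2)[OF 1] by (rule Nats_mult) (rule of_nat_in_Nats)
      then show ?thesis by (simp add: mult_ac)
    next
      case 2
      have "r * of_nat K * of_nat N \<in> \<nat>" using K(2)[OF 2] by (rule Nats_mult) (rule of_nat_in_Nats)
      then show ?thesis by (simp add: mult_ac)
    qed
  qed
  then show "\<exists>N>0. \<forall>r. a r + b r \<noteq> 0 \<longrightarrow> r * of_nat N \<in> \<nat>"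
    using N(1) K(1) by (intro exI[of _ "N * K"]) auto
qed

definition "a - b = a + - (b :: puiseux)"

text \<open>The sum is finite for Puiseux series with nonnegative exponents.\<close>

lift_definition times_puiseux :: "puiseux \<Rightarrow> puiseux \<Rightarrow> puiseux" is
  "\<lambda>a b r. \<Sum>s | a s \<noteq> 0 \<and> b (r - s) \<noteq> 0. a s * b (r - s)"
proof -
  fix a b :: "rat \<Rightarrow> complex"
  assume "\<exists>N>0. \<forall>r. a r \<noteq> 0 \<longrightarrow> r * of_nat N \<in> \<nat>" "\<exists>N>0. \<forall>r. b r \<noteq> 0 \<longrightarrow> r * of_nat N \<in> \<nat>"
  then obtain N K where N: "N > 0" "\<And>r. a r \<noteq> 0 \<Longrightarrow> r * of_nat N \<in> \<nat>"
    and K: "K > 0" "\<And>r. b r \<noteq> 0 \<Longrightarrow> r * of_nat K \<in> \<nat>" by blast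
  have "r * of_nat (N * K) \<in> \<nat>"
    if "(\<Sum>s | a s \<noteq> 0 \<and> b (r - s) \<noteq> 0. a s * b (r - s)) \<noteq> 0" for r
  proof -
    from that obtain s where s: "a s \<noteq> 0" "b (r - s) \<noteq> 0"
      by (auto elim: sum.not_neutral_contains_not_neutral)
    have "s * of_nat N * of_nat K + (r - s) * of_nat K * of_nat N \<in> \<nat>"
      by (intro Nats_add Nats_mult[OF N(2)[OF s(1)]] Nats_mult[OF K(2)[OF s(2)]] of_nat_in_Nats)
    then show ?thesis by (simp add: algebra_simps)
  qed
  then show "\<exists>N>0. \<forall>r. (\<Sum>s | a s \<noteq> 0 \<and> b (r - s) \<noteq> 0. a s * b (r - s)) \<noteq> 0 \<longrightarrow>
      r * of_nat N \<in> \<nat>"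
    using N(1) K(1) by (intro exI[of _ "N * K"]) auto
qed

lemma of_root_add: "of_root N g + of_root N h = of_root N (g + h)"
  by transfer auto

lemma of_root_uminus: "- of_root N g = of_root N (- g)"
  by transfer auto

lemma of_root_0: "of_root N 0 = 0"
  by transfer auto

lemma of_root_1: "N > 0 \<Longrightarrow> of_root N 1 = 1"
proof (unfold one_puiseux_def, rule puiseux_eqI)
  fix r :: rat
  assume N: "N > 0"
  show "pcoeff (of_root N 1) r = pcoeff (of_fps 1) r"
  proof (cases "r = 0")
    case False
    have "k \<noteq> 0" if "r * of_nat N = of_nat k" for k :: nat
      using that False N by (intro notI) auto
    moreover have "k \<noteq> 0" if "r = of_nat k" for k :: nat
      using that False by auto
    ultimately show ?thesis by (auto simp: of_root.rep_eq elim!: Nats_cases)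
  qed (use N in \<open>auto simp: of_root.rep_eq\<close>)
qed

lemma of_root_mult:
  assumes N: "N > 0"
  shows "of_root N g * of_root N h = of_root N (g * h)"
proof (rule puiseux_eqI)
  fix r :: rat
  let ?a = "pcoeff (of_root N g)" and ?b = "pcoeff (of_root N h)"
  let ?S = "{s. ?a s \<noteq> 0 \<and> ?b (r - s) \<noteq> 0}"
  have S: "\<exists>i k. s = of_nat i / of_nat N \<and> r - s = of_nat k / of_nat N" if "s \<in> ?S" for s
  proof -
    have "s * of_nat N \<in> \<nat>" "(r - s) * of_nat N \<in> \<nat>"
      using that pcoeff_of_root_eq_0 by blast+
    then obtain i k where "s * of_nat N = of_nat i" "(r - s) * of_nat N = of_nat k"
      by (auto elim!: Nats_cases)
    then have "s = of_nat i / of_nat N" "r - s = of_nat k / of_nat N"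
      using N by (simp_all add: field_simps)
    then show ?thesis by blast
  qed
  show "pcoeff (of_root N g * of_root N h) r = pcoeff (of_root N (g * h)) r"
  proof (cases "r * of_nat N \<in> \<nat>")
    case True
    then obtain n where "r * of_nat N = of_nat n" by (auto elim: Nats_cases)
    then have r: "r = of_nat n / of_nat N" using N by (simp add: field_simps)
    have d: "r - of_nat i / of_nat N = of_nat (n - i) / of_nat N" if "i \<le> n" for i
      using that r by (simp add: of_nat_diff diff_divide_distrib)
    have sub: "?S \<subseteq> (\<lambda>i. of_nat i / of_nat N) ` {0..n}"
    proof
      fix s assume "s \<in> ?S"
      then obtain i k where ik: "s = of_nat i / of_nat N" "r - s = of_nat k / of_nat N"
        using S by blast
      then have "of_nat n / of_nat N = (of_nat (i + k) / of_nat N :: rat)"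
        using r by (simp add: add_divide_distrib algebra_simps)
      then have "of_nat n = (of_nat (i + k) :: rat)"
        using N by (simp del: of_nat_add)
      then have "n = i + k" by (simp only: of_nat_eq_iff)
      then show "s \<in> (\<lambda>i. of_nat i / of_nat N) ` {0..n}" using ik by auto
    qed
    have "(\<Sum>s\<in>?S. ?a s * ?b (r - s)) =
        (\<Sum>s\<in>(\<lambda>i. of_nat i / of_nat N) ` {0..n}. ?a s * ?b (r - s))"
      using sub by (intro sum.mono_neutral_left) auto
    also have "\<dots> = (\<Sum>i=0..n. ?a (of_nat i / of_nat N) * ?b (r - of_nat i / of_nat N))"
      using N by (subst sum.reindex) (auto simp: inj_on_def)
    also have "\<dots> = (\<Sum>i=0..n. g $ i * h $ (n - i))"
      by (intro sum.cong refl) (simp only: d atLeastAtMost_iff pcoeff_of_root[OF N])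
    also have "\<dots> = pcoeff (of_root N (g * h)) r"
      using N by (simp add: r pcoeff_of_root fps_mult_nth)
    finally show ?thesis by (simp add: times_puiseux.rep_eq)
  next
    case False
    have "?S = {}"
    proof (rule equals0I)
      fix s assume "s \<in> ?S"
      then obtain i k where "s = of_nat i / of_nat N" "r - s = of_nat k / of_nat N"
        using S by blast
      then have "r = of_nat (i + k) / of_nat N" by (simp add: add_divide_distrib algebra_simps)
      then have "r * of_nat N = of_nat (i + k)" using N by (simp add: field_simps)
      then have "r * of_nat N \<in> \<nat>" by (metis of_nat_in_Nats)
      with False show False by contradiction
    qed
    then show ?thesis using False
      by (simp only: times_puiseux.rep_eq pcoeff_of_root_eq_0[OF False] sum.empty)
  qed
qed

instance
proof
  fix a b c :: puiseux
  obtain N g h k where N: "N > 0" and *: "a = of_root N g" "b = of_root N h" "c = of_root N k"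
    by (rule of_root_cases3)
  note ops = of_root_add of_root_mult[OF N] of_root_uminus
  show "a * b * c = a * (b * c)" unfolding * by (simp add: ops mult_ac)
  show "a * b = b * a" unfolding * by (simp add: ops mult_ac)
  show "1 * a = a" unfolding * of_root_1[OF N, symmetric] by (simp add: ops)
  show "(a + b) * c = a * c + b * c" unfolding * by (simp add: ops algebra_simps)
  show "a + b + c = a + (b + c)" unfolding * by (simp add: ops add_ac)
  show "a + b = b + a" unfolding * by (simp add: ops add_ac)
  show "0 + a = a" by transfer auto
  show "- a + a = 0" by transfer auto
  show "a - b = a + - b" by (rule minus_puiseux_def)
  show "(0 :: puiseux) \<noteq> 1"
  proof
    assume "(0 :: puiseux) = 1"
    then have "pcoeff 0 0 = pcoeff 1 0" by simp
    then show False by (simp add: one_puiseux_def of_root.rep_eq zero_puiseux.rep_eq)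
  qed
qed

end

text \<open>\<open>C{x\<^bsup>1/N\<^esup>}\<close>, the ring \<open>C{x}*\<close>, and the fractional power series (positive order).\<close>

definition cpuiseux_root :: "nat \<Rightarrow> puiseux set" where
  "cpuiseux_root N = {of_root N g | g. fps_conv_radius g > 0}"

definition cpuiseux :: "puiseux set" where
  "cpuiseux = (\<Union>N\<in>{0<..}. cpuiseux_root N)"

definition pord :: "puiseux \<Rightarrow> rat extended" where
  "pord a = (if a = 0 then Pinf else Fin (LEAST r. pcoeff a r \<noteq> 0))"

abbreviation contact :: "puiseux \<Rightarrow> puiseux \<Rightarrow> rat extended" where
  "contact \<alpha> \<gamma> \<equiv> pord (\<alpha> - \<gamma>)"

definition frac_series :: "puiseux set" where
  "frac_series = {\<gamma> \<in> cpuiseux. pord \<gamma> > Fin 0}"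

definition pindex :: "puiseux \<Rightarrow> nat" where
  "pindex \<beta> = (LEAST N. N > 0 \<and> \<beta> \<in> cpuiseux_root N)"

text \<open>\<open>expands \<gamma> l c h\<close> says that \<open>\<gamma>(x) = l(x) + c x\<^sup>h + \<cdots>\<close>; here \<open>c = 0\<close> is allowed.\<close>

definition expands :: "puiseux \<Rightarrow> puiseux \<Rightarrow> complex \<Rightarrow> rat \<Rightarrow> bool" where
  "expands \<gamma> l c h \<longleftrightarrow> (\<forall>s<h. pcoeff (\<gamma> - l) s = 0) \<and> pcoeff (\<gamma> - l) h = c"

lift_definition ptrunc :: "rat \<Rightarrow> puiseux \<Rightarrow> puiseux" is
  "\<lambda>h a r. if r < h then a r else 0"
  by auto

text \<open>
  The action \<open>\<theta> * \<Sum> a\<^sub>k x\<^bsup>k/D\<^esup> = \<Sum> a\<^sub>k \<theta>\<^sup>k x\<^bsup>k/D\<^esup>\<close>; it is only meaningful on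
  \<open>C{x\<^bsup>1/D\<^esup>}\<close>.
\<close>

lift_definition pconj :: "nat \<Rightarrow> complex \<Rightarrow> puiseux \<Rightarrow> puiseux" is
  "\<lambda>D \<theta> a r. a r * \<theta> ^ nat \<lfloor>r * of_nat D\<rfloor>"
  by auto


section \<open>Power series in two variables\<close>

text \<open>
  A formal power series \<open>f(x,y) = \<Sum> a\<^sub>i\<^sub>j x\<^sup>i y\<^sup>j\<close> is represented as a series in \<open>y\<close> (the outer
  variable) with coefficients in \<open>C[[x]]\<close>, so \<open>a\<^sub>i\<^sub>j = f $ j $ i\<close> and \<open>\<partial>f/\<partial>y = fps_deriv f\<close>.
\<close>

definition germs :: "complex fps fps set" where
  "germs = {f. \<exists>r>0. (\<lambda>(i, j). norm (f $ j $ i) * r ^ (i + j)) summable_on UNIV}"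

definition unit_germs :: "complex fps fps set" where
  "unit_germs = {f \<in> germs. f $ 0 $ 0 \<noteq> 0}"

definition reduced_germ :: "complex fps fps \<Rightarrow> bool" where
  "reduced_germ f \<longleftrightarrow> (\<forall>g\<in>germs. \<forall>h\<in>germs. f = g ^ 2 * h \<longrightarrow> g \<in> unit_germs)"

definition germ_to_puiseux :: "complex fps fps \<Rightarrow> puiseux fps" where
  "germ_to_puiseux f = Abs_fps (\<lambda>j. of_fps (f $ j))"

text \<open>
  The substitution \<open>f(x, \<gamma>(x))\<close>, for \<open>\<gamma>\<close> of positive order: for each exponent only finitely many
  summands are nonzero.
\<close>

lift_definition psubst :: "complex fps fps \<Rightarrow> puiseux \<Rightarrow> puiseux" is
  "\<lambda>f \<gamma> r. \<Sum>j | pcoeff (of_fps (f $ j) * \<gamma> ^ j) r \<noteq> 0. pcoeff (of_fps (f $ j) * \<gamma> ^ j) r"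
proof -
  fix f :: "complex fps fps" and \<gamma> :: puiseux
  obtain N g where N: "N > 0" and g: "\<gamma> = of_root N g" by (rule of_root_cases)
  have pow: "\<exists>k. \<gamma> ^ j = of_root N k" for j
    using N by (induction j) (metis of_root_1 power_0, metis g of_root_mult power_Suc)
  have supp: "r * of_nat N \<in> \<nat>" if "pcoeff (of_fps (f $ j) * \<gamma> ^ j) r \<noteq> 0" for j r
  proof -
    obtain k where "\<gamma> ^ j = of_root N k" using pow by blast
    moreover obtain l where "of_fps (f $ j) = of_root N l"
      using of_root_mono[of 1 N] N by auto
    ultimately have "of_fps (f $ j) * \<gamma> ^ j = of_root N (l * k)" using N by (simp add: of_root_mult)
    with that pcoeff_of_root_eq_0 show ?thesis by metis
  qed
  have "r * of_nat N \<in> \<nat>"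
    if "(\<Sum>j | pcoeff (of_fps (f $ j) * \<gamma> ^ j) r \<noteq> 0. pcoeff (of_fps (f $ j) * \<gamma> ^ j) r) \<noteq> 0" for r
    using that by (rule sum.not_neutral_contains_not_neutral) (rule supp)
  with N show "\<exists>N>0. \<forall>r. (\<Sum>j | pcoeff (of_fps (f $ j) * \<gamma> ^ j) r \<noteq> 0.
      pcoeff (of_fps (f $ j) * \<gamma> ^ j) r) \<noteq> 0 \<longrightarrow> r * of_nat N \<in> \<nat>"
    by blast
qed


section \<open>The tree model\<close>

definition Zer :: "complex fps fps \<Rightarrow> puiseux set" where
  "Zer g = {\<gamma> \<in> frac_series. psubst g \<gamma> = 0}"

definition pball :: "puiseux \<Rightarrow> rat \<Rightarrow> puiseux set" where
  "pball \<alpha> h = {\<gamma> \<in> cpuiseux. contact \<gamma> \<alpha> \<ge> Fin h}"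

definition height :: "puiseux set \<Rightarrow> rat" where
  "height B = (THE h. h > 0 \<and> (\<exists>\<alpha>\<in>cpuiseux. B = pball \<alpha> h))"

definition tree :: "complex fps fps \<Rightarrow> puiseux set set" where
  "tree f = {pball \<alpha> h | \<alpha> \<alpha>' h. \<alpha> \<in> Zer f \<and> \<alpha>' \<in> Zer f \<and> \<alpha> \<noteq> \<alpha>' \<and> contact \<alpha> \<alpha>' = Fin h}"

definition lam :: "puiseux set \<Rightarrow> puiseux" where
  "lam B = (THE l. \<forall>\<alpha>\<in>B. l = ptrunc (height B) \<alpha>)"

definition leading_data :: "complex fps fps \<Rightarrow> puiseux set \<Rightarrow> complex poly \<Rightarrow> rat \<Rightarrow> bool" where
  "leading_data f B F q \<longleftrightarrow> F \<noteq> 0 \<and>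
     (\<forall>c. \<forall>\<gamma>\<in>cpuiseux. expands \<gamma> (lam B) c (height B) \<longrightarrow> expands (psubst f \<gamma>) 0 (poly F c) q)"

definition F_poly :: "complex fps fps \<Rightarrow> puiseux set \<Rightarrow> complex poly" where
  "F_poly f B = (THE F. \<exists>q. leading_data f B F q)"

definition q_exp :: "complex fps fps \<Rightarrow> puiseux set \<Rightarrow> rat" where
  "q_exp f B = (THE q. \<exists>F. leading_data f B F q)"

text \<open>\<open>H_poly f B n M\<close> is the polynomial \<open>H\<close> with \<open>H(z\<^sup>n) = F\<^sub>B(z)\<^sup>M\<close>.\<close>

definition H_poly :: "complex fps fps \<Rightarrow> puiseux set \<Rightarrow> nat \<Rightarrow> nat \<Rightarrow> complex poly" where
  "H_poly f B n M = (THE H. pcompose H (monom 1 n) = F_poly f B ^ M)"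

definition leaves_at :: "complex fps fps \<Rightarrow> puiseux set \<Rightarrow> puiseux \<Rightarrow> bool" where
  "leaves_at f B \<gamma> \<longleftrightarrow> \<gamma> \<in> B \<and> Fin (height B) = Max ((\<lambda>\<alpha>. contact \<alpha> \<gamma>) ` Zer f)"

definition orbit :: "complex fps fps \<Rightarrow> nat \<Rightarrow> puiseux set \<Rightarrow> puiseux set set" where
  "orbit f D B = {pball (pconj D \<theta> \<alpha>) h | \<theta> \<alpha> h. \<theta> ^ D = 1 \<and> \<alpha> \<in> Zer f \<and> h > 0 \<and> B = pball \<alpha> h}"

text \<open>
  The list \<open>\<gamma>s\<close> below contains the roots of \<open>\<partial>f/\<partial>y\<close> with multiplicity. First the polynomial
  \<open>\<D>\<^sub>B\<close> in \<open>v\<close> with coefficients Puiseux series in \<open>u\<close>; then the product over the orbit,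
  read as an element of \<open>C[[u]][v]\<close>.
\<close>

definition disc_ball ::
    "complex fps fps \<Rightarrow> puiseux list \<Rightarrow> puiseux set \<Rightarrow> puiseux poly" where
  "disc_ball f \<gamma>s B = (\<Prod>\<gamma>\<leftarrow>filter (leaves_at f B) \<gamma>s. [:- psubst f \<gamma>, 1:])"

definition disc_orbit ::
    "complex fps fps \<Rightarrow> puiseux list \<Rightarrow> nat \<Rightarrow> puiseux set \<Rightarrow> complex fps poly" where
  "disc_orbit f \<gamma>s D B = (THE g. map_poly of_fps g = (\<Prod>B'\<in>orbit f D B. disc_ball f \<gamma>s B'))"


section \<open>Critical values and non-degeneracy\<close>

text \<open>
  Critical points are listed with multiplicity, so a multiple critical point with nonzero value
  violates simplicity.
\<close>

definition nonzero_critical_values_simple :: "complex poly \<Rightarrow> bool" where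
  "nonzero_critical_values_simple H \<longleftrightarrow>
     (\<exists>C ts. C \<noteq> 0 \<and> pderiv H = smult C (\<Prod>t\<leftarrow>ts. [:- t, 1:]) \<and>
        distinct (map (poly H) (filter (\<lambda>t. poly H t \<noteq> 0) ts)))"

definition newton_diagram :: "complex fps fps \<Rightarrow> (real \<times> real) set" where
  "newton_diagram g =
     convex hull {(real i + s, real j + t) | i j s t. g $ j $ i \<noteq> 0 \<and> s \<ge> 0 \<and> t \<ge> 0}"

definition edge_part :: "complex fps fps \<Rightarrow> (real \<times> real) set \<Rightarrow> complex fps fps" where
  "edge_part g S = Abs_fps (\<lambda>j. Abs_fps (\<lambda>i. if (real i, real j) \<in> S then g $ j $ i else 0))"

text \<open>
  \<open>g\<^sub>S = c u\<^sup>k v\<^sup>l \<Prod>\<^bsub>a\<in>A\<^esub> (v\<^sup>q - a u\<^sup>p)\<^bsup>s(a)\<^esup>\<close>, where \<open>A\<close> is the set of the pairwise different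
  \<open>a\<^sub>i\<close>; as above \<open>v\<close> is the outer variable.
\<close>

definition edge_factorization ::
    "complex fps fps \<Rightarrow> complex \<Rightarrow> nat \<Rightarrow> nat \<Rightarrow> nat \<Rightarrow> nat \<Rightarrow> complex set \<Rightarrow> (complex \<Rightarrow> nat) \<Rightarrow> bool"
  where
  "edge_factorization gS c k l p q A s \<longleftrightarrow>
     c \<noteq> 0 \<and> p > 0 \<and> q > 0 \<and> coprime p q \<and> finite A \<and> 0 \<notin> A \<and> (\<forall>a\<in>A. s a > 0) \<and>
     gS = fps_const (fps_const c * fps_X ^ k) * fps_X ^ l *
       (\<Prod>a\<in>A. (fps_X ^ q - fps_const (fps_const a * fps_X ^ p)) ^ s a)"

definition nondegenerate :: "complex fps fps \<Rightarrow> bool" where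
  "nondegenerate g \<longleftrightarrow> (\<forall>S. S edge_of newton_diagram g \<and> compact S \<longrightarrow>
     (\<exists>c k l p q A s. edge_factorization (edge_part g S) c k l p q A s \<and> (\<forall>a\<in>A. s a = 1)))"

end

theory Submission
  imports Defs "HOL-Computational_Algebra.Fundamental_Theorem_Algebra"
begin

text \<open>
  Write \<open>\<gamma> = \<lambda>\<^sub>B + c x\<^sup>h + \<cdots>\<close>. Differentiating \<open>f(x, \<lambda>\<^sub>B + z x\<^sup>h) = F\<^sub>B(z) x\<^sup>q + \<cdots>\<close> in \<open>z\<close> shows that
  the \<open>\<gamma>\<^sub>j\<close> in \<open>B\<close> have as coefficients of \<open>x\<^sup>h\<close> the critical points of \<open>F\<^sub>B\<close>; those leaving the tree at \<open>B\<close>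
  are the ones with nonzero critical value. The orbit of \<open>B\<close> consists of \<open>N\<close> balls, so all roots
  of the discriminant have order exactly \<open>q = L/M\<close>, and its Newton diagram has the single compact edge
  with polynomial \<open>\<Prod>(v - w u\<^sup>q) = \<Prod>(v\<^sup>M - t u\<^sup>L)\<close>. Non-degeneracy says that the \<open>t\<close> are pairwise different.
  A number \<open>a \<noteq> 0\<close> occurs among the \<open>t\<close> exactly \<open>(N/M) \<nu>(a)\<close> times, where \<open>\<nu>(a)\<close> counts the critical
  points \<open>z\<close> of \<open>F\<^sub>B\<close> with \<open>F\<^sub>B(z)\<^sup>M = a\<close>. Differentiating \<open>F\<^sub>B(z)\<^sup>M = H\<^sub>B(z\<^sup>n)\<close> gives \<open>\<nu>(a) = n c(a) + (n - 1)\<close>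
  or \<open>n c(a)\<close>, according to whether \<open>H\<^sub>B(0) = a\<close> or not, where \<open>c(a)\<close> counts the critical points of
  \<open>H\<^sub>B\<close> with value \<open>a\<close>. The criterion follows from \<open>M | nN\<close> and, if \<open>F\<^sub>B(0) \<noteq> 0\<close>, \<open>M | N\<close>.
\<close>

text \<open>A leading-term expansion of single values f(x, gamma) cannot simply be differentiated,
  so f and its y-derivative are both handled through their linear factors: a root in the ball
  contributes \<open>z - c\<close> to F_B, a root outside it a nonzero constant. The leading term of
  the derivative, computed once from the roots of f and once from its own roots, then gives F_B'
  with multiplicities. The divisibilities come from the N-th power of the basic conjugation: it
  fixes lambda_B, multiplies c by e^(2 pi i m/n) and the value of f by e^(2 pi i N L/M). The two
  cases arise because H_B has one critical point off its zeros fewer than it has distinct zeros.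
  With one zero only a = H_B(0) can have \<nu>(a) > 0, and n > 1 because F_B has two distinct roots.
  With more zeros some c(a) is positive, so nN is at most M, and M | nN gives equality. Conversely,
  if nN = M, the summand n - 1 is harmless: it occurs only if F_B(0) is nonzero, and then M | N
  forces n = 1.\<close>

lemma pcoeff_0 [simp]: "pcoeff 0 r = 0"
  by (simp add: zero_puiseux.rep_eq)

lemma pcoeff_add [simp]: "pcoeff (a + b) r = pcoeff a r + pcoeff b r"
  by (simp add: plus_puiseux.rep_eq)

lemma pcoeff_uminus [simp]: "pcoeff (- a) r = - pcoeff a r"
  by (simp add: uminus_puiseux.rep_eq)

lemma pcoeff_diff [simp]: "pcoeff (a - b) r = pcoeff a r - pcoeff b r"
  unfolding minus_puiseux_def pcoeff_add pcoeff_uminus by simp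

lemma pcoeff_sum: "pcoeff (sum f A) r = (\<Sum>x\<in>A. pcoeff (f x) r)"
  by (induction A rule: infinite_finite_induct) simp_all

lemma pcoeff_of_fps: "pcoeff (of_fps g) r = (if r \<in> \<nat> then g $ nat \<lfloor>r\<rfloor> else 0)"
  by (simp add: of_root.rep_eq)

lemma pcoeff_of_fps_of_nat: "pcoeff (of_fps g) (of_nat k) = g $ k"
  unfolding pcoeff_of_fps by simp

lemma pcoeff_1: "pcoeff 1 r = (if r = 0 then 1 else 0)"
proof -
  have "fps_nth (1 :: complex fps) (nat \<lfloor>r\<rfloor>) = 0" if "r \<in> \<nat>" "r \<noteq> 0"
    using that by (auto elim!: Nats_cases)
  then show ?thesis unfolding one_puiseux_def pcoeff_of_fps by auto
qed

lemma pcoeff_support: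
  obtains N where "N > 0" "\<And>r. pcoeff a r \<noteq> 0 \<Longrightarrow> r * of_nat N \<in> \<nat>"
  using pcoeff[of a] by blast

lemma pcoeff_neg: "r < 0 \<Longrightarrow> pcoeff a r = 0"
proof (rule ccontr)
  assume r: "r < 0" and "pcoeff a r \<noteq> 0"
  obtain N where "N > 0" "\<And>r. pcoeff a r \<noteq> 0 \<Longrightarrow> r * of_nat N \<in> \<nat>"
    by (rule pcoeff_support[of a]) blast
  with \<open>pcoeff a r \<noteq> 0\<close> obtain k where "r * of_nat N = of_nat k" by (auto elim: Nats_cases)
  moreover have "r * of_nat N < 0" using r \<open>N > 0\<close> by (simp add: mult_neg_pos)
  ultimately show False by simp
qed

section \<open>Orders and leading coefficients\<close>

definition ord_ge :: "rat \<Rightarrow> puiseux \<Rightarrow> bool" where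
  "ord_ge r a \<longleftrightarrow> (\<forall>s<r. pcoeff a s = 0)"

text \<open>\<open>c = 0\<close> is allowed, so \<open>leads\<close> joins a lower bound for the
  order with one coefficient. This makes it stable under sums and products, and a polynomial value
  may stand for \<open>c\<close> even at a zero of the polynomial.\<close>

abbreviation leads :: "puiseux \<Rightarrow> rat \<Rightarrow> complex \<Rightarrow> bool" where
  "leads a r c \<equiv> expands a 0 c r"

lemma leads_iff: "leads a r c \<longleftrightarrow> ord_ge r a \<and> pcoeff a r = c"
  by (simp add: expands_def ord_ge_def)

lemma expands_iff: "expands a l c r \<longleftrightarrow> ord_ge r (a - l) \<and> pcoeff (a - l) r = c"
  by (simp add: expands_def ord_ge_def)

lemma ord_ge_pcoeff: "ord_ge r a \<Longrightarrow> s < r \<Longrightarrow> pcoeff a s = 0"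
  by (simp add: ord_ge_def)

lemma ord_ge_0 [simp]: "ord_ge 0 a"
  by (simp add: ord_ge_def pcoeff_neg)

lemma ord_ge_zero [simp]: "ord_ge r 0"
  by (simp add: ord_ge_def)

lemma ord_ge_add: "ord_ge r a \<Longrightarrow> ord_ge r b \<Longrightarrow> ord_ge r (a + b)"
  by (simp add: ord_ge_def)

lemma ord_ge_diff: "ord_ge r a \<Longrightarrow> ord_ge r b \<Longrightarrow> ord_ge r (a - b)"
  by (simp add: ord_ge_def)

lemma ord_ge_minus_commute: "ord_ge r (a - b) \<longleftrightarrow> ord_ge r (b - a)"
  by (auto simp: ord_ge_def)

lemma ord_ge_trans: "ord_ge r (a - b) \<Longrightarrow> ord_ge r (b - c) \<Longrightarrow> ord_ge r (a - c)"
  by (auto simp: ord_ge_def)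

lemma ord_ge_mono: "ord_ge r a \<Longrightarrow> s \<le> r \<Longrightarrow> ord_ge s a"
  by (simp add: ord_ge_def)

lemma leads_mult:
  assumes "leads a r c" "leads b s d"
  shows "leads (a * b) (r + s) (c * d)"
proof -
  have low: "t + t' \<ge> r + s" if "pcoeff a t \<noteq> 0" "pcoeff b t' \<noteq> 0" for t t'
  proof -
    have "t \<ge> r" "t' \<ge> s"
      using that assms unfolding leads_iff ord_ge_def by (meson not_less)+
    then show ?thesis by simp
  qed
  have "pcoeff (a * b) x = 0" if "x < r + s" for x
  proof -
    have "{t. pcoeff a t \<noteq> 0 \<and> pcoeff b (x - t) \<noteq> 0} = {}"
      using low[of _ "x - _"] that by fastforce
    then show ?thesis by (simp only: times_puiseux.rep_eq sum.empty)
  qed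
  moreover have "pcoeff (a * b) (r + s) = c * d"
  proof -
    have "{t. pcoeff a t \<noteq> 0 \<and> pcoeff b (r + s - t) \<noteq> 0} \<subseteq> {r}"
    proof safe
      fix t assume t: "pcoeff a t \<noteq> 0" "pcoeff b (r + s - t) \<noteq> 0"
      have "t \<ge> r" "r + s - t \<ge> s"
        using t assms unfolding leads_iff ord_ge_def by (meson not_less)+
      then show "t = r" by simp
    qed
    then have "pcoeff (a * b) (r + s) = (\<Sum>t\<in>{r}. pcoeff a t * pcoeff b (r + s - t))"
      unfolding times_puiseux.rep_eq by (intro sum.mono_neutral_left) auto
    then show ?thesis using assms by (simp add: leads_iff)
  qed
  ultimately show ?thesis by (simp add: leads_iff ord_ge_def)
qed

lemma ord_ge_mult: "ord_ge r a \<Longrightarrow> ord_ge s b \<Longrightarrow> ord_ge (r + s) (a * b)"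
  using leads_mult[of a _ r b _ s] by (simp add: leads_iff)

lemma ord_ge_mult_left: "ord_ge r b \<Longrightarrow> ord_ge r (a * b)"
  using ord_ge_mult[of 0 a r b] by simp

lemma ord_ge_power: "ord_ge r a \<Longrightarrow> ord_ge (of_nat j * r) (a ^ j)"
proof (induction j)
  case (Suc j)
  from ord_ge_mult[OF Suc.prems Suc.IH[OF Suc.prems]] show ?case by (simp add: algebra_simps)
qed simp

lemma leads_less: "leads a r c \<Longrightarrow> s < r \<Longrightarrow> leads a s 0"
  by (auto simp: leads_iff ord_ge_def)

lemma leads_add: "leads a r c \<Longrightarrow> leads b r d \<Longrightarrow> leads (a + b) r (c + d)"
  by (simp add: leads_iff ord_ge_add)

lemma leads_zero: "leads 0 r 0"
  by (simp add: leads_iff)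

lemma leads_unique:
  assumes "leads a r c" "leads a s d" "c \<noteq> 0" "d \<noteq> 0"
  shows "r = s" "c = d"
proof -
  show "r = s"
    using assms unfolding leads_iff ord_ge_def by (metis linorder_neqE)
  with assms show "c = d" by (simp add: leads_iff)
qed

text \<open>All exponents lie in (1/N) times the naturals, which is well-ordered; an arbitrary set
  of rationals need not have a least element.\<close>

lemma leads_exists:
  assumes "a \<noteq> 0"
  obtains r c where "c \<noteq> 0" "leads a r c"
proof -
  obtain N where N: "N > 0" "\<And>r. pcoeff a r \<noteq> 0 \<Longrightarrow> r * of_nat N \<in> \<nat>"
    by (rule pcoeff_support[of a]) blast
  have form: "\<exists>k. r = of_nat k / of_nat N" if "pcoeff a r \<noteq> 0" for r
  proof -
    have "r * of_nat N \<in> \<nat>" using N(2) that by blast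
    then obtain k where "r * of_nat N = of_nat k" by (auto elim: Nats_cases)
    then show ?thesis using N(1) by (auto simp: field_simps)
  qed
  obtain r where "pcoeff a r \<noteq> 0" using assms puiseux_eqI[of a 0] by auto
  then obtain k where k: "pcoeff a (of_nat k / of_nat N) \<noteq> 0" using form by metis
  define k0 where "k0 = (LEAST k. pcoeff a (of_nat k / of_nat N) \<noteq> 0)"
  have k0: "pcoeff a (of_nat k0 / of_nat N) \<noteq> 0"
    unfolding k0_def by (rule LeastI[of _ k]) (rule k)
  have "pcoeff a s = 0" if "s < of_nat k0 / of_nat N" for s
  proof (rule ccontr)
    assume s: "pcoeff a s \<noteq> 0"
    then obtain l where l: "s = of_nat l / of_nat N" using form by blast
    with s have "k0 \<le> l" unfolding k0_def by (intro Least_le) simp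
    with that l N(1) show False by (simp add: field_simps)
  qed
  then have "leads a (of_nat k0 / of_nat N) (pcoeff a (of_nat k0 / of_nat N))"
    by (simp add: leads_iff ord_ge_def)
  then show ?thesis by (rule that[OF k0])
qed

text \<open>Leading coefficients multiply to a nonzero number. The instance makes
  \<open>proots\<close> available over the Puiseux ring, where conjugate roots are compared as
  multisets.\<close>

instance puiseux :: idom
proof
  fix a b :: puiseux
  assume "a \<noteq> 0" "b \<noteq> 0"
  then obtain r c s d where "c \<noteq> 0" "leads a r c" "d \<noteq> 0" "leads b s d"
    by (metis leads_exists)
  then have "pcoeff (a * b) (r + s) \<noteq> 0"
    using leads_mult[of a c r b d s] by (simp add: leads_iff)
  then show "a * b \<noteq> 0" by auto
qed

lemma leads_Least: "leads a r c \<Longrightarrow> c \<noteq> 0 \<Longrightarrow> (LEAST r. pcoeff a r \<noteq> 0) = r"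
  by (intro Least_equality) (auto simp: leads_iff ord_ge_def not_less[symmetric])

lemma pord_eq_Fin_iff: "pord a = Fin r \<longleftrightarrow> (\<exists>c. c \<noteq> 0 \<and> leads a r c)"
proof
  assume "pord a = Fin r"
  then have "a \<noteq> 0" "(LEAST r. pcoeff a r \<noteq> 0) = r"
    by (auto simp: pord_def split: if_splits)
  then show "\<exists>c. c \<noteq> 0 \<and> leads a r c" by (metis leads_exists leads_Least)
next
  assume "\<exists>c. c \<noteq> 0 \<and> leads a r c"
  then show "pord a = Fin r" by (auto simp: pord_def leads_Least) (simp add: leads_iff)
qed

lemma Fin_le_pord_iff: "Fin r \<le> pord a \<longleftrightarrow> ord_ge r a"
proof (cases "a = 0")
  case False
  then obtain s c where s: "c \<noteq> 0" "leads a s c" by (rule leads_exists)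
  then have "pord a = Fin s" by (auto simp: pord_eq_Fin_iff)
  then show ?thesis using s by (auto simp: leads_iff ord_ge_def) (meson not_less)
qed (simp add: pord_def)

lemma ord_ge_all_imp_0: "(\<And>r. ord_ge r a) \<Longrightarrow> a = 0"
  by (rule puiseux_eqI) (metis ord_ge_pcoeff pcoeff_0 gt_ex)

lemma frac_series_ord_ge:
  assumes "\<gamma> \<in> frac_series"
  obtains \<delta> where "\<delta> > 0" "ord_ge \<delta> \<gamma>"
proof (cases "\<gamma> = 0")
  case True
  then show ?thesis using that[of 1] by simp
next
  case False
  then obtain r c where "c \<noteq> 0" "leads \<gamma> r c" by (rule leads_exists)
  moreover from this have "pord \<gamma> = Fin r" by (auto simp: pord_eq_Fin_iff)
  ultimately show ?thesis using that[of r] assms by (auto simp: frac_series_def leads_iff)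
qed

section \<open>Rotations\<close>

text \<open>The character e^(2 pi i r), whose kernel is the integers. It turns identities between
  roots of unity into integrality of rationals and so into divisibility.\<close>

definition chi :: "rat \<Rightarrow> complex" where
  "chi r = cis (2 * pi * of_rat r)"

lemma chi_add: "chi (r + s) = chi r * chi s"
  by (simp add: chi_def of_rat_add cis_mult algebra_simps)

lemma chi_0 [simp]: "chi 0 = 1"
  by (simp add: chi_def)

lemma chi_nonzero [simp]: "chi r \<noteq> 0"
  by (simp add: chi_def)

lemma chi_eq_1_iff: "chi r = 1 \<longleftrightarrow> r \<in> \<int>"
proof
  assume "chi r = 1"
  then have "cos (2 * pi * of_rat r) = 1" by (simp add: chi_def complex_eq_iff)
  then obtain x where "2 * pi * of_rat r = real_of_int x * 2 * pi"
    using cos_one_2pi_int by auto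
  then have "(of_rat r :: real) = of_rat (of_int x)" by simp
  then have "r = of_int x" unfolding of_rat_eq_iff .
  then show "r \<in> \<int>" by simp
next
  assume "r \<in> \<int>"
  then show "chi r = 1" by (auto simp: chi_def elim!: Ints_cases)
qed

lemma chi_of_nat_mult: "chi (of_nat k * r) = chi r ^ k"
  by (simp add: chi_def Complex.DeMoivre of_rat_mult mult_ac)

text \<open>The automorphism of the whole ring that substitutes \<open>e\<^bsup>2\<pi>ik/D\<^esup> x\<^bsup>1/D\<^esup>\<close> for \<open>x\<^bsup>1/D\<^esup>\<close>,
  compatibly for all \<open>D\<close>.\<close>

lift_definition rot :: "nat \<Rightarrow> puiseux \<Rightarrow> puiseux" is
  "\<lambda>k a r. a r * chi (of_nat k * r)"
  by auto

lemma rot_0 [simp]: "rot k 0 = 0"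
  by transfer auto

lemma rot_add [simp]: "rot k (a + b) = rot k a + rot k b"
  by transfer (auto simp: algebra_simps)

lemma rot_uminus [simp]: "rot k (- a) = - rot k a"
  by transfer auto

lemma rot_diff [simp]: "rot k (a - b) = rot k a - rot k b"
  unfolding minus_puiseux_def rot_add rot_uminus by simp

lemma rot_of_fps [simp]: "rot k (of_fps g) = of_fps g"
proof (rule puiseux_eqI)
  fix r
  have "chi (of_nat k * r) = 1" if "r \<in> \<nat>"
    using that by (auto simp: chi_eq_1_iff elim!: Nats_cases)
  then show "pcoeff (rot k (of_fps g)) r = pcoeff (of_fps g) r"
    unfolding rot.rep_eq pcoeff_of_fps by auto
qed

lemma rot_1 [simp]: "rot k 1 = 1"
  unfolding one_puiseux_def by (rule rot_of_fps)

lemma rot_mult [simp]: "rot k (a * b) = rot k a * rot k b"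
proof (rule puiseux_eqI)
  fix r
  have "{s. pcoeff (rot k a) s \<noteq> 0 \<and> pcoeff (rot k b) (r - s) \<noteq> 0} =
      {s. pcoeff a s \<noteq> 0 \<and> pcoeff b (r - s) \<noteq> 0}"
    by (simp add: rot.rep_eq)
  moreover have "pcoeff (rot k a) s * pcoeff (rot k b) (r - s) =
      pcoeff a s * pcoeff b (r - s) * chi (of_nat k * r)" for s
    using chi_add[of "of_nat k * s" "of_nat k * (r - s)"]
    by (simp add: rot.rep_eq algebra_simps)
  ultimately show "pcoeff (rot k (a * b)) r = pcoeff (rot k a * rot k b) r"
    unfolding times_puiseux.rep_eq rot.rep_eq[of k "a * b"] sum_distrib_right by simp
qed

lemma rot_power [simp]: "rot k (a ^ j) = rot k a ^ j"
  by (induction j) auto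

lemma rot_sum [simp]: "rot k (sum f A) = (\<Sum>x\<in>A. rot k (f x))"
  by (induction A rule: infinite_finite_induct) auto

lemma rot_zero_index [simp]: "rot 0 a = a"
  by (rule puiseux_eqI) (simp add: rot.rep_eq)

lemma rot_rot: "rot k (rot l a) = rot (k + l) a"
  by (rule puiseux_eqI) (simp add: rot.rep_eq distrib_right chi_add)

lemma rot_eq_iff [simp]: "rot k a = rot k b \<longleftrightarrow> a = b"
proof
  assume eq: "rot k a = rot k b"
  show "a = b"
  proof (rule puiseux_eqI)
    fix r
    from eq have "pcoeff (rot k a) r = pcoeff (rot k b) r" by simp
    then show "pcoeff a r = pcoeff b r" by (simp add: rot.rep_eq)
  qed
qed simp

lemma ord_ge_rot [simp]: "ord_ge r (rot k a) \<longleftrightarrow> ord_ge r a"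
  by (simp add: ord_ge_def rot.rep_eq)

lemma leads_rot: "leads a r c \<Longrightarrow> leads (rot k a) r (c * chi (of_nat k * r))"
  by (simp add: leads_iff rot.rep_eq)

lemma pord_rot [simp]: "pord (rot k a) = pord a"
proof -
  have "Fin r \<le> pord (rot k a) \<longleftrightarrow> Fin r \<le> pord a" for r
    by (simp add: Fin_le_pord_iff)
  moreover have "rot k a = 0 \<longleftrightarrow> a = 0" using rot_eq_iff[of k a 0] by simp
  ultimately show ?thesis by (simp add: pord_def rot.rep_eq)
qed

text \<open>If \<open>r * D\<close> is an integer \<open>l\<close>, then \<open>chi (k * r)\<close>
  is the \<open>l\<close>-th power of \<open>chi (k / D)\<close>. This connects the action of the
  D-th roots of unity with \<open>rot\<close>, which is a ring automorphism without any restriction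
  on denominators.\<close>

lemma pconj_eq_rot:
  assumes "D > 0" "\<And>r. pcoeff a r \<noteq> 0 \<Longrightarrow> r * of_nat D \<in> \<nat>"
  shows "pconj D (chi (of_nat k / of_nat D)) a = rot k a"
proof (rule puiseux_eqI)
  fix r
  show "pcoeff (pconj D (chi (of_nat k / of_nat D)) a) r = pcoeff (rot k a) r"
  proof (cases "pcoeff a r = 0")
    case False
    with assms(2) obtain l where l: "r * of_nat D = of_nat l" by (auto elim: Nats_cases)
    then have "of_nat k * r = of_nat l * (of_nat k / of_nat D)"
      using assms(1) by (simp add: field_simps)
    then have "chi (of_nat k * r) = chi (of_nat k / of_nat D) ^ l"
      by (simp only: chi_of_nat_mult)
    then show ?thesis by (simp add: pconj.rep_eq rot.rep_eq l)
  qed (simp add: pconj.rep_eq rot.rep_eq)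
qed

lemma root_of_unity_eq_chi:
  assumes "D > 0" "\<theta> ^ D = 1"
  obtains k where "\<theta> = chi (of_nat k / of_nat D)"
proof -
  have "\<theta> \<in> {z. z ^ D = 1}" using assms by simp
  also have "\<dots> = (\<lambda>k. cis (2 * pi * real k / real D)) ` {..<D}"
    using Complex.bij_betw_roots_unity[OF assms(1)] by (auto simp: bij_betw_def)
  finally obtain k where "\<theta> = cis (2 * pi * real k / real D)" by blast
  then show ?thesis using that[of k] by (simp add: chi_def of_rat_divide)
qed

section \<open>Substitution into power series over the Puiseux ring\<close>

text \<open>Substitution as an x-adic limit with rate \<open>\<delta>\<close>, in use a positive
  lower bound for the order of \<open>\<gamma>\<close>. The coefficients of \<open>G\<close> may be
  Puiseux series, as the factors y - \<alpha> require; \<open>psubst\<close> only takes power series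
  in x.\<close>

definition peval :: "rat \<Rightarrow> puiseux fps \<Rightarrow> puiseux \<Rightarrow> puiseux \<Rightarrow> bool" where
  "peval \<delta> G \<gamma> p \<longleftrightarrow> (\<forall>J. ord_ge (of_nat J * \<delta>) (p - (\<Sum>j<J. G $ j * \<gamma> ^ j)))"

lemma peval_unique:
  assumes "\<delta> > 0" "peval \<delta> G \<gamma> p" "peval \<delta> G \<gamma> p'"
  shows "p = p'"
proof -
  have "ord_ge r (p - p')" for r
  proof -
    obtain J :: nat where "r / \<delta> < of_nat J" using reals_Archimedean2 by blast
    then have "r \<le> of_nat J * \<delta>" using assms(1) by (simp add: field_simps)
    moreover have "ord_ge (of_nat J * \<delta>) (p - p')"
      using assms(2,3) unfolding peval_def by (meson ord_ge_minus_commute ord_ge_trans)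
    ultimately show ?thesis by (rule ord_ge_mono[rotated])
  qed
  then have "p - p' = 0" by (rule ord_ge_all_imp_0)
  then show ?thesis by simp
qed

lemma peval_psubst:
  assumes "\<delta> > 0" "ord_ge \<delta> \<gamma>"
  shows "peval \<delta> (germ_to_puiseux f) \<gamma> (psubst f \<gamma>)"
  unfolding peval_def
proof
  fix J
  let ?t = "\<lambda>j. of_fps (f $ j) * \<gamma> ^ j"
  have "pcoeff (psubst f \<gamma>) s = pcoeff (\<Sum>j<J. ?t j) s" if s: "s < of_nat J * \<delta>" for s
  proof -
    \<comment> \<open>The \<open>j\<close>-th summand has order at least
      \<open>j * \<delta>\<close>, so only \<open>j < J\<close> can reach an exponent below
      \<open>J * \<delta>\<close>.\<close>
    have "{j. pcoeff (?t j) s \<noteq> 0} \<subseteq> {..<J}"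
    proof
      fix j assume "j \<in> {j. pcoeff (?t j) s \<noteq> 0}"
      moreover have "ord_ge (of_nat j * \<delta>) (?t j)"
        using assms by (intro ord_ge_mult_left ord_ge_power)
      ultimately have "of_nat j * \<delta> \<le> s" by (auto simp: ord_ge_def not_less[symmetric])
      with s have "of_nat j * \<delta> < of_nat J * \<delta>" by simp
      with assms(1) show "j \<in> {..<J}" by simp
    qed
    then show ?thesis
      unfolding psubst.rep_eq pcoeff_sum by (intro sum.mono_neutral_left) auto
  qed
  then show "ord_ge (of_nat J * \<delta>) (psubst f \<gamma> - (\<Sum>j<J. germ_to_puiseux f $ j * \<gamma> ^ j))"
    by (simp add: ord_ge_def germ_to_puiseux_def)
qed

lemma peval_add: "peval \<delta> G \<gamma> p \<Longrightarrow> peval \<delta> H \<gamma> q \<Longrightarrow> peval \<delta> (G + H) \<gamma> (p + q)"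
  unfolding peval_def
proof
  fix J
  assume "\<forall>J. ord_ge (of_nat J * \<delta>) (p - (\<Sum>j<J. G $ j * \<gamma> ^ j))"
    and "\<forall>J. ord_ge (of_nat J * \<delta>) (q - (\<Sum>j<J. H $ j * \<gamma> ^ j))"
  then have "ord_ge (of_nat J * \<delta>)
      ((p - (\<Sum>j<J. G $ j * \<gamma> ^ j)) + (q - (\<Sum>j<J. H $ j * \<gamma> ^ j)))"
    by (blast intro: ord_ge_add)
  then show "ord_ge (of_nat J * \<delta>) (p + q - (\<Sum>j<J. (G + H) $ j * \<gamma> ^ j))"
    by (simp only: fps_add_nth distrib_right sum.distrib add_diff_add)
qed

lemma peval_linear_mult:
  assumes "ord_ge \<delta> \<gamma>" "peval \<delta> G \<gamma> p"
  shows "peval \<delta> ((fps_X - fps_const \<alpha>) * G) \<gamma> ((\<gamma> - \<alpha>) * p)"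
  unfolding peval_def
proof
  fix J
  let ?S = "\<lambda>J. \<Sum>j<J. G $ j * \<gamma> ^ j"
  let ?T = "\<lambda>J. \<Sum>j<J. ((fps_X - fps_const \<alpha>) * G) $ j * \<gamma> ^ j"
  \<comment> \<open>Shifting the index leaves one boundary term; its order is at least
    \<open>J * \<delta>\<close>, so the limit is not disturbed.\<close>
  have T: "?T J = (\<gamma> - \<alpha>) * ?S J - (if J = 0 then 0 else G $ (J - 1) * \<gamma> ^ J)" for J
  proof (induction J)
    case (Suc J)
    have nth: "((fps_X - fps_const \<alpha>) * G) $ J = (if J = 0 then 0 else G $ (J - 1)) - \<alpha> * G $ J"
      by (simp add: left_diff_distrib)
    show ?case
      unfolding sum.lessThan_Suc Suc.IH nth by (cases "J = 0") (auto simp: algebra_simps)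
  qed simp
  have "(\<gamma> - \<alpha>) * p - ?T J = (\<gamma> - \<alpha>) * (p - ?S J) + (if J = 0 then 0 else G $ (J - 1) * \<gamma> ^ J)"
    unfolding T by (simp add: algebra_simps)
  moreover have "ord_ge (of_nat J * \<delta>) \<dots>"
    using assms by (auto simp: peval_def intro!: ord_ge_add ord_ge_mult_left ord_ge_power)
  ultimately show "ord_ge (of_nat J * \<delta>) ((\<gamma> - \<alpha>) * p - ?T J)" by simp
qed

lemma peval_prod_linear:
  assumes "ord_ge \<delta> \<gamma>" "peval \<delta> G \<gamma> p"
  shows "peval \<delta> (G * (\<Prod>\<alpha>\<leftarrow>\<alpha>s. fps_X - fps_const \<alpha>)) \<gamma> (p * (\<Prod>\<alpha>\<leftarrow>\<alpha>s. \<gamma> - \<alpha>))"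
proof (induction \<alpha>s)
  case (Cons \<alpha> \<alpha>s)
  from peval_linear_mult[OF assms(1) this, of \<alpha>] show ?case by (simp add: mult_ac)
qed (use assms in simp)

text \<open>The y-derivative of the product of the y - \<alpha> at y = \<gamma>, by the product
  rule. Unlike a logarithmic derivative it makes sense when \<gamma> is one of the \<alpha>.\<close>

primrec deriv_prod :: "puiseux \<Rightarrow> puiseux list \<Rightarrow> puiseux" where
  "deriv_prod \<gamma> [] = 0"
| "deriv_prod \<gamma> (\<alpha> # \<alpha>s) = (\<Prod>\<alpha>\<leftarrow>\<alpha>s. \<gamma> - \<alpha>) + (\<gamma> - \<alpha>) * deriv_prod \<gamma> \<alpha>s"

lemma peval_deriv_prod_linear:
  assumes "ord_ge \<delta> \<gamma>" "peval \<delta> G \<gamma> p" "peval \<delta> (fps_deriv G) \<gamma> p'"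
  shows "peval \<delta> (fps_deriv (G * (\<Prod>\<alpha>\<leftarrow>\<alpha>s. fps_X - fps_const \<alpha>))) \<gamma>
           (p' * (\<Prod>\<alpha>\<leftarrow>\<alpha>s. \<gamma> - \<alpha>) + p * deriv_prod \<gamma> \<alpha>s)"
proof (induction \<alpha>s)
  case (Cons \<alpha> \<alpha>s)
  let ?P = "G * (\<Prod>\<alpha>\<leftarrow>\<alpha>s. fps_X - fps_const \<alpha>)"
  have "G * (\<Prod>\<alpha>\<leftarrow>\<alpha> # \<alpha>s. fps_X - fps_const \<alpha>) = (fps_X - fps_const \<alpha>) * ?P"
    by (simp add: mult_ac)
  then have "fps_deriv (G * (\<Prod>\<alpha>\<leftarrow>\<alpha> # \<alpha>s. fps_X - fps_const \<alpha>)) =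
      (fps_X - fps_const \<alpha>) * fps_deriv ?P + ?P"
    by (simp only: fps_deriv_mult) simp
  then show ?case
    using peval_add[OF peval_linear_mult[OF assms(1) Cons.IH, of \<alpha>]
        peval_prod_linear[OF assms(1,2), of \<alpha>s]]
    by (simp add: algebra_simps)
qed (use assms in simp)

lemma peval_rot:
  "peval \<delta> G \<gamma> p \<Longrightarrow> peval \<delta> (Abs_fps (\<lambda>j. rot k (G $ j))) (rot k \<gamma>) (rot k p)"
  unfolding peval_def
proof
  fix J assume "\<forall>J. ord_ge (of_nat J * \<delta>) (p - (\<Sum>j<J. G $ j * \<gamma> ^ j))"
  then have "ord_ge (of_nat J * \<delta>) (rot k (p - (\<Sum>j<J. G $ j * \<gamma> ^ j)))"
    unfolding ord_ge_rot by blast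
  then show "ord_ge (of_nat J * \<delta>)
      (rot k p - (\<Sum>j<J. Abs_fps (\<lambda>j. rot k (G $ j)) $ j * rot k \<gamma> ^ j))"
    by simp
qed

lemma psubst_rot:
  assumes "\<delta> > 0" "ord_ge \<delta> \<gamma>"
  shows "psubst f (rot k \<gamma>) = rot k (psubst f \<gamma>)"
proof (rule peval_unique[OF assms(1)])
  show "peval \<delta> (germ_to_puiseux f) (rot k \<gamma>) (psubst f (rot k \<gamma>))"
    using assms by (intro peval_psubst) auto
  have "Abs_fps (\<lambda>j. rot k (germ_to_puiseux f $ j)) = germ_to_puiseux f"
    unfolding germ_to_puiseux_def by (simp only: fps_nth_Abs_fps rot_of_fps)
  then show "peval \<delta> (germ_to_puiseux f) (rot k \<gamma>) (rot k (psubst f \<gamma>))"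
    using peval_rot[OF peval_psubst[OF assms, of f], of k] by simp
qed

text \<open>The linear factors are not series to which \<open>psubst\<close> applies. Both sides are
  limits of partial sums of the same power series, and such limits are unique.\<close>

lemma psubst_factorization:
  assumes "\<delta> > 0" "ord_ge \<delta> \<gamma>"
    and "germ_to_puiseux f = germ_to_puiseux u * (\<Prod>\<alpha>\<leftarrow>\<alpha>s. fps_X - fps_const \<alpha>)"
  shows "psubst f \<gamma> = psubst u \<gamma> * (\<Prod>\<alpha>\<leftarrow>\<alpha>s. \<gamma> - \<alpha>)"
  using peval_unique[OF assms(1)] peval_psubst[OF assms(1,2)]
    peval_prod_linear[OF assms(2) peval_psubst[OF assms(1,2)]] assms(3) by metis

lemma of_fps_add [simp]: "of_fps (g + h) = of_fps g + of_fps h"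
  by (simp add: of_root_add)

lemma of_fps_mult [simp]: "of_fps (g * h) = of_fps g * of_fps h"
  by (simp add: of_root_mult)

lemma of_fps_of_nat: "of_fps (of_nat k) = of_nat k"
proof (induction k)
  case (Suc k)
  then show ?case using of_root_1[of 1] by (simp del: of_fps_add add: of_root_add[symmetric])
qed (use of_root_0[of 1] in simp)

lemma germ_to_puiseux_deriv: "germ_to_puiseux (fps_deriv f) = fps_deriv (germ_to_puiseux f)"
proof (rule fps_ext)
  fix j
  show "germ_to_puiseux (fps_deriv f) $ j = fps_deriv (germ_to_puiseux f) $ j"
    unfolding germ_to_puiseux_def fps_deriv_nth fps_nth_Abs_fps of_fps_mult of_fps_of_nat ..
qed

lemma psubst_deriv_factorization:
  assumes "\<delta> > 0" "ord_ge \<delta> \<gamma>"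
    and "germ_to_puiseux f = germ_to_puiseux u * (\<Prod>\<alpha>\<leftarrow>\<alpha>s. fps_X - fps_const \<alpha>)"
  shows "psubst (fps_deriv f) \<gamma> =
    psubst (fps_deriv u) \<gamma> * (\<Prod>\<alpha>\<leftarrow>\<alpha>s. \<gamma> - \<alpha>) + psubst u \<gamma> * deriv_prod \<gamma> \<alpha>s"
proof (rule peval_unique[OF assms(1) peval_psubst[OF assms(1,2)]])
  show "peval \<delta> (germ_to_puiseux (fps_deriv f)) \<gamma>
      (psubst (fps_deriv u) \<gamma> * (\<Prod>\<alpha>\<leftarrow>\<alpha>s. \<gamma> - \<alpha>) + psubst u \<gamma> * deriv_prod \<gamma> \<alpha>s)"
    unfolding germ_to_puiseux_deriv assms(3)
    by (intro peval_deriv_prod_linear peval_psubst assms)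
      (simp add: germ_to_puiseux_deriv[symmetric] peval_psubst assms)
qed

lemma psubst_unit_leads:
  assumes "\<delta> > 0" "ord_ge \<delta> \<gamma>"
  shows "leads (psubst u \<gamma>) 0 (u $ 0 $ 0)"
proof -
  \<comment> \<open>The case \<open>J = 1\<close> of \<open>peval\<close>: everything after the
    first summand has positive order.\<close>
  have "ord_ge \<delta> (psubst u \<gamma> - of_fps (u $ 0))"
    using peval_psubst[OF assms, of u] unfolding peval_def
    by (auto dest!: spec[of _ 1] simp: germ_to_puiseux_def)
  then have "pcoeff (psubst u \<gamma>) 0 = pcoeff (of_fps (u $ 0)) 0"
    using assms(1) by (auto simp: ord_ge_def)
  then show ?thesis using pcoeff_of_fps_of_nat[of "u $ 0" 0] by (simp add: leads_iff)
qed

section \<open>Leading coefficients along a ball\<close>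

text \<open>For \<open>\<gamma> = l + c x\<^sup>h + \<cdots>\<close> the difference \<open>\<gamma> - \<alpha>\<close> has the leading term
  \<open>lpoly l h \<alpha> (c) \<cdot> x\<^bsup>ldeg l h \<alpha>\<^esup>\<close>.\<close>

definition ldeg :: "puiseux \<Rightarrow> rat \<Rightarrow> puiseux \<Rightarrow> rat" where
  "ldeg l h \<alpha> = (if ord_ge h (\<alpha> - l) then h else (LEAST r. pcoeff (l - \<alpha>) r \<noteq> 0))"

definition lpoly :: "puiseux \<Rightarrow> rat \<Rightarrow> puiseux \<Rightarrow> complex poly" where
  "lpoly l h \<alpha> = (if ord_ge h (\<alpha> - l) then [:- pcoeff (\<alpha> - l) h, 1:]
     else [:pcoeff (l - \<alpha>) (ldeg l h \<alpha>):])"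

lemma far_leads:
  assumes "\<not> ord_ge h (\<alpha> - l)"
  shows "ldeg l h \<alpha> < h" "pcoeff (l - \<alpha>) (ldeg l h \<alpha>) \<noteq> 0"
    "leads (l - \<alpha>) (ldeg l h \<alpha>) (pcoeff (l - \<alpha>) (ldeg l h \<alpha>))"
proof -
  have "l - \<alpha> \<noteq> 0" using assms by auto
  then obtain r c where rc: "c \<noteq> 0" "leads (l - \<alpha>) r c" by (rule leads_exists)
  then have r: "ldeg l h \<alpha> = r" using assms leads_Least[OF rc(2,1)] unfolding ldeg_def by simp
  have "\<not> ord_ge h (l - \<alpha>)" using assms ord_ge_minus_commute by blast
  then have "r < h" using rc(2) by (auto simp: leads_iff intro: ord_ge_mono simp: not_less[symmetric])
  with rc r show "ldeg l h \<alpha> < h" "pcoeff (l - \<alpha>) (ldeg l h \<alpha>) \<noteq> 0"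
    "leads (l - \<alpha>) (ldeg l h \<alpha>) (pcoeff (l - \<alpha>) (ldeg l h \<alpha>))"
    by (auto simp: leads_iff)
qed

lemma lpoly_nonzero: "lpoly l h \<alpha> \<noteq> 0"
  using far_leads(2)[of h \<alpha> l] by (auto simp: lpoly_def)

lemma proots_lpoly:
  "proots (lpoly l h \<alpha>) = (if ord_ge h (\<alpha> - l) then {#pcoeff (\<alpha> - l) h#} else {#})"
  by (auto simp: lpoly_def)

lemma leads_diff_lpoly:
  assumes "expands \<gamma> l c h"
  shows "leads (\<gamma> - \<alpha>) (ldeg l h \<alpha>) (poly (lpoly l h \<alpha>) c)"
proof (cases "ord_ge h (\<alpha> - l)")
  case True
  have "ord_ge h (\<gamma> - \<alpha>)"
    using True assms ord_ge_minus_commute ord_ge_trans unfolding expands_iff by blast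
  then show ?thesis using True assms by (auto simp: leads_iff expands_iff ldeg_def lpoly_def)
next
  case False
  have "leads (\<gamma> - l) (ldeg l h \<alpha>) 0"
    using assms far_leads(1)[OF False] by (auto simp: expands_iff leads_iff ord_ge_def)
  from leads_add[OF this far_leads(3)[OF False]] show ?thesis
    using False by (simp add: lpoly_def)
qed

lemma leads_prod_lpoly:
  assumes "expands \<gamma> l c h"
  shows "leads (\<Prod>\<alpha>\<leftarrow>\<alpha>s. \<gamma> - \<alpha>) (\<Sum>\<alpha>\<leftarrow>\<alpha>s. ldeg l h \<alpha>) (poly (\<Prod>\<alpha>\<leftarrow>\<alpha>s. lpoly l h \<alpha>) c)"
proof (induction \<alpha>s)
  case (Cons \<alpha> \<alpha>s)
  from leads_mult[OF leads_diff_lpoly[OF assms, of \<alpha>] this] show ?case by simp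
qed (simp add: leads_iff pcoeff_1)

lemma leads_deriv_prod:
  assumes "expands \<gamma> l c h"
  shows "leads (deriv_prod \<gamma> \<alpha>s) ((\<Sum>\<alpha>\<leftarrow>\<alpha>s. ldeg l h \<alpha>) - h)
           (poly (pderiv (\<Prod>\<alpha>\<leftarrow>\<alpha>s. lpoly l h \<alpha>)) c)"
proof (induction \<alpha>s)
  case (Cons \<alpha> \<alpha>s)
  let ?r = "\<Sum>\<alpha>\<leftarrow>\<alpha>s. ldeg l h \<alpha>" and ?P = "\<Prod>\<alpha>\<leftarrow>\<alpha>s. lpoly l h \<alpha>"
  have "leads (\<Prod>\<alpha>\<leftarrow>\<alpha>s. \<gamma> - \<alpha>) (ldeg l h \<alpha> + (?r - h)) (poly (pderiv (lpoly l h \<alpha>) * ?P) c)"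
  proof (cases "ord_ge h (\<alpha> - l)")
    case True
    then show ?thesis using leads_prod_lpoly[OF assms, of \<alpha>s]
      by (simp add: ldeg_def lpoly_def pderiv_pCons)
  next
    case False
    \<comment> \<open>Outside the ball \<open>ldeg < h\<close>, so this summand has order strictly
      above the claimed exponent, in agreement with the vanishing derivative of the constant
      \<open>lpoly\<close>.\<close>
    then have "leads (\<Prod>\<alpha>\<leftarrow>\<alpha>s. \<gamma> - \<alpha>) (ldeg l h \<alpha> + (?r - h)) 0"
      using far_leads(1)[OF False] by (intro leads_less[OF leads_prod_lpoly[OF assms]]) simp
    then show ?thesis using False by (simp add: lpoly_def pderiv_pCons)
  qed
  from leads_add[OF this leads_mult[OF leads_diff_lpoly[OF assms, of \<alpha>] Cons.IH]]
  show ?case by (simp add: pderiv_mult algebra_simps)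
qed (simp add: leads_iff)

lemma expands_ord_ge:
  assumes "\<delta> > 0" "ord_ge \<delta> l" "h > 0" "expands \<gamma> l c h"
  shows "min \<delta> h > 0" "ord_ge (min \<delta> h) \<gamma>"
proof -
  have "ord_ge (min \<delta> h) (l + (\<gamma> - l))"
    using assms by (intro ord_ge_add) (auto simp: expands_iff intro: ord_ge_mono)
  then show "min \<delta> h > 0" "ord_ge (min \<delta> h) \<gamma>" using assms by simp_all
qed

lemma leads_psubst:
  assumes "\<delta> > 0" "ord_ge \<delta> l" "h > 0" "expands \<gamma> l c h"
    and "germ_to_puiseux f = germ_to_puiseux u * (\<Prod>\<alpha>\<leftarrow>\<alpha>s. fps_X - fps_const \<alpha>)"
  shows "leads (psubst f \<gamma>) (\<Sum>\<alpha>\<leftarrow>\<alpha>s. ldeg l h \<alpha>)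
           (poly (smult (u $ 0 $ 0) (\<Prod>\<alpha>\<leftarrow>\<alpha>s. lpoly l h \<alpha>)) c)"
proof -
  note \<gamma> = expands_ord_ge[OF assms(1-4)]
  from leads_mult[OF psubst_unit_leads[OF \<gamma>] leads_prod_lpoly[OF assms(4)]]
  show ?thesis unfolding psubst_factorization[OF \<gamma> assms(5)] by simp
qed

text \<open>This is \<open>\<partial>/\<partial>z\<close> of \<open>f(x, l + z x\<^sup>h) = F(z) x\<^sup>q + \<cdots>\<close>.\<close>

lemma leads_psubst_deriv:
  assumes "\<delta> > 0" "ord_ge \<delta> l" "h > 0" "expands \<gamma> l c h"
    and "germ_to_puiseux f = germ_to_puiseux u * (\<Prod>\<alpha>\<leftarrow>\<alpha>s. fps_X - fps_const \<alpha>)"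
  shows "leads (psubst (fps_deriv f) \<gamma>) ((\<Sum>\<alpha>\<leftarrow>\<alpha>s. ldeg l h \<alpha>) - h)
           (poly (pderiv (smult (u $ 0 $ 0) (\<Prod>\<alpha>\<leftarrow>\<alpha>s. lpoly l h \<alpha>))) c)"
proof -
  let ?q = "\<Sum>\<alpha>\<leftarrow>\<alpha>s. ldeg l h \<alpha>"
  note \<gamma> = expands_ord_ge[OF assms(1-4)]
  \<comment> \<open>Differentiating the unit leaves order at least \<open>?q\<close>, above
    \<open>?q - h\<close>; only the derivative of the product contributes.\<close>
  have "ord_ge ?q (psubst (fps_deriv u) \<gamma> * (\<Prod>\<alpha>\<leftarrow>\<alpha>s. \<gamma> - \<alpha>))"
    using leads_prod_lpoly[OF assms(4)] by (intro ord_ge_mult_left) (simp add: leads_iff)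
  then have "leads (psubst (fps_deriv u) \<gamma> * (\<Prod>\<alpha>\<leftarrow>\<alpha>s. \<gamma> - \<alpha>)) (?q - h) 0"
    using assms(3) by (simp add: leads_iff ord_ge_def)
  moreover have "leads (psubst u \<gamma> * deriv_prod \<gamma> \<alpha>s) (?q - h)
      (u $ 0 $ 0 * poly (pderiv (\<Prod>\<alpha>\<leftarrow>\<alpha>s. lpoly l h \<alpha>)) c)"
    using leads_mult[OF psubst_unit_leads[OF \<gamma>] leads_deriv_prod[OF assms(4)]] by simp
  ultimately have "leads (psubst (fps_deriv u) \<gamma> * (\<Prod>\<alpha>\<leftarrow>\<alpha>s. \<gamma> - \<alpha>) + psubst u \<gamma> * deriv_prod \<gamma> \<alpha>s)
      (?q - h) (0 + u $ 0 $ 0 * poly (pderiv (\<Prod>\<alpha>\<leftarrow>\<alpha>s. lpoly l h \<alpha>)) c)"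
    by (rule leads_add)
  then show ?thesis
    unfolding psubst_deriv_factorization[OF \<gamma> assms(5)] by (simp add: pderiv_smult)
qed

section \<open>Monomials and convergence\<close>

lemma puiseux_monom_exists:
  assumes "h \<ge> 0"
  obtains a where "\<And>r. pcoeff a r = (if r = h then c else 0)"
proof -
  obtain p N where pN: "quotient_of h = (p, N)" by fastforce
  then have N: "N > 0" "h = of_int p / of_int N"
    using quotient_of_denom_pos quotient_of_div by blast+
  have "h * of_int N = of_int p" using N by simp
  moreover have "p \<ge> 0" using assms N by (simp add: zero_le_divide_iff)
  ultimately have h: "h * of_nat (nat N) \<in> \<nat>" using N(1) by (simp add: Nats_altdef2)
  have "(\<lambda>r. if r = h then c else 0) \<in>
      {a. \<exists>N>0. \<forall>r. a r \<noteq> 0 \<longrightarrow> r * of_nat N \<in> \<nat>}"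
    using h N(1) by (auto intro!: exI[of _ "nat N"])
  from Abs_puiseux_inverse[OF this]
  have "pcoeff (Abs_puiseux (\<lambda>r. if r = h then c else 0)) r = (if r = h then c else 0)" for r
    by simp
  then show ?thesis by (rule that)
qed

text \<open>Bounded exponents make the series a polynomial in x^(1/N), which converges everywhere.
  Truncations and test series are shown to be convergent in this way.\<close>

lemma finite_support_cpuiseux_root:
  assumes "N > 0" "\<And>r. pcoeff a r \<noteq> 0 \<Longrightarrow> r * of_nat N \<in> \<nat>"
    and "\<And>r. pcoeff a r \<noteq> 0 \<Longrightarrow> r \<le> b"
  shows "a \<in> cpuiseux_root N"
proof -
  let ?g = "Abs_fps (\<lambda>k. pcoeff a (of_nat k / of_nat N))"
  obtain K :: nat where K: "b * of_nat N < of_nat K" using reals_Archimedean2 by blast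
  have "pcoeff a (of_nat k / of_nat N) = 0" if "k \<ge> K" for k
  proof (rule ccontr)
    assume "pcoeff a (of_nat k / of_nat N) \<noteq> 0"
    then have "of_nat k / of_nat N \<le> b" by (rule assms(3))
    then have "(of_nat k :: rat) \<le> b * of_nat N" using assms(1) by (simp add: field_simps)
    with K that show False by (meson le_less_trans not_less of_nat_less_iff)
  qed
  then have "?g = fps_of_poly (truncate_fps K ?g)"
    by (auto simp: fps_eq_iff coeff_truncate_fps)
  then have "fps_conv_radius ?g = \<infinity>" by (metis fps_conv_radius_fps_of_poly)
  moreover have "a = of_root N ?g" using assms(1,2) by (rule supp_imp_of_root)
  ultimately show ?thesis unfolding cpuiseux_root_def by force
qed

lemma cpuiseux_root_support:
  "a \<in> cpuiseux_root N \<Longrightarrow> pcoeff a r \<noteq> 0 \<Longrightarrow> r * of_nat N \<in> \<nat>"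
  unfolding cpuiseux_root_def using pcoeff_of_root_eq_0 by blast

section \<open>Conjugation of the roots\<close>

lemma proots_linear_factors:
  fixes xs :: "'a :: idom list"
  shows "proots (\<Prod>x\<leftarrow>xs. [:- x, 1:]) = mset xs"
proof (induction xs)
  case (Cons x xs)
  have "(\<Prod>\<alpha>\<leftarrow>xs. [:- \<alpha>, 1:]) \<noteq> 0" by (auto simp: prod_list_zero_iff)
  then have "proots ([:- x, 1:] * (\<Prod>\<alpha>\<leftarrow>xs. [:- \<alpha>, 1:])) =
      proots [:- x, 1:] + proots (\<Prod>\<alpha>\<leftarrow>xs. [:- \<alpha>, 1:])"
    by (intro proots_mult) auto
  then show ?case using Cons by (simp del: mult_pCons_left)
qed simp

lemma lead_coeff_linear_factors:
  fixes xs :: "'a :: idom list"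
  shows "lead_coeff (\<Prod>x\<leftarrow>xs. [:- x, 1:]) = 1" "degree (\<Prod>x\<leftarrow>xs. [:- x, 1:]) = length xs"
proof -
  have "lead_coeff (\<Prod>x\<leftarrow>xs. [:- x, 1:]) = 1 \<and> degree (\<Prod>x\<leftarrow>xs. [:- x, 1:]) = length xs"
  proof (induction xs)
    case (Cons x xs)
    let ?W = "\<Prod>x\<leftarrow>xs. [:- x, 1:]"
    have "?W \<noteq> 0" by (auto simp: prod_list_zero_iff)
    then have "degree ([:- x, 1:] * ?W) = length (x # xs)"
      using Cons by (subst degree_mult_eq) auto
    moreover have "lead_coeff ([:- x, 1:] * ?W) = 1"
      unfolding lead_coeff_mult conjunct1[OF Cons] by simp
    ultimately show ?case by (simp del: mult_pCons_left)
  qed simp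
  then show "lead_coeff (\<Prod>x\<leftarrow>xs. [:- x, 1:]) = 1" "degree (\<Prod>x\<leftarrow>xs. [:- x, 1:]) = length xs"
    by blast+
qed

text \<open>A finite product of factors y - \<alpha> is a polynomial viewed as a power series. Once
  \<open>G\<close> is cancelled, its roots recover the factors with multiplicity.\<close>

lemma linear_factors_unique:
  fixes \<alpha>s \<beta>s :: "'a :: idom list"
  assumes "G \<noteq> 0"
    and "G * (\<Prod>\<alpha>\<leftarrow>\<alpha>s. fps_X - fps_const \<alpha>) = G * (\<Prod>\<alpha>\<leftarrow>\<beta>s. fps_X - fps_const \<alpha>)"
  shows "mset \<alpha>s = mset \<beta>s"
proof -
  have lin: "(\<Prod>\<alpha>\<leftarrow>xs. fps_X - fps_const \<alpha>) = fps_of_poly (\<Prod>\<alpha>\<leftarrow>xs. [:- \<alpha>, 1:])"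
    for xs :: "'a list"
    by (induction xs) (auto simp: fps_of_poly_mult fps_of_poly_pCons)
  show ?thesis using assms unfolding lin by (metis fps_of_poly_eq_iff mult_cancel_left proots_linear_factors)
qed

lemma rot_prod_linear:
  "Abs_fps (\<lambda>j. rot k ((G * (\<Prod>\<alpha>\<leftarrow>\<alpha>s. fps_X - fps_const \<alpha>)) $ j)) =
     Abs_fps (\<lambda>j. rot k (G $ j)) * (\<Prod>\<alpha>\<leftarrow>map (rot k) \<alpha>s. fps_X - fps_const \<alpha>)"
proof (induction \<alpha>s arbitrary: G)
  case (Cons \<alpha> \<alpha>s)
  have "Abs_fps (\<lambda>j. rot k ((G * (fps_X - fps_const \<alpha>)) $ j)) =
      Abs_fps (\<lambda>j. rot k (G $ j)) * (fps_X - fps_const (rot k \<alpha>))"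
    by (rule fps_ext) (simp add: right_diff_distrib)
  with Cons[of "G * (fps_X - fps_const \<alpha>)"] show ?case by (simp add: mult.assoc)
qed simp

text \<open>\<open>f\<close> and \<open>u\<close> have coefficients with integer exponents in x,
  which \<open>rot\<close> fixes. Applying it to the factorization therefore yields a second
  factorization of \<open>f\<close>, with conjugated roots.\<close>

lemma rot_roots:
  assumes "germ_to_puiseux f = germ_to_puiseux u * (\<Prod>\<alpha>\<leftarrow>\<alpha>s. fps_X - fps_const \<alpha>)"
    and "u $ 0 $ 0 \<noteq> 0"
  shows "image_mset (rot k) (mset \<alpha>s) = mset \<alpha>s"
proof -
  have inv: "Abs_fps (\<lambda>j. rot k (germ_to_puiseux g $ j)) = germ_to_puiseux g" for g
    unfolding germ_to_puiseux_def by (simp only: fps_nth_Abs_fps rot_of_fps)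
  have "germ_to_puiseux u \<noteq> 0"
  proof
    assume "germ_to_puiseux u = 0"
    then have "pcoeff (germ_to_puiseux u $ 0) (of_nat 0) = 0" by simp
    with assms(2) show False unfolding germ_to_puiseux_def fps_nth_Abs_fps pcoeff_of_fps_of_nat by simp
  qed
  moreover have "germ_to_puiseux u * (\<Prod>\<alpha>\<leftarrow>\<alpha>s. fps_X - fps_const \<alpha>) =
      germ_to_puiseux u * (\<Prod>\<alpha>\<leftarrow>map (rot k) \<alpha>s. fps_X - fps_const \<alpha>)"
    using rot_prod_linear[of k "germ_to_puiseux u" \<alpha>s] unfolding assms(1)[symmetric] inv .
  ultimately have "mset \<alpha>s = mset (map (rot k) \<alpha>s)" by (rule linear_factors_unique)
  then show ?thesis by simp
qed

text \<open>In an integral domain the product vanishes only with one of its factors, and the unit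
  factor keeps its nonzero constant term at \<gamma>.\<close>

lemma Zer_eq_roots:
  assumes "germ_to_puiseux f = germ_to_puiseux u * (\<Prod>\<alpha>\<leftarrow>\<alpha>s. fps_X - fps_const \<alpha>)"
    and "u $ 0 $ 0 \<noteq> 0" "set \<alpha>s \<subseteq> frac_series"
  shows "Zer f = set \<alpha>s"
proof -
  have "psubst f \<gamma> = 0 \<longleftrightarrow> \<gamma> \<in> set \<alpha>s" if frac: "\<gamma> \<in> frac_series" for \<gamma>
  proof -
    obtain \<delta> where \<delta>: "\<delta> > 0" "ord_ge \<delta> \<gamma>" using frac_series_ord_ge[OF frac] by blast
    have "psubst u \<gamma> \<noteq> 0"
      using psubst_unit_leads[OF \<delta>, of u] assms(2) by (auto simp: leads_iff)
    then show ?thesis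
      unfolding psubst_factorization[OF \<delta> assms(1)] by (auto simp: prod_list_zero_iff)
  qed
  then show ?thesis using assms(3) by (auto simp: Zer_def)
qed

section \<open>Polynomials in a power of the variable\<close>

lemma coeff_pcompose_monom:
  fixes H :: "'a :: comm_ring_1 poly"
  assumes "n > 0"
  shows "coeff (pcompose H (monom 1 n)) i = (if n dvd i then coeff H (i div n) else 0)"
proof (induction H arbitrary: i)
  case (pCons a H)
  show ?case
  proof (cases "i < n")
    case True
    then have "n dvd i \<longleftrightarrow> i = 0" using assms by (auto dest: dvd_imp_le)
    with True show ?thesis
      by (auto simp: pcompose_pCons coeff_monom_mult coeff_pCons split: nat.splits)
  next
    case False
    then have "i div n = Suc ((i - n) div n)" "n dvd i \<longleftrightarrow> n dvd (i - n)" "i \<noteq> 0"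
      using assms by (auto simp: le_div_geq dvd_minus_self)
    with False show ?thesis
      by (auto simp: pcompose_pCons coeff_monom_mult coeff_pCons pCons.IH split: nat.splits)
  qed
qed simp

lemma pcompose_monom_eq_iff:
  fixes H H' :: "'a :: comm_ring_1 poly"
  assumes "n > 0"
  shows "pcompose H (monom 1 n) = pcompose H' (monom 1 n) \<longleftrightarrow> H = H'"
proof
  assume "pcompose H (monom 1 n) = pcompose H' (monom 1 n)"
  then have "coeff (pcompose H (monom 1 n)) (n * k) = coeff (pcompose H' (monom 1 n)) (n * k)" for k
    by simp
  then show "H = H'" using assms by (auto simp: coeff_pcompose_monom poly_eq_iff)
qed simp

lemma pcompose_monom_exists:
  fixes G :: "'a :: comm_ring_1 poly"
  assumes "n > 0" "\<And>k. coeff G k \<noteq> 0 \<Longrightarrow> n dvd k"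
  obtains H where "pcompose H (monom 1 n) = G"
proof -
  have "coeff G (n * k) = 0" if "k > degree G" for k
  proof (rule coeff_eq_0)
    have "degree G < 1 * k" using that by simp
    also have "\<dots> \<le> n * k" using assms(1) by (intro mult_le_mono) auto
    finally show "degree G < n * k" .
  qed
  then have "coeff (Abs_poly (\<lambda>k. coeff G (n * k))) = (\<lambda>k. coeff G (n * k))"
    by (rule coeff_Abs_poly)
  then have "pcompose (Abs_poly (\<lambda>k. coeff G (n * k))) (monom 1 n) = G"
    using assms by (auto simp: poly_eq_iff coeff_pcompose_monom)
  then show ?thesis by (rule that)
qed

lemma monom_diff_const_nonzero:
  "n > 0 \<Longrightarrow> monom 1 n - [:t:] \<noteq> (0 :: complex poly)"
  using degree_monom_eq[of "1 :: complex" n]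
  by (metis degree_pCons_0 eq_iff_diff_eq_0 less_irrefl zero_neq_one)

lemma proots_pcompose_monom:
  fixes H :: "complex poly"
  assumes "n > 0" "H \<noteq> 0"
  shows "proots (pcompose H (monom 1 n)) = (\<Sum>t\<in>#proots H. proots (monom 1 n - [:t:]))"
proof -
  note nz = monom_diff_const_nonzero[OF assms(1)]
  have lin: "pcompose [:- x, 1:] (monom 1 n) = monom 1 n - [:x:]" for x :: complex
    by (simp add: pcompose_pCons)
  have "pcompose (\<Prod>x\<in>#A. [:- x, 1:]) (monom 1 n) = (\<Prod>x\<in>#A. monom 1 n - [:x:])"
    for A :: "complex multiset"
    by (induction A) (simp_all add: pcompose_mult lin pcompose_1 del: mult_pCons_left pcompose_pCons)
  then have "pcompose H (monom 1 n) =
      smult (lead_coeff H) (\<Prod>x\<in>#proots H. monom 1 n - [:x:])"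
    by (subst complex_poly_decompose_multiset[of H, symmetric]) (simp add: pcompose_smult)
  moreover have "proots (\<Prod>x\<in>#A. monom 1 n - [:x:]) = (\<Sum>t\<in>#A. proots (monom 1 n - [:t:]))"
    for A :: "complex multiset"
  proof (induction A)
    case (add x A)
    have "(\<Prod>x\<in>#A. monom 1 n - [:x:]) \<noteq> 0" using nz by (auto simp: prod_mset_zero_iff)
    with add nz show ?case by (simp add: proots_mult)
  qed simp
  ultimately show ?thesis using assms(2) by simp
qed

text \<open>Each root t of \<open>H\<close> is replaced by the n solutions of z^n = t. Counting with
  multiplicity, t = 0 is no exception: its fibre is 0 taken n times.\<close>

lemma size_filter_proots_pcompose_monom:
  fixes H :: "complex poly"
  assumes "n > 0" "H \<noteq> 0"
  shows "size {#z \<in># proots (pcompose H (monom 1 n)). Q (z ^ n)#} = n * size {#t \<in># proots H. Q t#}"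
proof -
  note nz = monom_diff_const_nonzero[OF assms(1)]
  have size: "size (proots (monom 1 n - [:t:] :: complex poly)) = n" for t
  proof -
    have "degree (monom 1 n - [:t:] :: complex poly) = degree (monom 1 n :: complex poly)"
      using assms(1) by (subst diff_conv_add_uminus, intro degree_add_eq_left) (auto simp: degree_monom_eq)
    then show ?thesis by (simp add: size_proots_complex degree_monom_eq)
  qed
  have one: "{#z \<in># proots (monom 1 n - [:t:]). Q (z ^ n)#} =
      (if Q t then proots (monom 1 n - [:t:]) else {#})" for t
  proof -
    have "z ^ n = t" if "z \<in># proots (monom 1 n - [:t:])" for z
      using that nz by (simp add: poly_monom)
    then show ?thesis by (auto simp: filter_mset_eq_conv filter_mset_eq_mempty_iff)
  qed
  have "size {#z \<in># (\<Sum>t\<in>#A. proots (monom 1 n - [:t:])). Q (z ^ n)#} = n * size {#t \<in># A. Q t#}"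
    for A :: "complex multiset"
    by (induction A) (auto simp: one size)
  then show ?thesis unfolding proots_pcompose_monom[OF assms] .
qed

section \<open>Counting critical points\<close>

lemma size_filter_eq_count_image:
  "size {#x \<in># A. f x = a#} = count (image_mset f A) a"
  by (induction A) auto

text \<open>A k-fold root of \<open>H\<close> is a (k-1)-fold critical point, and there are
  \<open>degree H - 1\<close> critical points in all. In particular a nonzero critical value exists
  exactly if \<open>H\<close> has at least two distinct roots.\<close>

lemma size_noncritical_roots:
  fixes H :: "complex poly"
  assumes "degree H > 0"
  shows "size {#t \<in># proots (pderiv H). poly H t \<noteq> 0#} + 1 = card {t. poly H t = 0}"
proof -
  let ?Z = "{t. poly H t = 0}"
  have H: "H \<noteq> 0" "pderiv H \<noteq> 0" using assms by (auto simp: pderiv_eq_0_iff)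
  have fin: "finite ?Z" using H(1) by (rule poly_roots_finite)
  have "degree H = (\<Sum>t\<in>?Z. order t H)"
    unfolding size_proots_complex[symmetric] size_multiset_overloaded_eq using H by simp
  also have "\<dots> = (\<Sum>t\<in>?Z. 1 + order t (pderiv H))"
    using H by (intro sum.cong) (auto dest: order_pderiv)
  also have "\<dots> = card ?Z + (\<Sum>t\<in>?Z. order t (pderiv H))"
    by (subst sum.distrib) simp
  also have "(\<Sum>t\<in>?Z. order t (pderiv H)) = size {#t \<in># proots (pderiv H). poly H t = 0#}"
  proof -
    have "set_mset {#t \<in># proots (pderiv H). poly H t = 0#} \<subseteq> ?Z" by auto
    then have "size {#t \<in># proots (pderiv H). poly H t = 0#} =
        (\<Sum>t\<in>?Z. count {#t \<in># proots (pderiv H). poly H t = 0#} t)"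
      unfolding size_multiset_overloaded_eq using fin
      by (intro sum.mono_neutral_left) (auto simp: not_in_iff)
    also have "\<dots> = (\<Sum>t\<in>?Z. order t (pderiv H))"
      using H by (intro sum.cong) auto
    finally show ?thesis ..
  qed
  finally have "degree H = card ?Z + size {#t \<in># proots (pderiv H). poly H t = 0#}" .
  moreover have "size {#t \<in># proots (pderiv H). poly H t = 0#} +
      size {#t \<in># proots (pderiv H). poly H t \<noteq> 0#} = degree H - 1"
    using size_proots_complex[of "pderiv H"]
    by (simp add: degree_pderiv flip: size_union multiset_partition)
  ultimately show ?thesis using assms by linarith
qed

definition crit_count :: "complex poly \<Rightarrow> complex \<Rightarrow> nat" where
  "crit_count H a = size {#t \<in># proots (pderiv H). poly H t = a#}"

text \<open>The roots of \<open>pderiv H\<close> determine the list of critical points up to order,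
  so the existential over lists reduces to a bound on multiplicities.\<close>

lemma nonzero_critical_values_simple_iff:
  assumes "degree H > 0"
  shows "nonzero_critical_values_simple H \<longleftrightarrow> (\<forall>a. a \<noteq> 0 \<longrightarrow> crit_count H a \<le> 1)"
proof -
  have distinct: "distinct (map (poly H) (filter (\<lambda>t. poly H t \<noteq> 0) ts)) \<longleftrightarrow>
      (\<forall>a. a \<noteq> 0 \<longrightarrow> size {#t \<in># mset ts. poly H t = a#} \<le> 1)" for ts
  proof -
    let ?xs = "map (poly H) (filter (\<lambda>t. poly H t \<noteq> 0) ts)"
    have "count (mset ?xs) a = (if a = 0 then 0 else size {#t \<in># mset ts. poly H t = a#})" for a
      by (induction ts) auto
    moreover have "distinct ?xs \<longleftrightarrow> (\<forall>a. count (mset ?xs) a \<le> 1)"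
      unfolding distinct_count_atmost_1
      by (metis count_greater_zero_iff le_antisym less_one not_gr_zero not_less order_refl set_mset_mset zero_le)
    ultimately show ?thesis by auto
  qed
  have pd: "pderiv H \<noteq> 0" using assms by (auto simp: pderiv_eq_0_iff)
  show ?thesis
  proof
    assume "nonzero_critical_values_simple H"
    then obtain C ts where "C \<noteq> 0" "pderiv H = smult C (\<Prod>t\<leftarrow>ts. [:- t, 1:])"
      and ts: "distinct (map (poly H) (filter (\<lambda>t. poly H t \<noteq> 0) ts))"
      unfolding nonzero_critical_values_simple_def by blast
    then have "proots (pderiv H) = mset ts" by (simp add: proots_linear_factors)
    with ts show "\<forall>a. a \<noteq> 0 \<longrightarrow> crit_count H a \<le> 1" by (simp add: distinct crit_count_def)
  next
    assume *: "\<forall>a. a \<noteq> 0 \<longrightarrow> crit_count H a \<le> 1"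
    obtain ts where ts: "mset ts = proots (pderiv H)" by (metis ex_mset)
    have "(\<Prod>x\<in>#proots (pderiv H). [:- x, 1:]) = (\<Prod>t\<leftarrow>ts. [:- t, 1:])"
      unfolding ts[symmetric] by (simp flip: prod_mset_prod_list)
    then have "pderiv H = smult (lead_coeff (pderiv H)) (\<Prod>t\<leftarrow>ts. [:- t, 1:])"
      using complex_poly_decompose_multiset[of "pderiv H"] by simp
    then show "nonzero_critical_values_simple H"
      unfolding nonzero_critical_values_simple_def using * pd
      by (intro exI[of _ "lead_coeff (pderiv H)"] exI[of _ ts])
        (auto simp: distinct ts crit_count_def)
  qed
qed

text \<open>Differentiate \<open>F(z)\<^sup>M = H(z\<^sup>n)\<close> and compare the roots on both sides.\<close>

lemma crit_count_power:
  fixes F H :: "complex poly"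
  assumes "pcompose H (monom 1 n) = F ^ M" "n > 0" "M > 0" "degree F > 0" "a \<noteq> 0"
  shows "size {#z \<in># proots (pderiv F). poly F z ^ M = a#} =
    n * crit_count H a + (if poly H 0 = a then n - 1 else 0)"
proof -
  have F: "F \<noteq> 0" "pderiv F \<noteq> 0" using assms(4) by (auto simp: pderiv_eq_0_iff)
  have "degree (F ^ M) > 0" using assms F by (simp add: degree_power_eq)
  then have "degree H > 0"
    unfolding assms(1)[symmetric] by (rule contrapos_pp) (auto elim!: degree_eq_zeroE)
  then have H: "pderiv H \<noteq> 0" by (auto simp: pderiv_eq_0_iff)
  let ?Q = "\<lambda>z. poly F z ^ M = a"
  have Q: "?Q z \<longleftrightarrow> poly H (z ^ n) = a" for z
    using arg_cong[OF assms(1), of "\<lambda>p. poly p z"] by (simp add: poly_pcompose poly_monom)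
  have "smult (of_nat M) (F ^ (M - 1) * pderiv F) =
      smult (of_nat n) (pcompose (pderiv H) (monom 1 n) * monom 1 (n - 1))"
  proof -
    have "monom (of_nat n) (n - 1) = smult (of_nat n) (monom (1 :: complex) (n - 1))"
      by (simp add: smult_monom)
    then show ?thesis
      using arg_cong[OF assms(1), of pderiv]
      by (simp add: pderiv_power pderiv_pcompose pderiv_monom)
  qed
  then have "proots (smult (of_nat M) (F ^ (M - 1) * pderiv F)) =
      proots (smult (of_nat n) (pcompose (pderiv H) (monom 1 n) * monom 1 (n - 1)))"
    by simp
  moreover have "pcompose (pderiv H) (monom 1 n) \<noteq> 0"
    using H pcompose_monom_eq_iff[OF assms(2), of "pderiv H" 0] by simp
  \<comment> \<open>On the left \<open>F ^ (M - 1)\<close> contributes only points with value 0,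
    which is not \<open>a\<close>; on the right the factor \<open>z ^ (n - 1)\<close> contributes
    the point 0 with multiplicity \<open>n - 1\<close>.\<close>
  ultimately have eq: "repeat_mset (M - 1) (proots F) + proots (pderiv F) =
      proots (pcompose (pderiv H) (monom 1 n)) + proots (monom 1 (n - 1))"
    using assms F by (simp add: proots_mult proots_power)
  have r1: "proots (monom 1 (n - 1) :: complex poly) = repeat_mset (n - 1) {#0#}"
  proof -
    have "monom 1 (n - 1) = ([:0, 1:] :: complex poly) ^ (n - 1)"
      by (simp add: monom_altdef)
    then show ?thesis by (simp add: proots_power)
  qed
  have r2: "{#z \<in># repeat_mset k (proots F). ?Q z#} = {#}" for k
    using F assms by (induction k) auto
  have r3: "size {#z \<in># proots (pcompose (pderiv H) (monom 1 n)). ?Q z#} = n * crit_count H a"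
    unfolding Q crit_count_def by (rule size_filter_proots_pcompose_monom) (use assms H in auto)
  have r4: "size {#z \<in># repeat_mset k {#0#}. ?Q z#} = (if poly H 0 = a then k else 0)" for k
  proof -
    have "?Q 0 \<longleftrightarrow> poly H 0 = a" using Q[of 0] assms by (simp add: power_0_left)
    then show ?thesis by (induction k) auto
  qed
  show ?thesis
    using arg_cong[OF eq, of "\<lambda>A. size {#z \<in># A. ?Q z#}"]
    unfolding filter_union_mset size_union r1 r2 r3 r4 size_empty add_0 .
qed

text \<open>By \<open>\<nu>_dvd\<close> the number \<open>N * \<nu> a\<close> is a multiple of
  \<open>M\<close>, so the bound leaves only 0 and \<open>M\<close>. The two cases differ in which
  contribution to \<open>\<nu>\<close> is certain to be positive: the branch point 0 of z^n, or a
  critical point of \<open>H\<close>.\<close>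

lemma critical_multiplicity_criterion:
  fixes F H :: "complex poly"
  assumes "pcompose H (monom 1 n) = F ^ M" "n > 0" "M > 0" "N > 0"
    and roots: "poly F z1 = 0" "poly F z2 = 0" "z1 \<noteq> z2" and F: "F \<noteq> 0"
    and dvd: "M dvd n * N" "poly F 0 \<noteq> 0 \<Longrightarrow> M dvd N"
  defines "\<nu> \<equiv> \<lambda>a. size {#z \<in># proots (pderiv F). poly F z ^ M = a#}"
  assumes \<nu>_dvd: "\<And>a. a \<noteq> 0 \<Longrightarrow> M dvd N * \<nu> a"
  shows "card {t. poly H t = 0} = 1 \<Longrightarrow> (\<forall>a. a \<noteq> 0 \<longrightarrow> N * \<nu> a \<le> M) \<longleftrightarrow> (n - 1) * N = M"
    and "card {t. poly H t = 0} \<noteq> 1 \<Longrightarrow> (\<forall>a. a \<noteq> 0 \<longrightarrow> N * \<nu> a \<le> M) \<longleftrightarrow>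
      n * N = M \<and> nonzero_critical_values_simple H"
proof -
  have deg: "degree F > 0"
  proof (rule ccontr)
    assume "\<not> degree F > 0"
    then obtain c where "F = [:c:]" by (auto elim: degree_eq_zeroE)
    with roots F show False by simp
  qed
  have "degree (F ^ M) > 0" using assms deg F by (simp add: degree_power_eq)
  then have degH: "degree H > 0"
    unfolding assms(1)[symmetric] by (rule contrapos_pp) (auto elim!: degree_eq_zeroE)
  have eval: "poly H (z ^ n) = poly F z ^ M" for z
    using arg_cong[OF assms(1), of "\<lambda>p. poly p z"] by (simp add: poly_pcompose poly_monom)
  have \<nu>: "\<nu> a = n * crit_count H a + (if poly H 0 = a then n - 1 else 0)" if "a \<noteq> 0" for a
    unfolding \<nu>_def using crit_count_power[OF assms(1-3) deg that] .
  note noncrit = size_noncritical_roots[OF degH]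
  {
    assume one: "card {t. poly H t = 0} = 1"
    then have "size {#t \<in># proots (pderiv H). poly H t \<noteq> 0#} = 0" using noncrit by simp
    then have none: "{#t \<in># proots (pderiv H). poly H t \<noteq> 0#} = {#}" by simp
    have zero: "crit_count H a = 0" if "a \<noteq> 0" for a
      using none that by (auto simp: crit_count_def filter_mset_eq_mempty_iff)
    from one obtain t0 where t0: "{t. poly H t = 0} = {t0}" by (rule card_1_singletonE)
    have root: "z ^ n = t0" if "poly F z = 0" for z
      using that eval[of z] t0 assms(3) by (auto simp: power_0_left)
    \<comment> \<open>Two distinct numbers have \<open>t0\<close> as their \<open>n\<close>-th
      power, which excludes \<open>t0 = 0\<close> and, in the next step,
      \<open>n = 1\<close>.\<close>
    have "t0 \<noteq> 0" using root[OF roots(1)] root[OF roots(2)] roots(3) assms(2) by (auto simp: power_0_left)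
    then have H0: "poly H 0 \<noteq> 0" using t0 by auto
    have "n \<noteq> 1" using root[OF roots(1)] root[OF roots(2)] roots(3) by auto
    then have n: "n - 1 > 0" using assms(2) by simp
    have "(\<forall>a. a \<noteq> 0 \<longrightarrow> N * \<nu> a \<le> M) \<longleftrightarrow> N * (n - 1) \<le> M"
      using \<nu> zero H0 by auto
    also have "\<dots> \<longleftrightarrow> (n - 1) * N = M"
    proof -
      \<comment> \<open>At \<open>a = poly H 0\<close> the only contribution is
        \<open>n - 1\<close>. So \<open>N * (n - 1)\<close> is a positive multiple of
        \<open>M\<close>, and being at most \<open>M\<close> means being equal to it.\<close>
      have "M dvd N * (n - 1)" using \<nu>_dvd[OF H0] \<nu>[OF H0] zero[OF H0] by simp
      then have "M \<le> N * (n - 1)" using n assms(4) by (intro dvd_imp_le) auto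
      then show ?thesis by (auto simp: mult.commute)
    qed
    finally show "(\<forall>a. a \<noteq> 0 \<longrightarrow> N * \<nu> a \<le> M) \<longleftrightarrow> (n - 1) * N = M" .
  }
  {
    assume not_one: "card {t. poly H t = 0} \<noteq> 1"
    then have "{#t \<in># proots (pderiv H). poly H t \<noteq> 0#} \<noteq> {#}"
      using noncrit by (metis add_0 size_empty)
    then obtain t where t: "t \<in># proots (pderiv H)" "poly H t \<noteq> 0"
      by (auto simp: filter_mset_eq_mempty_iff)
    then have pos: "crit_count H (poly H t) > 0"
      by (auto simp: crit_count_def nonempty_has_size[symmetric] filter_mset_eq_mempty_iff)
    show "(\<forall>a. a \<noteq> 0 \<longrightarrow> N * \<nu> a \<le> M) \<longleftrightarrow> n * N = M \<and> nonzero_critical_values_simple H"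
    proof
      assume le: "\<forall>a. a \<noteq> 0 \<longrightarrow> N * \<nu> a \<le> M"
      have le': "n * N * crit_count H a \<le> M" if "a \<noteq> 0" for a
      proof -
        have "n * N * crit_count H a \<le> N * \<nu> a" using \<nu>[OF that] by (simp add: algebra_simps)
        also have "\<dots> \<le> M" using le that by blast
        finally show ?thesis .
      qed
      \<comment> \<open>Divisibility gives this inequality; the nonzero critical value
        \<open>poly H t\<close> gives the reverse one.\<close>
      have "M \<le> n * N" using dvd(1) assms by (intro dvd_imp_le) auto
      moreover have "n * N * 1 \<le> n * N * crit_count H (poly H t)"
        using pos by (intro mult_le_mono) auto
      ultimately have nN: "n * N = M" using le'[OF t(2)] by linarith
      moreover have "crit_count H a \<le> 1" if "a \<noteq> 0" for a
        using le'[OF that] assms(3) unfolding nN by simp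
      ultimately show "n * N = M \<and> nonzero_critical_values_simple H"
        using nonzero_critical_values_simple_iff[OF degH] by blast
    next
      assume *: "n * N = M \<and> nonzero_critical_values_simple H"
      show "\<forall>a. a \<noteq> 0 \<longrightarrow> N * \<nu> a \<le> M"
      proof (intro allI impI)
        fix a :: complex assume a: "a \<noteq> 0"
        have c: "crit_count H a \<le> 1"
          using * a nonzero_critical_values_simple_iff[OF degH] by blast
        have "(if poly H 0 = a then n - 1 else 0) = 0"
        proof (cases "poly H 0 = a")
          case True
          then have "poly F 0 \<noteq> 0" using eval[of 0] a assms by (auto simp: power_0_left)
          then have "M dvd N" by (rule dvd(2))
          \<comment> \<open>\<open>M\<close>, which is \<open>n * N\<close>, divides
            \<open>N\<close>. Hence \<open>n = 1\<close>, and the extra summand \<open>n - 1\<close>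
            is 0.\<close>
          then have "n * N \<le> N" using * assms(4) by (auto dest: dvd_imp_le)
          then show ?thesis using assms by simp
        qed simp
        then have "\<nu> a = n * crit_count H a" using \<nu>[OF a] by simp
        also have "N * \<dots> \<le> N * (n * 1)" using c by (intro mult_le_mono) auto
        finally show "N * \<nu> a \<le> M" using * unfolding mult_1_right by (metis mult.commute)
      qed
    qed
  }
qed

section \<open>Newton diagrams with one compact edge\<close>

definition quadrant_above :: "real \<Rightarrow> real \<Rightarrow> real \<Rightarrow> (real \<times> real) set" where
  "quadrant_above a b c = {(x, y). x \<ge> 0 \<and> y \<ge> 0 \<and> a * x + b * y \<ge> c}"

lemma convex_quadrant_above: "convex (quadrant_above a b c)"
proof -
  have eq: "quadrant_above a b c =
      {p. (1, 0) \<bullet> p \<ge> 0} \<inter> ({p. (0, 1) \<bullet> p \<ge> 0} \<inter> {p. (a, b) \<bullet> p \<ge> c})"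
    unfolding quadrant_above_def by (rule set_eqI) (simp add: case_prod_beta inner_prod_def)
  show ?thesis unfolding eq by (rule convex_Int[OF convex_halfspace_ge convex_Int[OF convex_halfspace_ge convex_halfspace_ge]])
qed

text \<open>\<open>p\<close> is interior to a ray contained in \<open>Q\<close>, so a face through
  \<open>p\<close> also contains the far points of the ray and is unbounded.\<close>

lemma compact_face_no_ray:
  fixes p d :: "'a :: real_normed_vector"
  assumes "S face_of Q" "compact S" "p \<in> S" "d \<noteq> 0" "\<epsilon> > 0" "p - \<epsilon> *\<^sub>R d \<in> Q"
    and ray: "\<And>t. t > 0 \<Longrightarrow> p + t *\<^sub>R d \<in> Q"
  shows False
proof -
  obtain K where K: "\<And>x. x \<in> S \<Longrightarrow> norm x \<le> K"
    using compact_imp_bounded[OF assms(2)] by (auto simp: bounded_iff)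
  \<comment> \<open>Chosen so that the translation has norm \<open>K + norm p + 1\<close>, which
    moves \<open>p\<close> out of the ball of radius \<open>K\<close>.\<close>
  define t where "t = (K + norm p + 1) / norm d"
  have pos: "K + norm p + 1 > 0" using K[OF assms(3)] norm_ge_zero[of p] by linarith
  with assms(4) have t: "t > 0" by (simp add: t_def)
  have "p = (1 - \<epsilon> / (\<epsilon> + t)) *\<^sub>R (p - \<epsilon> *\<^sub>R d) + (\<epsilon> / (\<epsilon> + t)) *\<^sub>R (p + t *\<^sub>R d)"
  proof -
    have "(1 - \<epsilon> / (\<epsilon> + t)) *\<^sub>R (p - \<epsilon> *\<^sub>R d) + (\<epsilon> / (\<epsilon> + t)) *\<^sub>R (p + t *\<^sub>R d) =
        p + ((\<epsilon> / (\<epsilon> + t)) * t - (1 - \<epsilon> / (\<epsilon> + t)) * \<epsilon>) *\<^sub>R d"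
      by (simp add: algebra_simps)
    also have "(\<epsilon> / (\<epsilon> + t)) * t - (1 - \<epsilon> / (\<epsilon> + t)) * \<epsilon> = 0"
      using t assms(5) by (simp add: field_simps)
    finally show ?thesis by simp
  qed
  moreover have "p - \<epsilon> *\<^sub>R d \<noteq> p + t *\<^sub>R d"
  proof
    assume "p - \<epsilon> *\<^sub>R d = p + t *\<^sub>R d"
    then have "(t + \<epsilon>) *\<^sub>R d = 0" by (simp add: algebra_simps)
    with t assms(4,5) show False by simp
  qed
  ultimately have "p \<in> open_segment (p - \<epsilon> *\<^sub>R d) (p + t *\<^sub>R d)"
    unfolding in_segment using t assms(5) by (intro conjI exI[of _ "\<epsilon> / (\<epsilon> + t)"]) auto
  then have "p + t *\<^sub>R d \<in> S" using face_ofD[OF assms(1)] assms(3,6) ray[OF t] by blast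
  then have "norm (p + t *\<^sub>R d) \<le> K" by (rule K)
  moreover have "norm (t *\<^sub>R d) = K + norm p + 1"
    using pos assms(4) by (simp add: t_def)
  moreover have "norm (t *\<^sub>R d) \<le> norm (p + t *\<^sub>R d) + norm p"
    using norm_triangle_ineq4[of "p + t *\<^sub>R d" p] unfolding add_diff_cancel_left' .
  ultimately show False by linarith
qed

text \<open>A point strictly above the line can move a little inwards and indefinitely outwards
  along a coordinate direction, so no compact face contains it. An edge inside the segment is a face
  of it of the same dimension, hence all of it.\<close>

lemma compact_edge_quadrant_above_iff:
  assumes "a > 0" "b > 0" "c > 0"
  shows "S edge_of quadrant_above a b c \<and> compact S \<longleftrightarrow>
    S = {(x, y). x \<ge> 0 \<and> y \<ge> 0 \<and> a * x + b * y = c}"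
proof -
  let ?Q = "quadrant_above a b c"
  let ?S = "{(x, y). x \<ge> 0 \<and> y \<ge> 0 \<and> a * x + b * y = c}"
  have seg: "?S = closed_segment (c / a, 0) (0, c / b)"
  proof (rule set_eqI, clarify)
    fix x y
    have "(x, y) \<in> ?S \<longleftrightarrow> (\<exists>u. 0 \<le> u \<and> u \<le> 1 \<and> x = (1 - u) * (c / a) \<and> y = u * (c / b))"
    proof
      assume xy: "(x, y) \<in> ?S"
      then have "x \<ge> 0" "y \<ge> 0" and sum: "a * x + b * y = c" by simp_all
      moreover from this have "a * x \<ge> 0" "b * y \<ge> 0" using assms by simp_all
      ultimately have "b * y \<le> c" by linarith
      moreover have "(1 - b * y / c) * c = a * x"
        using sum assms(3) by (simp add: left_diff_distrib)
      then have "x = (1 - b * y / c) * (c / a)"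
        using assms(1) by (simp add: eq_divide_eq mult.commute)
      ultimately show "\<exists>u. 0 \<le> u \<and> u \<le> 1 \<and> x = (1 - u) * (c / a) \<and> y = u * (c / b)"
        using \<open>b * y \<ge> 0\<close> assms by (intro exI[of _ "b * y / c"]) simp
    next
      assume "\<exists>u. 0 \<le> u \<and> u \<le> 1 \<and> x = (1 - u) * (c / a) \<and> y = u * (c / b)"
      then obtain u where u: "0 \<le> u" "u \<le> 1" "x = (1 - u) * (c / a)" "y = u * (c / b)" by blast
      have "a * x = (1 - u) * c" "b * y = u * c" using u assms by simp_all
      then have "a * x + b * y = c" by (simp add: algebra_simps)
      then show "(x, y) \<in> ?S" using u assms by simp
    qed
    then show "(x, y) \<in> ?S \<longleftrightarrow> (x, y) \<in> closed_segment (c / a, 0) (0, c / b)"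
      unfolding in_segment by simp
  qed
  have face: "?S face_of ?Q"
  proof -
    have "?Q \<inter> {p. (a, b) \<bullet> p = c} face_of ?Q"
      by (rule face_of_Int_supporting_hyperplane_ge[OF convex_quadrant_above])
        (auto simp: quadrant_above_def)
    also have "?Q \<inter> {p. (a, b) \<bullet> p = c} = ?S" by (auto simp: quadrant_above_def)
    finally show ?thesis .
  qed
  have dim: "aff_dim ?S = 1"
    unfolding seg segment_convex_hull aff_dim_convex_hull aff_dim_2 using assms by simp
  show ?thesis
  proof
    assume "S = ?S"
    then show "S edge_of ?Q \<and> compact S"
    proof -
      have "compact ?S" unfolding seg by (rule compact_segment)
      with face dim show ?thesis unfolding edge_of_def \<open>S = ?S\<close> by blast
    qed
  next
    assume S: "S edge_of ?Q \<and> compact S"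
    then have S_face: "S face_of ?Q" and S_dim: "aff_dim S = 1" by (auto simp: edge_of_def)
    have "S \<subseteq> ?S"
    proof clarify
      fix x y assume p: "(x, y) \<in> S"
      then have Q: "(x, y) \<in> ?Q" using S_face face_of_imp_subset by blast
      have "a * x + b * y = c"
      proof (rule ccontr)
        assume "a * x + b * y \<noteq> c"
        then have gt: "a * x + b * y > c" using Q by (auto simp: quadrant_above_def)
        show False
        proof (cases "x > 0")
          case True
          \<comment> \<open>The minimum keeps the shifted point both in the quadrant and above the
            line.\<close>
          let ?e = "min x ((a * x + b * y - c) / a)"
          have e: "?e > 0" "?e \<le> x" using True gt assms by auto
          have "a * ?e \<le> a * ((a * x + b * y - c) / a)" using assms by (intro mult_left_mono) auto
          then have "a * ?e \<le> a * x + b * y - c" using assms by simp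
          then have "(x, y) - ?e *\<^sub>R (1, 0) \<in> ?Q"
            using Q e by (auto simp: quadrant_above_def algebra_simps)
          moreover have "(x, y) + t *\<^sub>R (1, 0) \<in> ?Q" if "t > 0" for t
          proof -
            have "a * (x + t) + b * y = (a * x + b * y) + a * t" "a * t > 0"
              using that assms(1) by (simp_all add: algebra_simps)
            then show ?thesis using Q that by (auto simp: quadrant_above_def)
          qed
          ultimately show False
            using compact_face_no_ray[where d = "(1, 0)", OF S_face conjunct2[OF S] p _ e(1)]
            by (simp add: zero_prod_def)
        next
          case False
          \<comment> \<open>On this axis there is no room horizontally; the vertical direction works
            since \<open>c > 0\<close> forces \<open>y > 0\<close>.\<close>
          then have x: "x = 0" using Q by (auto simp: quadrant_above_def)
          let ?e = "min y ((b * y - c) / b)"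
          have "b * y > 0" using gt x assms(3) by simp
          then have "y > 0" using assms(2) by (simp add: zero_less_mult_iff)
          then have e: "?e > 0" "?e \<le> y" using gt x assms by auto
          have "b * ?e \<le> b * ((b * y - c) / b)" using assms by (intro mult_left_mono) auto
          then have "b * ?e \<le> b * y - c" using assms by simp
          then have "(x, y) - ?e *\<^sub>R (0, 1) \<in> ?Q"
            using Q e x by (auto simp: quadrant_above_def algebra_simps)
          moreover have "(x, y) + t *\<^sub>R (0, 1) \<in> ?Q" if "t > 0" for t
          proof -
            have "a * x + b * (y + t) = (a * x + b * y) + b * t" "b * t > 0"
              using that assms(2) by (simp_all add: algebra_simps)
            then show ?thesis using Q that by (auto simp: quadrant_above_def)
          qed
          ultimately show False
            using compact_face_no_ray[where d = "(0, 1)", OF S_face conjunct2[OF S] p _ e(1)]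
            by (simp add: zero_prod_def)
        qed
      qed
      with Q show "x \<ge> 0 \<and> y \<ge> 0 \<and> a * x + b * y = c" by (auto simp: quadrant_above_def)
    qed
    then have "S face_of ?S"
      by (rule face_of_subset[OF S_face _ face_of_imp_subset[OF face]])
    then have "S \<noteq> ?S \<Longrightarrow> aff_dim S < aff_dim ?S"
      by (rule face_of_aff_dim_lt[OF face_of_imp_convex[OF face]])
    then show "S = ?S" unfolding S_dim dim by blast
  qed
qed

lemma newton_diagram_eq_quadrant_above:
  assumes low: "\<And>i j. g $ j $ i \<noteq> 0 \<Longrightarrow> a * real i + b * real j \<ge> c"
    and ends: "g $ 0 $ k \<noteq> 0" "g $ l $ 0 \<noteq> 0" "a * real k = c" "b * real l = c"
    and pos: "a > 0" "b > 0" "c > 0"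
  shows "newton_diagram g = quadrant_above a b c"
proof
  let ?X = "{(real i + s, real j + t) | i j s t. g $ j $ i \<noteq> 0 \<and> s \<ge> 0 \<and> t \<ge> 0}"
  show "newton_diagram g \<subseteq> quadrant_above a b c"
    unfolding newton_diagram_def
  proof (rule hull_minimal)
    show "?X \<subseteq> quadrant_above a b c"
    proof clarify
      fix i j s t assume *: "g $ j $ i \<noteq> 0" "(s :: real) \<ge> 0" "(t :: real) \<ge> 0"
      have "a * (real i + s) + b * (real j + t) = (a * real i + b * real j) + (a * s + b * t)"
        by (simp add: algebra_simps)
      moreover have "a * s + b * t \<ge> 0" using * pos by simp
      ultimately show "(real i + s, real j + t) \<in> quadrant_above a b c"
        using low[OF *(1)] * by (auto simp: quadrant_above_def)
    qed
  qed (rule convex_quadrant_above)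
  show "quadrant_above a b c \<subseteq> newton_diagram g"
  proof clarify
    fix x y assume "(x, y) \<in> quadrant_above a b c"
    then have xy: "x \<ge> 0" "y \<ge> 0" "a * x + b * y \<ge> c" by (auto simp: quadrant_above_def)
    have k: "real k = c / a" "real k > 0" and l: "real l = c / b"
    proof -
      show k: "real k = c / a" using ends(3) pos(1) by (simp add: eq_divide_eq mult.commute)
      show "real k > 0" unfolding k using pos by simp
      show "real l = c / b" using ends(4) pos(2) by (simp add: eq_divide_eq mult.commute)
    qed
    show "(x, y) \<in> newton_diagram g"
    proof (cases "x \<ge> real k")
      case True
      have "(real k + (x - real k), real 0 + y) \<in> ?X"
        using ends(1) True xy(2) by (intro CollectI exI[of _ k] exI[of _ 0] exI[of _ "x - real k"] exI[of _ y]) auto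
      then show ?thesis unfolding newton_diagram_def by (intro hull_inc) simp
    next
      case False
      \<comment> \<open>\<open>s\<close> and \<open>1 - s\<close> are the weights of the vertices
        (k, 0) and (0, l) in the point of the segment with abscissa \<open>x\<close>;
        \<open>t\<close> is the height of \<open>(x, y)\<close> above that point.\<close>
      define s where "s = x / real k"
      define t where "t = y - (1 - s) * real l"
      have s: "0 \<le> s" "s \<le> 1" using False xy(1) k(2) by (simp_all add: s_def)
      have "c - a * x \<le> b * y" using xy(3) by simp
      then have "(c - a * x) / b \<le> y" using pos by (simp add: field_simps)
      moreover have "s = a * x / c" using k(1) pos by (simp add: s_def)
      then have "(1 - s) * c = c - a * x" using pos by (simp add: left_diff_distrib)
      then have "(1 - s) * real l = (c - a * x) / b" by (simp add: l)
      ultimately have t: "t \<ge> 0" by (simp add: t_def)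
      have "(real k + 0, real 0 + t) \<in> ?X"
        using ends(1) t by (intro CollectI exI[of _ k] exI[of _ 0] exI[of _ 0] exI[of _ t]) auto
      moreover have "(real 0 + 0, real l + t) \<in> ?X"
        using ends(2) t by (intro CollectI exI[of _ 0] exI[of _ l] exI[of _ 0] exI[of _ t]) auto
      ultimately have "(1 - s) *\<^sub>R (real 0 + 0, real l + t) + s *\<^sub>R (real k + 0, real 0 + t)
          \<in> newton_diagram g"
        unfolding newton_diagram_def using s
        by (intro convexD[OF convex_convex_hull] hull_inc) auto
      also have "(1 - s) *\<^sub>R (real 0 + 0, real l + t) + s *\<^sub>R (real k + 0, real 0 + t) = (x, y)"
      proof -
        have "s * real k = x" using k(2) by (simp add: s_def)
        then show ?thesis by (simp add: t_def algebra_simps)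
      qed
      finally show ?thesis .
    qed
  qed
qed

section \<open>Quasi-homogeneous products\<close>

lemma poly_prod_list_eq_0:
  fixes p :: "'b \<Rightarrow> 'a :: idom poly"
  shows "poly (\<Prod>t\<leftarrow>ts. p t) x = 0 \<longleftrightarrow> (\<exists>t\<in>set ts. poly (p t) x = 0)"
  by (induction ts) auto

lemma pcompose_linear_factors:
  fixes ts :: "'a :: comm_ring_1 list"
  shows "pcompose (\<Prod>t\<leftarrow>ts. [:- t, 1:]) (monom 1 q) = (\<Prod>t\<leftarrow>ts. monom 1 q - [:t:])"
proof (induction ts)
  case (Cons t ts)
  have "pcompose [:- t, 1:] (monom 1 q) = monom 1 q - [:t:]"
    by (simp add: pcompose_pCons)
  with Cons show ?case
    by (simp add: pcompose_mult del: mult_pCons_left pcompose_pCons)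
qed (simp add: pcompose_1)

lemma coeff_monom_diff_mult:
  fixes t :: "'a :: comm_ring_1"
  shows "coeff ((monom 1 q - [:t:]) * W) j = (if j < q then 0 else coeff W (j - q)) - t * coeff W j"
  by (simp add: left_diff_distrib coeff_monom_mult)

lemma coeff_monom_diff_prod_eq_0:
  fixes ts :: "'a :: comm_ring_1 list"
  assumes "j > q * length ts"
  shows "coeff (\<Prod>t\<leftarrow>ts. monom 1 q - [:t:]) j = 0"
  using assms
proof (induction ts arbitrary: j)
  case (Cons t ts)
  from Cons.prems have "j - q > q * length ts" "j > q * length ts" by auto
  then show ?case
    unfolding list.map prod_list.Cons coeff_monom_diff_mult by (simp add: Cons.IH)
qed simp

definition qhom :: "nat \<Rightarrow> nat \<Rightarrow> complex list \<Rightarrow> complex fps fps" where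
  "qhom p q ts = (\<Prod>t\<leftarrow>ts. fps_X ^ q - fps_const (fps_const t * fps_X ^ p))"

text \<open>All monomials lie on one line, on which \<open>j\<close> determines \<open>i\<close>;
  the product is the weighted homogenization of its value at u = 1.\<close>

lemma qhom_nth:
  assumes "p > 0" "q > 0"
  shows "qhom p q ts $ j $ i = (if i * q + j * p = p * q * length ts
    then coeff (\<Prod>t\<leftarrow>ts. monom 1 q - [:t:]) j else 0)"
proof (induction ts arbitrary: i j)
  case Nil
  then show ?case using assms by (auto simp: qhom_def)
next
  case (Cons t ts)
  let ?W = "\<Prod>t\<leftarrow>ts. monom 1 q - [:t:]"
  have "qhom p q (t # ts) = (fps_X ^ q - fps_const (fps_const t * fps_X ^ p)) * qhom p q ts"
    by (simp add: qhom_def)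
  then have "qhom p q (t # ts) $ j $ i =
      (if j < q then 0 else qhom p q ts $ (j - q) $ i) - t * (if i < p then 0 else qhom p q ts $ j $ (i - p))"
    by (simp add: left_diff_distrib fps_X_power_mult_nth mult.assoc)
  also have "(if j < q then 0 else qhom p q ts $ (j - q) $ i) =
      (if i * q + j * p = p * q * length (t # ts) then (if j < q then 0 else coeff ?W (j - q)) else 0)"
  proof (cases "j < q")
    case False
    then obtain j' where j: "j = q + j'" by (metis le_Suc_ex not_less)
    then show ?thesis by (simp add: Cons.IH algebra_simps)
  qed simp
  also have "(if i < p then 0 else qhom p q ts $ j $ (i - p)) =
      (if i * q + j * p = p * q * length (t # ts) then coeff ?W j else 0)"
  proof (cases "i < p")
    case True
    \<comment> \<open>On the line, \<open>i < p\<close> puts \<open>j\<close> beyond the degree of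
      the remaining product, so the term lost by the shift in u was zero anyway.\<close>
    have "coeff ?W j = 0" if "i * q + j * p = p * q * length (t # ts)"
    proof (rule coeff_monom_diff_prod_eq_0)
      have "i * q < p * q" using True assms(2) by simp
      moreover have "i * q + p * j = p * q + p * (q * length ts)"
        using that by (simp add: algebra_simps)
      ultimately have "p * (q * length ts) < p * j" by linarith
      then show "q * length ts < j" by simp
    qed
    with True show ?thesis by auto
  next
    case False
    then obtain i' where i: "i = p + i'" by (metis le_Suc_ex not_less)
    then show ?thesis by (simp add: Cons.IH algebra_simps)
  qed
  finally show ?case unfolding list.map prod_list.Cons coeff_monom_diff_mult by simp
qed

lemma coeff_linear_factors_pcompose:
  fixes ts :: "complex list"
  assumes "q > 0" "coeff (\<Prod>t\<leftarrow>ts. monom 1 q - [:t:]) j \<noteq> 0"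
  obtains s where "j = q * s" "s \<le> length ts"
proof -
  have "j \<le> q * length ts" using assms(2) coeff_monom_diff_prod_eq_0 not_less by blast
  moreover have "q dvd j"
    using assms unfolding pcompose_linear_factors[symmetric]
    by (simp add: coeff_pcompose_monom split: if_splits)
  ultimately show ?thesis using that assms(1) by auto
qed

text \<open>In effect u is set to 1, which is not a legitimate substitution in formal power series.
  Coefficients are compared instead: on each side every \<open>j\<close> occurs with at most one
  power of u.\<close>

lemma qhom_eq_monom_mult_imp:
  assumes "p > 0" "q > 0" "p' > 0" "q' > 0"
    and eq: "qhom p q ts = fps_const (fps_const c * fps_X ^ k) * fps_X ^ l * qhom p' q' ts'"
  shows "(\<Prod>t\<leftarrow>ts. monom 1 q - [:t:]) = smult c (monom 1 l * (\<Prod>t\<leftarrow>ts'. monom 1 q' - [:t:]))"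
    (is "?P = smult c (monom 1 l * ?P')")
proof (rule poly_eqI)
  fix j
  have rhs: "qhom p q ts $ j $ i =
      (if j < l \<or> i < k then 0 else c * qhom p' q' ts' $ (j - l) $ (i - k))" for i j
    unfolding eq by (simp add: mult.assoc fps_X_power_mult_nth)
  show "coeff ?P j = coeff (smult c (monom 1 l * ?P')) j"
  proof (cases "coeff ?P j = 0")
    case False
    then obtain s where s: "j = q * s" "s \<le> length ts"
      using coeff_linear_factors_pcompose assms(2) by blast
    \<comment> \<open>The one power of u that lies on the line together with
      \<open>j = q * s\<close>.\<close>
    define i where "i = p * (length ts - s)"
    have "i * q + j * p = p * q * ((length ts - s) + s)"
      unfolding i_def s(1) by (simp add: algebra_simps)
    then have "qhom p q ts $ j $ i = coeff ?P j"
      using s(2) by (simp add: qhom_nth assms(1,2))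
    with False show ?thesis
      unfolding rhs by (auto simp: qhom_nth assms(3,4) coeff_monom_mult split: if_splits)
  next
    case True
    show ?thesis
    proof (rule ccontr)
      assume neq: "coeff ?P j \<noteq> coeff (smult c (monom 1 l * ?P')) j"
      then have nz: "j \<ge> l" "c \<noteq> 0" "coeff ?P' (j - l) \<noteq> 0"
        using True by (auto simp: coeff_monom_mult split: if_splits)
      then obtain s where s: "j - l = q' * s" "s \<le> length ts'"
        using coeff_linear_factors_pcompose assms(4) by blast
      define i where "i = p' * (length ts' - s)"
      have "i * q' + (j - l) * p' = p' * q' * ((length ts' - s) + s)"
        unfolding i_def s(1) by (simp add: algebra_simps)
      then have "qhom p' q' ts' $ (j - l) $ i = coeff ?P' (j - l)"
        using s(2) by (simp add: qhom_nth assms(3,4))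
      then have "qhom p q ts $ j $ (i + k) \<noteq> 0" using nz unfolding rhs by simp
      then show False using True by (simp add: qhom_nth assms(1,2) split: if_splits)
    qed
  qed
qed

text \<open>\<open>q\<close> and \<open>q'\<close> may differ, so the lists are not compared
  directly. A repeated \<open>t0\<close> makes any w with w^q = t0 a multiple zero of the left side,
  and away from 0 the right side has only simple zeros.\<close>

lemma distinct_of_squarefree_factorization:
  fixes ts :: "complex list"
  assumes "q > 0" "q' > 0" "c \<noteq> 0" "0 \<notin> set ts" "distinct ts'"
    and eq: "(\<Prod>t\<leftarrow>ts. monom 1 q - [:t:]) = smult c (monom 1 l * (\<Prod>t\<leftarrow>ts'. monom 1 q' - [:t:]))"
  shows "distinct ts"
proof (rule ccontr)
  assume "\<not> distinct ts"
  then obtain t0 xs ys zs where ts: "ts = xs @ [t0] @ ys @ [t0] @ zs" by (metis not_distinct_decomp)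
  let ?R = "\<Prod>t\<leftarrow>ts. [:- t, 1:]" and ?S = "\<Prod>t\<leftarrow>ts'. [:- t, 1:]"
  let ?U = "\<Prod>t\<leftarrow>xs @ ys @ zs. [:- t, 1:]"
  have R: "?R = [:- t0, 1:] * ([:- t0, 1:] * ?U)"
    unfolding ts by (simp add: mult_ac del: mult_pCons_left mult_pCons_right)
  have "poly ?R t0 = 0" "poly (pderiv ?R) t0 = 0"
    unfolding R pderiv_mult by simp_all
  obtain w where w: "w ^ q = t0"
    using assms(1) using nth_root_exists by blast
  have w0: "w \<noteq> 0" using w assms(1,4) ts by (auto simp: power_0_left)
  let ?P = "pcompose ?R (monom 1 q)" and ?Q = "pcompose ?S (monom 1 q')"
  have eq': "?P = smult c (monom 1 l * ?Q)"
    unfolding pcompose_linear_factors by (rule eq)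
  have "poly ?P w = 0" "poly (pderiv ?P) w = 0"
    using \<open>poly ?R t0 = 0\<close> \<open>poly (pderiv ?R) t0 = 0\<close> w
    by (simp_all add: poly_pcompose poly_monom pderiv_pcompose)
  then have "poly ?Q w = 0" and "poly (pderiv ?Q) w = 0"
    using assms(3) w0 unfolding eq' by (simp_all add: poly_monom pderiv_smult pderiv_mult)
  then have S: "poly ?S (w ^ q') = 0" "poly (pderiv ?S) (w ^ q') = 0"
    using assms(2) w0 by (simp_all add: poly_pcompose poly_monom pderiv_pcompose pderiv_monom)
  define b where "b = w ^ q'"
  have "b \<in> set ts'" using S(1) by (auto simp: poly_prod_list_eq_0 b_def)
  then obtain us vs where ts': "ts' = us @ b # vs" by (meson split_list)
  let ?V = "\<Prod>t\<leftarrow>us @ vs. [:- t, 1:]"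
  have "?S = [:- b, 1:] * ?V"
    unfolding ts' by (simp add: mult_ac del: mult_pCons_left mult_pCons_right)
  then have "poly (pderiv ?S) b = poly ?V b"
    by (simp only: pderiv_mult) (simp add: pderiv_pCons)
  then have "poly ?V b = 0" using S(2) by (simp add: b_def)
  then have "b \<in> set (us @ vs)" by (auto simp: poly_prod_list_eq_0)
  with assms(5) ts' show False by auto
qed

text \<open>The hypotheses make the homogeneous product the whole edge part of \<open>g\<close>,
  with nothing below the edge. The factorization in \<open>nondegenerate\<close> leaves its
  exponents free, so a given one need not use \<open>p\<close> and \<open>q\<close>.\<close>

lemma nondegenerate_iff_distinct:
  assumes "p > 0" "q > 0" "coprime p q" "ts \<noteq> []" "0 \<notin> set ts"
    and low: "\<And>i j. g $ j $ i \<noteq> 0 \<Longrightarrow> i * q + j * p \<ge> p * q * length ts"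
    and edge: "\<And>i j. i * q + j * p = p * q * length ts \<Longrightarrow>
      g $ j $ i = coeff (\<Prod>t\<leftarrow>ts. monom 1 q - [:t:]) j"
  shows "nondegenerate g \<longleftrightarrow> distinct ts"
proof -
  let ?P = "\<Prod>t\<leftarrow>ts. monom 1 q - [:t:]"
  let ?c = "real (p * q * length ts)"
  let ?S = "{(x, y). x \<ge> 0 \<and> y \<ge> 0 \<and> real q * x + real p * y = ?c}"
  have c: "?c > 0" using assms by simp
  have eq_iff: "real q * real i + real p * real j = ?c \<longleftrightarrow> i * q + j * p = p * q * length ts" for i j
    by (simp flip: of_nat_mult of_nat_add add: mult.commute)
  \<comment> \<open>This coefficient and the one in \<open>const\<close> give the two vertices on
    the axes; the latter is nonzero because no \<open>t\<close> is 0.\<close>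
  have lead: "coeff (\<Prod>t\<leftarrow>xs. monom 1 q - [:t:]) (q * length xs) = 1" for xs :: "complex list"
  proof (induction xs)
    case (Cons x xs)
    have "coeff (\<Prod>t\<leftarrow>xs. monom 1 q - [:t:]) (q * length (x # xs)) = 0"
      using assms(2) by (intro coeff_monom_diff_prod_eq_0) simp
    with Cons show ?case
      unfolding list.map prod_list.Cons coeff_monom_diff_mult by simp
  qed simp
  have const: "coeff ?P 0 \<noteq> 0"
    using assms(2,5) by (auto simp: poly_0_coeff_0[symmetric] poly_prod_list_eq_0 poly_monom power_0_left)
  have "newton_diagram g = quadrant_above (real q) (real p) ?c"
  proof (rule newton_diagram_eq_quadrant_above)
    fix i j assume "g $ j $ i \<noteq> 0"
    then have "p * q * length ts \<le> i * q + j * p" by (rule low)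
    then have "?c \<le> real (i * q + j * p)" by (simp only: of_nat_le_iff)
    then show "?c \<le> real q * real i + real p * real j" by (simp add: mult.commute)
  next
    show "g $ 0 $ (p * length ts) \<noteq> 0" using edge[of "p * length ts" 0] const by (simp add: mult_ac)
    show "g $ (q * length ts) $ 0 \<noteq> 0" using edge[of 0 "q * length ts"] lead[of ts] by (simp add: mult_ac)
  qed (use assms c in \<open>auto simp: mult_ac\<close>)
  then have edges: "S edge_of newton_diagram g \<and> compact S \<longleftrightarrow> S = ?S" for S
    using compact_edge_quadrant_above_iff[of "real q" "real p" ?c S] assms(1,2) c by simp
  have part: "edge_part g ?S = qhom p q ts"
    unfolding edge_part_def
    by (intro fps_ext) (auto simp: eq_iff qhom_nth assms edge simp del: of_nat_mult)
  show ?thesis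
  proof
    assume "nondegenerate g"
    then obtain c k l p' q' A s where fac: "edge_factorization (qhom p q ts) c k l p' q' A s"
      and s: "\<forall>a\<in>A. s a = 1"
      unfolding nondegenerate_def edges using part by auto
    then obtain ts' where ts': "set ts' = A" "distinct ts'"
      by (auto simp: edge_factorization_def dest: finite_distinct_list)
    have "(\<Prod>a\<in>A. (fps_X ^ q' - fps_const (fps_const a * fps_X ^ p')) ^ s a) =
        (\<Prod>a\<in>A. fps_X ^ q' - fps_const (fps_const a * fps_X ^ p'))"
      using s by (intro prod.cong refl) simp
    also have "\<dots> = qhom p' q' ts'"
      unfolding ts'(1)[symmetric] qhom_def using ts'(2) by (simp add: prod.distinct_set_conv_list)
    finally have "qhom p q ts = fps_const (fps_const c * fps_X ^ k) * fps_X ^ l * qhom p' q' ts'"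
      using fac by (simp add: edge_factorization_def)
    moreover have pos: "p' > 0" "q' > 0" "c \<noteq> 0"
      using fac by (simp_all add: edge_factorization_def)
    ultimately have "?P = smult c (monom 1 l * (\<Prod>t\<leftarrow>ts'. monom 1 q' - [:t:]))"
      using qhom_eq_monom_mult_imp[OF assms(1,2) pos(1,2)] by blast
    then show "distinct ts"
      by (rule distinct_of_squarefree_factorization[OF assms(2) pos(2,3) assms(5) ts'(2)])
  next
    assume dist: "distinct ts"
    have "qhom p q ts = (\<Prod>a\<in>set ts. (fps_X ^ q - fps_const (fps_const a * fps_X ^ p)) ^ 1)"
      using dist by (simp add: qhom_def prod.distinct_set_conv_list)
    then have fac1: "edge_factorization (qhom p q ts) 1 0 0 p q (set ts) (\<lambda>_. 1)"
      using assms by (simp add: edge_factorization_def)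
    have "\<exists>c k l p' q' A s. edge_factorization (qhom p q ts) c k l p' q' A s \<and> (\<forall>a\<in>A. s a = 1)"
      by (intro exI conjI, rule fac1) simp
    with part show "nondegenerate g"
      unfolding nondegenerate_def edges by simp
  qed
qed

section \<open>Balls\<close>

lemma pball_iff: "\<gamma> \<in> pball \<alpha> h \<longleftrightarrow> \<gamma> \<in> cpuiseux \<and> ord_ge h (\<gamma> - \<alpha>)"
  by (simp add: pball_def Fin_le_pord_iff)

lemma pball_eq_iff:
  assumes "\<alpha> \<in> cpuiseux"
  shows "pball \<alpha> h = pball \<beta> h \<longleftrightarrow> ord_ge h (\<alpha> - \<beta>)"
proof
  assume "pball \<alpha> h = pball \<beta> h"
  moreover have "\<alpha> \<in> pball \<alpha> h" using assms by (simp add: pball_iff)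
  ultimately show "ord_ge h (\<alpha> - \<beta>)" by (simp add: pball_iff)
next
  assume *: "ord_ge h (\<alpha> - \<beta>)"
  have "ord_ge h (\<gamma> - \<alpha>) \<longleftrightarrow> ord_ge h (\<gamma> - \<beta>)" for \<gamma>
    using * ord_ge_trans ord_ge_minus_commute by blast
  then show "pball \<alpha> h = pball \<beta> h" by (auto simp: pball_iff)
qed

lemma pcoeff_ptrunc: "pcoeff (ptrunc h a) r = (if r < h then pcoeff a r else 0)"
  by (simp add: ptrunc.rep_eq)

text \<open>Every coefficient \<open>c\<close> is realized by a convergent series, so statements
  about all substitutions become identities between polynomials in \<open>c\<close>.\<close>

lemma expands_exists:
  assumes "h \<ge> 0"
  obtains \<gamma> where "\<gamma> \<in> cpuiseux" "expands \<gamma> (ptrunc h \<alpha>) c h"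
proof -
  obtain x where x: "\<And>r. pcoeff x r = (if r = h then c else 0)"
    using puiseux_monom_exists[OF assms] by metis
  let ?\<gamma> = "ptrunc h \<alpha> + x"
  obtain N where N: "N > 0" "\<And>r. pcoeff ?\<gamma> r \<noteq> 0 \<Longrightarrow> r * of_nat N \<in> \<nat>"
    by (rule pcoeff_support[of ?\<gamma>]) blast
  have "?\<gamma> \<in> cpuiseux_root N"
    by (rule finite_support_cpuiseux_root[OF N, where b = h])
      (auto simp: pcoeff_ptrunc x split: if_splits)
  then have "?\<gamma> \<in> cpuiseux" using N(1) by (auto simp: cpuiseux_def)
  moreover have "expands ?\<gamma> (ptrunc h \<alpha>) c h" by (simp add: expands_def x)
  ultimately show ?thesis by (rule that)
qed

lemma pball_height_le:
  assumes "\<alpha> \<in> cpuiseux" "h' \<ge> 0" "pball \<alpha> h' \<subseteq> pball \<beta> h"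
  shows "h \<le> h'"
proof (rule ccontr)
  assume "\<not> h \<le> h'"
  \<comment> \<open>The coefficient at \<open>h'\<close> is made different from that of
    \<open>\<beta>\<close>, which keeps the series out of every ball about \<open>\<beta>\<close> of
    height above \<open>h'\<close>.\<close>
  obtain \<gamma> where \<gamma>: "\<gamma> \<in> cpuiseux" "expands \<gamma> (ptrunc h' \<alpha>) (pcoeff \<beta> h' + 1) h'"
    using expands_exists[OF assms(2)] by blast
  then have "ord_ge h' (\<gamma> - \<alpha>)" "pcoeff \<gamma> h' = pcoeff \<beta> h' + 1"
    by (auto simp: expands_def ord_ge_def pcoeff_ptrunc)
  with \<gamma>(1) assms(3) have "ord_ge h (\<gamma> - \<beta>)" by (auto simp: pball_iff)
  with \<open>\<not> h \<le> h'\<close> have "pcoeff (\<gamma> - \<beta>) h' = 0" by (intro ord_ge_pcoeff[of h]) auto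
  with \<open>pcoeff \<gamma> h' = pcoeff \<beta> h' + 1\<close> show False by simp
qed

lemma pball_height_unique:
  assumes "\<alpha> \<in> cpuiseux" "\<beta> \<in> cpuiseux" "h \<ge> 0" "h' \<ge> 0" "pball \<alpha> h = pball \<beta> h'"
  shows "h = h'"
  using pball_height_le[of \<alpha> h \<beta> h'] pball_height_le[of \<beta> h' \<alpha> h] assms by simp

lemma height_pball:
  assumes "\<alpha> \<in> cpuiseux" "h > 0"
  shows "height (pball \<alpha> h) = h"
  unfolding height_def using assms
  by (intro the_equality) (auto dest: pball_height_unique[OF _ _ less_imp_le less_imp_le])

lemma lam_pball:
  assumes "\<alpha> \<in> cpuiseux" "h > 0"
  shows "lam (pball \<alpha> h) = ptrunc h \<alpha>"
proof -
  have "ptrunc h \<gamma> = ptrunc h \<alpha>" if "\<gamma> \<in> pball \<alpha> h" for \<gamma>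
    using that by (intro puiseux_eqI) (auto simp: pball_iff ord_ge_def pcoeff_ptrunc)
  moreover have "\<alpha> \<in> pball \<alpha> h" using assms by (simp add: pball_iff)
  ultimately show ?thesis
    unfolding lam_def height_pball[OF assms] by (intro the_equality) metis+
qed

text \<open>A point where neither polynomial vanishes fixes the exponent, and then all values agree.
  This serves both for the definite descriptions \<open>F_poly\<close> and \<open>q_exp\<close> and
  for identifying the derivative of F_B.\<close>

lemma poly_leads_unique:
  fixes F G :: "complex poly"
  assumes "F \<noteq> 0" "G \<noteq> 0" and leads: "\<And>c. \<exists>X. leads X q (poly F c) \<and> leads X q' (poly G c)"
  shows "q = q' \<and> F = G"
proof
  have "finite {c. poly (F * G) c = 0}" using assms by (intro poly_roots_finite) simp
  then obtain c where "c \<notin> {c. poly (F * G) c = 0}" using ex_new_if_finite infinite_UNIV_char_0 by blast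
  then have c: "poly F c \<noteq> 0" "poly G c \<noteq> 0" by auto
  obtain X where "leads X q (poly F c)" "leads X q' (poly G c)" using leads by blast
  then show "q = q'" using c leads_unique(1) by blast
  have "poly F c = poly G c" for c
    using leads[of c] unfolding \<open>q = q'\<close> by (auto simp: leads_iff)
  then show "F = G" by (intro poly_ext) auto
qed

section \<open>Roots of unity, the index, and products invariant under conjugation\<close>

lemma chi_of_nat [simp]: "chi (of_nat k) = 1"
  by (simp add: chi_eq_1_iff)

lemma coprime_of_nat_div_in_Ints:
  assumes "(of_nat (a * b) / of_nat c :: rat) \<in> \<int>" "c > 0" "coprime b c"
  shows "c dvd a"
proof -
  obtain z where "(of_nat (a * b) / of_nat c :: rat) = of_int z" using assms(1) by (auto elim: Ints_cases)
  then have "(of_int (int (a * b)) :: rat) = of_int (z * int c)"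
    using assms(2) by (simp add: divide_eq_eq)
  then have "int (a * b) = z * int c" unfolding of_int_eq_iff .
  then have "int c dvd int (a * b)" by simp
  then have "c dvd a * b" by (simp only: of_nat_dvd_iff)
  then show ?thesis using assms(3) coprime_commute coprime_dvd_mult_left_iff by blast
qed

text \<open>\<open>pindex\<close> is defined by minimality, but divisibility is wanted. If
  \<open>rot d\<close> fixes \<open>l\<close>, then gcd(d, N) is, by Bezout, another common
  denominator of the exponents, so it is at least N. The bound \<open>b\<close> supplies convergence
  for it.\<close>

lemma rot_eq_rot_iff:
  assumes N: "N = pindex l" and l: "l \<in> cpuiseux_root D" "D > 0"
    and bounded: "\<And>r. pcoeff l r \<noteq> 0 \<Longrightarrow> r \<le> b"
  shows "N > 0" "rot i l = rot (i + d) l \<longleftrightarrow> N dvd d"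
proof -
  have "N > 0 \<and> l \<in> cpuiseux_root N"
    unfolding N pindex_def by (rule LeastI[of _ D]) (use l in blast)
  then have N0: "N > 0" and lN: "l \<in> cpuiseux_root N" by blast+
  show "N > 0" by (rule N0)
  have "rot i l = rot (i + d) l \<longleftrightarrow> (\<forall>r. pcoeff l r \<noteq> 0 \<longrightarrow> of_nat d * r \<in> \<int>)"
  proof -
    have "rot i l = rot (i + d) l \<longleftrightarrow> l = rot d l"
      unfolding rot_rot[symmetric] by simp
    also have "\<dots> \<longleftrightarrow> (\<forall>r. pcoeff l r = pcoeff (rot d l) r)"
      using puiseux_eqI by metis
    finally show ?thesis by (auto simp: rot.rep_eq chi_eq_1_iff)
  qed
  also have "\<dots> \<longleftrightarrow> N dvd d"
  proof
    assume *: "\<forall>r. pcoeff l r \<noteq> 0 \<longrightarrow> of_nat d * r \<in> \<int>"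
    let ?g = "gcd d N"
    obtain x y where xy: "x * int d + y * int N = int ?g"
      using bezout_int[of "int d" "int N"] by auto
    have "r * of_nat ?g \<in> \<nat>" if r: "pcoeff l r \<noteq> 0" for r
    proof -
      have "(of_nat ?g :: rat) = of_int (x * int d + y * int N)" unfolding xy by simp
      then have "r * of_nat ?g = of_int x * (of_nat d * r) + of_int y * (r * of_nat N)"
        by (simp add: algebra_simps)
      moreover have "r * of_nat N \<in> \<int>"
        using cpuiseux_root_support[OF lN r] by (auto elim: Nats_cases)
      ultimately have "r * of_nat ?g \<in> \<int>" using * r by simp
      moreover have "r \<ge> 0" using r pcoeff_neg not_less by blast
      ultimately show ?thesis by (simp add: Nats_altdef2)
    qed
    then have "l \<in> cpuiseux_root ?g"
      using N0 bounded by (intro finite_support_cpuiseux_root[of _ _ b]) auto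
    then have "?g > 0 \<and> l \<in> cpuiseux_root ?g" using N0 by simp
    then have "pindex l \<le> ?g" unfolding pindex_def by (rule Least_le)
    then have "N \<le> ?g" using N by simp
    then have "?g = N" using N0 by (intro antisym) (auto intro: dvd_imp_le)
    then show "N dvd d" by (metis gcd_dvd1)
  next
    assume "N dvd d"
    then obtain e where "d = N * e" by auto
    then have "of_nat d * r = of_nat e * (r * of_nat N)" for r :: rat by (simp add: mult_ac)
    then show "\<forall>r. pcoeff l r \<noteq> 0 \<longrightarrow> of_nat d * r \<in> \<int>"
      using cpuiseux_root_support[OF lN] by (metis Ints_mult Ints_of_nat Nats_subset_Ints subsetD)
  qed
  finally show "rot i l = rot (i + d) l \<longleftrightarrow> N dvd d" .
qed

text \<open>Up to sign the coefficients are elementary symmetric functions, homogeneous of degree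
  \<open>length \<phi>s - j\<close>. The subtraction takes place in the rationals; for larger
  \<open>j\<close> the coefficients are 0.\<close>

lemma leads_coeff_linear_factors:
  assumes "\<And>\<phi>. \<phi> \<in> set \<phi>s \<Longrightarrow> leads \<phi> q (w \<phi>)"
  shows "leads (coeff (\<Prod>\<phi>\<leftarrow>\<phi>s. [:- \<phi>, 1:]) j) (q * (of_nat (length \<phi>s) - of_nat j))
    (coeff (\<Prod>\<phi>\<leftarrow>\<phi>s. [:- w \<phi>, 1:]) j)"
  using assms
proof (induction \<phi>s arbitrary: j)
  case Nil
  show ?case
  proof (cases j)
    case 0
    then show ?thesis by (simp add: leads_iff pcoeff_1)
  qed (simp add: leads_iff)
next
  case (Cons \<phi> \<phi>s)
  let ?Q = "\<Prod>\<phi>\<leftarrow>\<phi>s. [:- \<phi>, 1:]" and ?P = "\<Prod>\<phi>\<leftarrow>\<phi>s. [:- w \<phi>, 1:]"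
  let ?r = "q * (of_nat (length (\<phi> # \<phi>s)) - of_nat j)"
  have IH: "leads (coeff ?Q j) (q * (of_nat (length \<phi>s) - of_nat j)) (coeff ?P j)" for j
    using Cons by simp
  have \<phi>: "leads (- \<phi>) q (- w \<phi>)" using Cons.prems[of \<phi>] by (simp add: leads_iff ord_ge_def)
  have coeff: "coeff ([:- x, 1:] * W) j = - x * coeff W j + (if j = 0 then 0 else coeff W (j - 1))"
    for x :: "'a :: comm_ring_1" and W
    by (cases j) auto
  have "leads (- \<phi> * coeff ?Q j) ?r (- w \<phi> * coeff ?P j)"
    using leads_mult[OF \<phi> IH[of j]] by (simp add: algebra_simps)
  moreover have "leads (if j = 0 then 0 else coeff ?Q (j - 1)) ?r (if j = 0 then 0 else coeff ?P (j - 1))"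
  proof (cases "j = 0")
    case False
    then have r: "q * (of_nat (length \<phi>s) - of_nat (j - 1)) = ?r" by (simp add: of_nat_diff algebra_simps)
    from IH[of "j - 1"] False show ?thesis unfolding r by simp
  qed (simp add: leads_zero)
  ultimately show ?case
    unfolding list.map prod_list.Cons coeff by (rule leads_add)
qed

lemma of_fps_0 [simp]: "of_fps 0 = 0"
  by (rule of_root_0)

lemma of_fps_inject: "of_fps g = of_fps h \<longleftrightarrow> g = h"
proof
  assume "of_fps g = of_fps h"
  then have "pcoeff (of_fps g) (of_nat i) = pcoeff (of_fps h) (of_nat i)" for i by simp
  then show "g = h" unfolding pcoeff_of_fps_of_nat by (rule fps_ext)
qed simp

text \<open>The coefficients are fixed by \<open>rot 1\<close>, so every exponent r that occurs
  satisfies \<open>chi r = 1\<close> and is an integer. This justifies the definite description in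
  \<open>disc_orbit\<close>.\<close>

lemma rot_invariant_linear_factors:
  assumes "image_mset (rot 1) (mset \<phi>s) = mset \<phi>s"
  shows "\<exists>!g. map_poly of_fps g = (\<Prod>\<phi>\<leftarrow>\<phi>s. [:- \<phi>, 1:])"
proof -
  let ?Q = "\<Prod>\<phi>\<leftarrow>\<phi>s. [:- \<phi>, 1:]"
  have map_rot: "map_poly (rot 1) (\<Prod>\<phi>\<leftarrow>xs. [:- \<phi>, 1:]) = (\<Prod>\<phi>\<leftarrow>map (rot 1) xs. [:- \<phi>, 1:])" for xs
  proof (induction xs)
    case (Cons x xs)
    have "map_poly (rot 1) ([:- x, 1:] * W) = [:- rot 1 x, 1:] * map_poly (rot 1) W" for W
    proof (rule poly_eqI)
      fix j show "coeff (map_poly (rot 1) ([:- x, 1:] * W)) j = coeff ([:- rot 1 x, 1:] * map_poly (rot 1) W) j"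
        by (cases j) (simp_all add: coeff_map_poly)
    qed
    with Cons show ?case by (simp del: mult_pCons_left)
  qed (simp add: map_poly_1')
  have "(\<Prod>\<phi>\<leftarrow>map (rot 1) \<phi>s. [:- \<phi>, 1:]) = prod_mset (image_mset (\<lambda>\<phi>. [:- \<phi>, 1:]) (mset (map (rot 1) \<phi>s)))"
    by (simp add: multiset.map_comp flip: prod_mset_prod_list)
  also have "\<dots> = ?Q" using assms by (simp flip: prod_mset_prod_list)
  finally have inv: "map_poly (rot 1) ?Q = ?Q" unfolding map_rot .
  have supp: "r \<in> \<nat>" if r: "pcoeff (coeff ?Q j) r \<noteq> 0" for j r
  proof -
    have "pcoeff (rot 1 (coeff ?Q j)) r = pcoeff (coeff ?Q j) r"
      using arg_cong[OF inv, of "\<lambda>p. pcoeff (coeff p j) r"] by (simp add: coeff_map_poly)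
    then have "chi r = 1" using r by (simp add: rot.rep_eq)
    moreover have "r \<ge> 0" using r pcoeff_neg not_less by blast
    ultimately show ?thesis by (simp add: chi_eq_1_iff Nats_altdef2)
  qed
  let ?\<psi> = "\<lambda>a. Abs_fps (\<lambda>i. pcoeff a (of_nat i))"
  have \<psi>0: "?\<psi> 0 = 0" by (simp add: fps_eq_iff)
  have "of_fps (?\<psi> (coeff ?Q j)) = coeff ?Q j" for j
    using supp_imp_of_root[of 1 "coeff ?Q j"] supp[of j] by simp
  then have "map_poly of_fps (map_poly ?\<psi> ?Q) = ?Q"
    by (intro poly_eqI) (simp only: coeff_map_poly \<psi>0 of_fps_0)
  moreover have "g = g'" if "map_poly of_fps g = map_poly of_fps g'" for g g'
  proof (rule poly_eqI)
    fix j
    have "coeff (map_poly of_fps g) j = coeff (map_poly of_fps g') j" using that by simp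
    then show "coeff g j = coeff g' j" by (simp only: coeff_map_poly of_fps_0 of_fps_inject)
  qed
  ultimately show ?thesis by metis
qed

section \<open>A ball of the tree\<close>

text \<open>The ball is given by a centre \<open>\<alpha>0\<close> and a second root
  \<open>\<alpha>1\<close> whose contact with it is exactly \<open>h\<close>. Their coefficients at
  x^h differ, which provides two distinct roots of F_B.\<close>

locale tree_ball =
  fixes f u u' :: "complex fps fps" and \<alpha>s \<gamma>s :: "puiseux list" and D :: nat
    and \<alpha>0 \<alpha>1 :: puiseux and h :: rat
  assumes unit: "u $ 0 $ 0 \<noteq> 0" "u' $ 0 $ 0 \<noteq> 0"
    and frac: "set \<alpha>s \<subseteq> frac_series" "set \<gamma>s \<subseteq> frac_series"
    and factors: "germ_to_puiseux f = germ_to_puiseux u * (\<Prod>\<alpha>\<leftarrow>\<alpha>s. fps_X - fps_const \<alpha>)"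
      "germ_to_puiseux (fps_deriv f) =
         germ_to_puiseux u' * (\<Prod>\<gamma>\<leftarrow>\<gamma>s. fps_X - fps_const \<gamma>)"
    and D: "D > 0" "set \<alpha>s \<subseteq> cpuiseux_root D"
    and contact: "\<alpha>0 \<in> set \<alpha>s" "\<alpha>1 \<in> set \<alpha>s" "contact \<alpha>0 \<alpha>1 = Fin h"
begin

definition B :: "puiseux set" where "B = pball \<alpha>0 h"

definition l :: puiseux where "l = ptrunc h \<alpha>0"

definition near :: "puiseux \<Rightarrow> bool" where "near \<gamma> \<longleftrightarrow> ord_ge h (\<gamma> - l)"

definition lc :: "puiseux \<Rightarrow> complex" where "lc \<gamma> = pcoeff (\<gamma> - l) h"

definition F :: "complex poly" where
  "F = smult (u $ 0 $ 0) (\<Prod>\<alpha>\<leftarrow>\<alpha>s. lpoly l h \<alpha>)"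

definition q :: rat where "q = (\<Sum>\<alpha>\<leftarrow>\<alpha>s. ldeg l h \<alpha>)"

definition bal :: "nat \<Rightarrow> puiseux set" where "bal k = pball (rot k \<alpha>0) h"

definition \<Gamma> :: "puiseux list" where "\<Gamma> = filter (leaves_at f B) \<gamma>s"

lemma in_cpuiseux: "\<alpha> \<in> set \<alpha>s \<Longrightarrow> \<alpha> \<in> cpuiseux" "\<gamma> \<in> set \<gamma>s \<Longrightarrow> \<gamma> \<in> cpuiseux"
  using frac by (auto simp: frac_series_def)

lemma diff_leads: obtains c where "c \<noteq> 0" "leads (\<alpha>0 - \<alpha>1) h c"
  using contact(3) by (auto simp: pord_eq_Fin_iff)

lemma h_pos: "h > 0"
proof -
  obtain \<delta> where \<delta>: "\<delta> > 0" "ord_ge \<delta> \<alpha>0" using frac_series_ord_ge contact(1) frac(1) by blast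
  obtain \<epsilon> where \<epsilon>: "\<epsilon> > 0" "ord_ge \<epsilon> \<alpha>1" using frac_series_ord_ge contact(2) frac(1) by blast
  obtain c where c: "c \<noteq> 0" "leads (\<alpha>0 - \<alpha>1) h c" by (rule diff_leads)
  have "ord_ge (min \<delta> \<epsilon>) (\<alpha>0 - \<alpha>1)"
    using \<delta> \<epsilon> by (intro ord_ge_diff) (auto intro: ord_ge_mono)
  then have "min \<delta> \<epsilon> \<le> h" using c by (auto simp: leads_iff ord_ge_def not_less[symmetric])
  with \<delta> \<epsilon> show ?thesis by simp
qed

lemma near_iff: "near \<gamma> \<longleftrightarrow> ord_ge h (\<gamma> - \<alpha>0)"
proof -
  have "ord_ge h (\<alpha>0 - l)" by (simp add: ord_ge_def l_def pcoeff_ptrunc)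
  then show ?thesis unfolding near_def using ord_ge_trans ord_ge_minus_commute by blast
qed

lemma in_B_iff: "\<gamma> \<in> B \<longleftrightarrow> \<gamma> \<in> cpuiseux \<and> near \<gamma>"
  by (simp add: B_def pball_iff near_iff)

lemma near_contact: "near \<alpha>0" "near \<alpha>1" "lc \<alpha>0 \<noteq> lc \<alpha>1"
proof -
  obtain c where "c \<noteq> 0" "leads (\<alpha>0 - \<alpha>1) h c" by (rule diff_leads)
  then show "near \<alpha>0" "near \<alpha>1" "lc \<alpha>0 \<noteq> lc \<alpha>1"
    by (auto simp: near_iff leads_iff lc_def ord_ge_minus_commute[of h \<alpha>1])
qed

lemma expands_l: "near \<gamma> \<Longrightarrow> expands \<gamma> l (lc \<gamma>) h"
  by (simp add: expands_iff near_def lc_def)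

lemma l_ord_ge: obtains \<delta> where "\<delta> > 0" "ord_ge \<delta> l"
proof -
  obtain \<delta> where "\<delta> > 0" "ord_ge \<delta> \<alpha>0" using frac_series_ord_ge contact(1) frac(1) by blast
  then show ?thesis using that[of \<delta>] by (auto simp: ord_ge_def l_def pcoeff_ptrunc)
qed

lemma height_B: "height B = h"
  unfolding B_def using in_cpuiseux contact h_pos by (intro height_pball) auto

lemma lam_B: "lam B = l"
  unfolding B_def l_def using in_cpuiseux contact h_pos by (intro lam_pball) auto

section \<open>Leading data of \<open>f\<close> on the ball, and the critical points of F_B\<close>

lemma leads_F:
  assumes "expands \<gamma> l c h"
  shows "leads (psubst f \<gamma>) q (poly F c)"
proof -
  obtain \<delta> where "\<delta> > 0" "ord_ge \<delta> l" by (rule l_ord_ge)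
  from leads_psubst[OF this h_pos assms factors(1)] show ?thesis unfolding q_def F_def .
qed

lemma F_nonzero: "F \<noteq> 0"
  using unit lpoly_nonzero by (auto simp: F_def prod_list_zero_iff)

lemma expands_l_exists: obtains \<gamma> where "\<gamma> \<in> cpuiseux" "expands \<gamma> l c h"
  unfolding l_def using expands_exists[of h \<alpha>0 c] h_pos by (metis less_imp_le)

lemma leading_data_iff: "leading_data f B G r \<longleftrightarrow> G = F \<and> r = q"
proof
  assume "leading_data f B G r"
  then have G: "G \<noteq> 0"
    and exp: "\<And>c \<gamma>. \<gamma> \<in> cpuiseux \<Longrightarrow> expands \<gamma> l c h \<Longrightarrow> leads (psubst f \<gamma>) r (poly G c)"
    by (auto simp: leading_data_def height_B lam_B)
  have "\<exists>X. leads X r (poly G c) \<and> leads X q (poly F c)" for c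
    using exp leads_F expands_l_exists[of c] by metis
  then show "G = F \<and> r = q" using poly_leads_unique[OF G F_nonzero] by blast
next
  assume "G = F \<and> r = q"
  then show "leading_data f B G r"
    using F_nonzero leads_F by (auto simp: leading_data_def height_B lam_B)
qed

lemma F_poly_B: "F_poly f B = F"
  unfolding F_poly_def leading_data_iff by blast

lemma q_exp_B: "q_exp f B = q"
  unfolding q_exp_def leading_data_iff by blast

lemma poly_F_eq_0_iff: "poly F z = 0 \<longleftrightarrow> (\<exists>\<alpha>\<in>set \<alpha>s. near \<alpha> \<and> lc \<alpha> = z)"
proof -
  have "poly (lpoly l h \<alpha>) z = 0 \<longleftrightarrow> near \<alpha> \<and> lc \<alpha> = z" for \<alpha>
  proof (cases "near \<alpha>")
    case True
    then have "poly (lpoly l h \<alpha>) z = z - lc \<alpha>" by (simp add: lpoly_def near_def lc_def)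
    with True show ?thesis by auto
  next
    case False
    then show ?thesis using far_leads(2)[of h \<alpha> l] by (simp add: lpoly_def near_def)
  qed
  then show ?thesis using unit by (simp add: F_def poly_prod_list_eq_0)
qed

lemma F_roots: "poly F (lc \<alpha>0) = 0" "poly F (lc \<alpha>1) = 0"
  using poly_F_eq_0_iff contact near_contact by blast+

lemma degree_F: "degree F > 0"
proof (rule ccontr)
  assume "\<not> degree F > 0"
  then obtain c where "F = [:c:]" by (auto elim: degree_eq_zeroE)
  with F_roots(1) F_nonzero show False by simp
qed

text \<open>Both factorizations compute the leading term of the y-derivative along the ball, so
  \<open>pderiv F\<close> is a constant times the product of the \<open>lpoly\<close> of the
  \<gamma>. Only those in the ball contribute a root.\<close>

lemma proots_deriv_F: "proots (pderiv F) = image_mset lc (filter_mset near (mset \<gamma>s))"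
proof -
  let ?P = "\<Prod>\<gamma>\<leftarrow>\<gamma>s. lpoly l h \<gamma>"
  let ?G = "smult (u' $ 0 $ 0) ?P"
  obtain \<delta> where \<delta>: "\<delta> > 0" "ord_ge \<delta> l" by (rule l_ord_ge)
  have dF: "pderiv F \<noteq> 0" using degree_F by (auto simp: pderiv_eq_0_iff)
  have P: "?P \<noteq> 0" using lpoly_nonzero by (auto simp: prod_list_zero_iff)
  then have G: "?G \<noteq> 0" using unit by simp
  have "\<exists>X. leads X (q - h) (poly (pderiv F) c) \<and> leads X (\<Sum>\<gamma>\<leftarrow>\<gamma>s. ldeg l h \<gamma>) (poly ?G c)" for c
  proof -
    obtain \<gamma> where \<gamma>: "expands \<gamma> l c h" using expands_l_exists by metis
    from leads_psubst_deriv[OF \<delta> h_pos \<gamma> factors(1)] leads_psubst[OF \<delta> h_pos \<gamma> factors(2)]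
    show ?thesis unfolding F_def q_def by blast
  qed
  then have "pderiv F = ?G" using poly_leads_unique[OF dF G] by blast
  then have "proots (pderiv F) = proots ?P" using unit by simp
  also have "\<dots> = image_mset lc (filter_mset near (mset \<gamma>s))"
  proof (induction \<gamma>s)
    case (Cons \<gamma> \<gamma>s)
    have "(\<Prod>\<gamma>\<leftarrow>\<gamma>s. lpoly l h \<gamma>) \<noteq> 0" using lpoly_nonzero by (auto simp: prod_list_zero_iff)
    with Cons show ?case
      by (simp add: proots_mult lpoly_nonzero proots_lpoly near_def lc_def)
  qed simp
  finally show ?thesis .
qed

section \<open>Conjugate balls and the roots leaving the tree there\<close>

lemma rot_\<alpha>s: "image_mset (rot k) (mset \<alpha>s) = mset \<alpha>s"
  by (rule rot_roots[OF factors(1) unit(1)])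

lemma rot_\<gamma>s: "image_mset (rot k) (mset \<gamma>s) = mset \<gamma>s"
  by (rule rot_roots[OF factors(2) unit(2)])

lemma rot_image_\<alpha>s: "rot k ` set \<alpha>s = set \<alpha>s"
  using arg_cong[OF rot_\<alpha>s[of k], of set_mset] by simp

lemma Zer_f: "Zer f = set \<alpha>s"
  by (rule Zer_eq_roots[OF factors(1) unit(1) frac(1)])

lemma rot_\<alpha>0: "rot k \<alpha>0 \<in> set \<alpha>s" "rot k \<alpha>0 \<in> cpuiseux"
  using rot_image_\<alpha>s[of k] contact(1) in_cpuiseux by blast+

lemma bal_0: "bal 0 = B"
  by (simp add: bal_def B_def)

lemma height_bal: "height (bal k) = h"
  unfolding bal_def using rot_\<alpha>0 h_pos by (intro height_pball) auto

lemma leaves_at_bal_rot: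
  assumes "\<gamma> \<in> set \<gamma>s"
  shows "leaves_at f (bal k) (rot k \<gamma>) \<longleftrightarrow> leaves_at f B \<gamma>"
proof -
  have "rot k ` set \<gamma>s = set \<gamma>s" using arg_cong[OF rot_\<gamma>s[of k], of set_mset] by simp
  then have "rot k \<gamma> \<in> cpuiseux" "\<gamma> \<in> cpuiseux" using assms in_cpuiseux by blast+
  then have "rot k \<gamma> \<in> bal k \<longleftrightarrow> \<gamma> \<in> B"
    by (simp add: bal_def B_def pball_iff flip: rot_diff)
  moreover have "(\<lambda>\<alpha>. contact \<alpha> (rot k \<gamma>)) ` set \<alpha>s = (\<lambda>\<alpha>. contact \<alpha> (rot k \<gamma>)) ` rot k ` set \<alpha>s"
    by (simp only: rot_image_\<alpha>s)
  then have "(\<lambda>\<alpha>. contact \<alpha> (rot k \<gamma>)) ` set \<alpha>s = (\<lambda>\<alpha>. contact \<alpha> \<gamma>) ` set \<alpha>s"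
    by (simp add: image_image flip: rot_diff)
  ultimately show ?thesis
    unfolding leaves_at_def Zer_f height_bal height_B by simp
qed

text \<open>\<open>\<alpha>0\<close> already has contact at least \<open>h\<close> with a \<gamma>
  in the ball. The maximum exceeds \<open>h\<close> exactly if some root \<alpha> in the ball shares
  the coefficient of \<gamma> at x^h, which is then a zero of \<open>F\<close>.\<close>

lemma leaves_at_B_iff:
  assumes "\<gamma> \<in> set \<gamma>s"
  shows "leaves_at f B \<gamma> \<longleftrightarrow> near \<gamma> \<and> poly F (lc \<gamma>) \<noteq> 0"
proof (cases "near \<gamma>")
  case True
  have ne: "set \<alpha>s \<noteq> {}" using contact(1) by auto
  have "Fin h \<le> contact \<alpha>0 \<gamma>"
    using True by (simp add: Fin_le_pord_iff near_iff ord_ge_minus_commute)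
  then have "Fin h = Max ((\<lambda>\<alpha>. contact \<alpha> \<gamma>) ` set \<alpha>s) \<longleftrightarrow> (\<forall>\<alpha>\<in>set \<alpha>s. contact \<alpha> \<gamma> \<le> Fin h)"
    using ne contact(1) by (auto simp: eq_Max_iff intro: antisym)
  also have "\<dots> \<longleftrightarrow> (\<forall>\<alpha>\<in>set \<alpha>s. \<not> (near \<alpha> \<and> lc \<alpha> = lc \<gamma>))"
  proof -
    have "contact \<alpha> \<gamma> \<le> Fin h \<longleftrightarrow> \<not> (near \<alpha> \<and> lc \<alpha> = lc \<gamma>)" for \<alpha>
    proof -
      have "near \<alpha> \<and> lc \<alpha> = lc \<gamma> \<longleftrightarrow> ord_ge h (\<alpha> - \<gamma>) \<and> pcoeff (\<alpha> - \<gamma>) h = 0"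
      proof -
        have "ord_ge h (\<gamma> - l)" using True by (simp add: near_def)
        then have "near \<alpha> \<longleftrightarrow> ord_ge h (\<alpha> - \<gamma>)"
          unfolding near_def using ord_ge_trans ord_ge_minus_commute by blast
        then show ?thesis by (auto simp: lc_def)
      qed
      also have "\<dots> \<longleftrightarrow> \<not> pord (\<alpha> - \<gamma>) \<le> Fin h"
      proof (cases "\<alpha> - \<gamma> = 0")
        case False
        then obtain r c where rc: "c \<noteq> 0" "leads (\<alpha> - \<gamma>) r c" by (rule leads_exists)
        then have "pord (\<alpha> - \<gamma>) = Fin r" by (auto simp: pord_eq_Fin_iff)
        moreover have "ord_ge h (\<alpha> - \<gamma>) \<and> pcoeff (\<alpha> - \<gamma>) h = 0 \<longleftrightarrow> h < r"
        proof
          assume *: "ord_ge h (\<alpha> - \<gamma>) \<and> pcoeff (\<alpha> - \<gamma>) h = 0"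
          show "h < r"
          proof (rule ccontr)
            assume "\<not> h < r"
            then consider "r < h" | "r = h" by linarith
            then show False using * rc unfolding leads_iff ord_ge_def by cases auto
          qed
        next
          assume "h < r"
          then show "ord_ge h (\<alpha> - \<gamma>) \<and> pcoeff (\<alpha> - \<gamma>) h = 0"
            using rc(2) unfolding leads_iff ord_ge_def by auto
        qed
        ultimately show ?thesis by (simp add: not_le)
      qed (simp add: pord_def)
      finally show ?thesis by blast
    qed
    then show ?thesis by blast
  qed
  finally show ?thesis
    using True assms in_cpuiseux by (auto simp: leaves_at_def Zer_f height_B in_B_iff poly_F_eq_0_iff)
qed (simp add: leaves_at_def in_B_iff)

section \<open>The orbit of the ball\<close>

lemma l_cpuiseux_root: "l \<in> cpuiseux_root D"
  using D contact(1)
  by (intro finite_support_cpuiseux_root[of D l h])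
    (auto simp: l_def pcoeff_ptrunc split: if_splits intro: cpuiseux_root_support)

text \<open>A ball of height \<open>h\<close> only sees exponents below \<open>h\<close> of its
  centre, so its stabilizer is that of the truncation \<open>l\<close>, described by the
  index.\<close>

lemma bal_eq_iff:
  assumes "N = pindex l"
  shows "bal i = bal (i + d) \<longleftrightarrow> N dvd d"
proof -
  have "bal i = bal (i + d) \<longleftrightarrow> ord_ge h (rot i \<alpha>0 - rot (i + d) \<alpha>0)"
    unfolding bal_def using rot_\<alpha>0(2) by (rule pball_eq_iff)
  also have "\<dots> \<longleftrightarrow> (\<forall>r. pcoeff (rot i l) r = pcoeff (rot (i + d) l) r)"
    by (auto simp: ord_ge_def rot.rep_eq l_def pcoeff_ptrunc)
  also have "\<dots> \<longleftrightarrow> rot i l = rot (i + d) l" using puiseux_eqI by metis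
  also have "\<dots> \<longleftrightarrow> N dvd d"
    by (rule rot_eq_rot_iff(2)[OF assms l_cpuiseux_root D(1), of h])
      (simp add: l_def pcoeff_ptrunc split: if_splits)
  finally show ?thesis .
qed

lemma pindex_l_pos: "pindex l > 0"
  by (rule rot_eq_rot_iff(1)[OF refl l_cpuiseux_root D(1), of h])
    (simp add: l_def pcoeff_ptrunc split: if_splits)

text \<open>\<open>orbit\<close> admits every root in \<open>B\<close> as centre. The height is
  determined by the ball, and conjugating two centres by the same \<open>rot k\<close> gives the
  same ball.\<close>

lemma orbit_B: "orbit f D B = range bal"
proof
  show "orbit f D B \<subseteq> range bal"
  proof
    fix X assume "X \<in> orbit f D B"
    then obtain \<theta> \<alpha> h' where X: "X = pball (pconj D \<theta> \<alpha>) h'" and \<theta>: "\<theta> ^ D = 1"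
      and \<alpha>: "\<alpha> \<in> set \<alpha>s" and h': "h' > 0" and B: "B = pball \<alpha> h'"
      unfolding orbit_def Zer_f by blast
    obtain k where k: "\<theta> = chi (of_nat k / of_nat D)" by (rule root_of_unity_eq_chi[OF D(1) \<theta>])
    have "h' = h"
      using B h' h_pos in_cpuiseux \<alpha> contact(1) pball_height_unique[of \<alpha> \<alpha>0 h' h]
      by (simp add: B_def)
    moreover have "pconj D \<theta> \<alpha> = rot k \<alpha>"
      unfolding k using D \<alpha> by (intro pconj_eq_rot) (auto intro: cpuiseux_root_support)
    moreover have "pball (rot k \<alpha>) h = pball (rot k \<alpha>0) h"
    proof -
      have "rot k \<alpha> \<in> cpuiseux" using rot_image_\<alpha>s[of k] \<alpha> in_cpuiseux by blast
      moreover have "ord_ge h (\<alpha> - \<alpha>0)"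
        using B \<open>h' = h\<close> pball_eq_iff[of \<alpha> h \<alpha>0] in_cpuiseux \<alpha> by (simp add: B_def)
      ultimately show ?thesis by (simp add: pball_eq_iff flip: rot_diff)
    qed
    ultimately have "X = bal k" using X by (simp add: bal_def)
    then show "X \<in> range bal" by blast
  qed
  show "range bal \<subseteq> orbit f D B"
  proof clarify
    fix k
    let ?\<theta> = "chi (of_nat k / of_nat D)"
    have "?\<theta> ^ D = 1" using D(1) by (simp flip: chi_of_nat_mult)
    moreover have "pconj D ?\<theta> \<alpha>0 = rot k \<alpha>0"
      using D contact(1) by (intro pconj_eq_rot) (auto intro: cpuiseux_root_support)
    then have "bal k = pball (pconj D ?\<theta> \<alpha>0) h" by (simp add: bal_def)
    ultimately show "bal k \<in> orbit f D B"
      unfolding orbit_def Zer_f using contact(1) h_pos B_def by blast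
  qed
qed

lemma orbit_B_bij: "bij_betw bal {..<pindex l} (orbit f D B)"
  unfolding bij_betw_def orbit_B
proof
  have *: "i = j" if "bal i = bal j" "i \<le> j" "j < pindex l" for i j
  proof -
    from that(2) obtain d where d: "j = i + d" by (auto simp: le_iff_add)
    then have "pindex l dvd d" using bal_eq_iff[OF refl] that(1) by simp
    with d that(3) show ?thesis by (auto dest: dvd_imp_le)
  qed
  show "inj_on bal {..<pindex l}"
    by (rule inj_onI) (metis * lessThan_iff nat_le_linear)
  show "bal ` {..<pindex l} = range bal"
  proof
    show "range bal \<subseteq> bal ` {..<pindex l}"
    proof clarify
      fix k
      have "bal (k mod pindex l) = bal (k mod pindex l + (k - k mod pindex l))"
        by (subst bal_eq_iff[OF refl]) (simp add: minus_mod_eq_mult_div)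
      then have "bal k = bal (k mod pindex l)" by simp
      moreover have "k mod pindex l \<in> {..<pindex l}" using pindex_l_pos by simp
      ultimately show "bal k \<in> bal ` {..<pindex l}" by blast
    qed
  qed blast
qed

section \<open>The roots of the discriminant of the orbit\<close>

lemma psubst_rot_\<gamma>:
  assumes "\<gamma> \<in> set \<gamma>s"
  shows "psubst f (rot k \<gamma>) = rot k (psubst f \<gamma>)"
proof -
  obtain \<delta> where "\<delta> > 0" "ord_ge \<delta> \<gamma>" using frac_series_ord_ge frac(2) assms by blast
  then show ?thesis by (rule psubst_rot)
qed

text \<open>The multiset of all \<gamma> is invariant under conjugation and so can be reindexed by
  \<open>rot k\<close> before filtering; multiplicities are kept.\<close>

lemma mset_leaves_bal: "filter_mset (leaves_at f (bal k)) (mset \<gamma>s) = image_mset (rot k) (mset \<Gamma>)"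
proof -
  have "filter_mset (leaves_at f (bal k)) (mset \<gamma>s) =
      filter_mset (leaves_at f (bal k)) (image_mset (rot k) (mset \<gamma>s))"
    by (simp only: rot_\<gamma>s)
  also have "\<dots> = image_mset (rot k) (filter_mset (\<lambda>\<gamma>. leaves_at f (bal k) (rot k \<gamma>)) (mset \<gamma>s))"
    by (rule filter_mset_image_mset)
  also have "filter_mset (\<lambda>\<gamma>. leaves_at f (bal k) (rot k \<gamma>)) (mset \<gamma>s) = mset \<Gamma>"
    unfolding \<Gamma>_def mset_filter by (intro filter_mset_cong refl) (simp add: leaves_at_bal_rot)
  finally show ?thesis .
qed

text \<open>The roots in v of the discriminant of the orbit. Block \<open>k\<close> belongs to the
  ball \<open>bal k\<close>, since substituting \<open>rot k \<gamma>\<close> into \<open>f\<close>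
  conjugates the value by \<open>rot k\<close>.\<close>

definition \<phi>s :: "puiseux list" where
  "\<phi>s = concat (map (\<lambda>k. map (\<lambda>\<gamma>. rot k (psubst f \<gamma>)) \<Gamma>) [0..<pindex l])"

lemma mset_\<phi>s: "mset \<phi>s = (\<Sum>k<pindex l. image_mset (\<lambda>\<gamma>. rot k (psubst f \<gamma>)) (mset \<Gamma>))"
proof -
  have "mset (concat (map (\<lambda>k. map (\<lambda>\<gamma>. rot k (psubst f \<gamma>)) \<Gamma>) [0..<n])) =
      (\<Sum>k<n. image_mset (\<lambda>\<gamma>. rot k (psubst f \<gamma>)) (mset \<Gamma>))" for n
    by (induction n) auto
  then show ?thesis by (simp add: \<phi>s_def)
qed

lemma disc_ball_bal:
  "disc_ball f \<gamma>s (bal k) = (\<Prod>\<phi>\<in>#image_mset (\<lambda>\<gamma>. rot k (psubst f \<gamma>)) (mset \<Gamma>). [:- \<phi>, 1:])"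
proof -
  have "disc_ball f \<gamma>s (bal k) =
      (\<Prod>\<gamma>\<in>#filter_mset (leaves_at f (bal k)) (mset \<gamma>s). [:- psubst f \<gamma>, 1:])"
    unfolding disc_ball_def by (simp flip: prod_mset_prod_list mset_filter)
  also have "\<dots> = (\<Prod>\<gamma>\<in>#mset \<Gamma>. [:- psubst f (rot k \<gamma>), 1:])"
    unfolding mset_leaves_bal by (simp add: multiset.map_comp comp_def)
  also have "\<dots> = (\<Prod>\<gamma>\<in>#mset \<Gamma>. [:- rot k (psubst f \<gamma>), 1:])"
    by (intro arg_cong[of _ _ prod_mset] image_mset_cong) (auto simp: \<Gamma>_def psubst_rot_\<gamma>)
  finally show ?thesis by (simp add: multiset.map_comp comp_def)
qed

lemma prod_disc_ball:
  "(\<Prod>B'\<in>orbit f D B. disc_ball f \<gamma>s B') = (\<Prod>\<phi>\<leftarrow>\<phi>s. [:- \<phi>, 1:])"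
proof -
  have "(\<Prod>B'\<in>orbit f D B. disc_ball f \<gamma>s B') = (\<Prod>k<pindex l. disc_ball f \<gamma>s (bal k))"
    by (rule prod.reindex_bij_betw[OF orbit_B_bij, symmetric])
  also have "\<dots> = (\<Prod>\<phi>\<in>#mset \<phi>s. [:- \<phi>, 1:])"
  proof -
    have "(\<Prod>k<n. disc_ball f \<gamma>s (bal k)) =
        (\<Prod>\<phi>\<in>#(\<Sum>k<n. image_mset (\<lambda>\<gamma>. rot k (psubst f \<gamma>)) (mset \<Gamma>)). [:- \<phi>, 1:])" for n
    proof (induction n)
      case (Suc n)
      then show ?case
        unfolding sum.lessThan_Suc prod.lessThan_Suc disc_ball_bal image_mset_union prod_mset.union
        by simp
    qed simp
    then show ?thesis by (simp only: mset_\<phi>s)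
  qed
  also have "\<dots> = (\<Prod>\<phi>\<leftarrow>\<phi>s. [:- \<phi>, 1:])"
    by (simp flip: prod_mset_prod_list)
  finally show ?thesis .
qed

text \<open>\<open>rot 1\<close> moves block \<open>k\<close> to block \<open>k + 1\<close>, and
  block \<open>pindex l\<close> is block 0 because \<open>rot (pindex l)\<close> fixes the
  ball.\<close>

lemma rot_\<phi>s: "image_mset (rot 1) (mset \<phi>s) = mset \<phi>s"
proof -
  let ?b = "\<lambda>k. image_mset (\<lambda>\<gamma>. rot k (psubst f \<gamma>)) (mset \<Gamma>)"
  have "?b (pindex l) = image_mset (psubst f) (image_mset (rot (pindex l)) (mset \<Gamma>))"
    by (auto simp: multiset.map_comp \<Gamma>_def psubst_rot_\<gamma> intro!: image_mset_cong)
  also have "image_mset (rot (pindex l)) (mset \<Gamma>) = mset \<Gamma>"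
  proof -
    have "bal (pindex l) = bal 0" using bal_eq_iff[OF refl, of 0 "pindex l"] by simp
    then have "image_mset (rot (pindex l)) (mset \<Gamma>) = filter_mset (leaves_at f B) (mset \<gamma>s)"
      unfolding mset_leaves_bal[symmetric] bal_0 by (rule arg_cong)
    then show ?thesis unfolding \<Gamma>_def mset_filter .
  qed
  finally have period: "?b (pindex l) = ?b 0" by simp
  have "image_mset (rot 1) (\<Sum>k<n. ?b k) = (\<Sum>k<n. ?b (Suc k))" for n
    by (induction n) (auto simp: multiset.map_comp comp_def rot_rot)
  then have "image_mset (rot 1) (mset \<phi>s) + ?b 0 = (\<Sum>k<Suc (pindex l). ?b k)"
    unfolding sum.lessThan_Suc_shift mset_\<phi>s by simp
  also have "\<dots> = mset \<phi>s + ?b 0"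
    unfolding sum.lessThan_Suc mset_\<phi>s period by simp
  finally show ?thesis by simp
qed

lemma disc_orbit_B: "map_poly of_fps (disc_orbit f \<gamma>s D B) = (\<Prod>\<phi>\<leftarrow>\<phi>s. [:- \<phi>, 1:])"
  unfolding disc_orbit_def prod_disc_ball
  by (rule theI'[OF rot_invariant_linear_factors[OF rot_\<phi>s]])

lemma leads_\<Gamma>: "\<gamma> \<in> set \<Gamma> \<Longrightarrow> leads (rot k (psubst f \<gamma>)) q (poly F (lc \<gamma>) * chi (of_nat k * q))"
  by (intro leads_rot leads_F expands_l) (auto simp: \<Gamma>_def leaves_at_B_iff)

lemma leads_\<phi>s:
  assumes "\<phi> \<in> set \<phi>s"
  shows "leads \<phi> q (pcoeff \<phi> q)" "pcoeff \<phi> q \<noteq> 0"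
proof -
  from assms obtain k \<gamma> where k\<gamma>: "\<gamma> \<in> set \<Gamma>" "\<phi> = rot k (psubst f \<gamma>)"
    by (auto simp: \<phi>s_def)
  have *: "leads \<phi> q (poly F (lc \<gamma>) * chi (of_nat k * q))"
    unfolding k\<gamma>(2) by (rule leads_\<Gamma>[OF k\<gamma>(1)])
  then show "leads \<phi> q (pcoeff \<phi> q)" by (simp add: leads_iff)
  have "poly F (lc \<gamma>) \<noteq> 0" using k\<gamma>(1) by (auto simp: \<Gamma>_def leaves_at_B_iff)
  with * show "pcoeff \<phi> q \<noteq> 0" by (auto simp: leads_iff)
qed

text \<open>Conjugation by the index fixes \<open>l\<close>, so it acts on a test series through its
  coefficient at x^h and on the value of \<open>f\<close> through the exponent \<open>q\<close>.
  This symmetry yields both the existence of H_B and the divisibilities.\<close>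

lemma F_rot: "poly F (chi (of_nat (pindex l) * h) * c) = chi (of_nat (pindex l) * q) * poly F c"
proof -
  let ?N = "pindex l"
  obtain \<gamma> where \<gamma>: "expands \<gamma> l c h" using expands_l_exists by metis
  have "rot ?N l = l"
    using rot_eq_rot_iff(2)[OF refl l_cpuiseux_root D(1), of h 0 ?N]
    by (simp add: l_def pcoeff_ptrunc split: if_splits)
  then have diff: "rot ?N \<gamma> - l = rot ?N (\<gamma> - l)" by simp
  have "expands (rot ?N \<gamma>) l (chi (of_nat ?N * h) * c) h"
    using \<gamma> unfolding expands_iff diff ord_ge_rot rot.rep_eq by (simp add: mult.commute)
  from leads_F[OF this] have 1: "leads (psubst f (rot ?N \<gamma>)) q (poly F (chi (of_nat ?N * h) * c))" .
  obtain \<delta> where \<delta>: "\<delta> > 0" "ord_ge \<delta> l" by (rule l_ord_ge)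
  have "psubst f (rot ?N \<gamma>) = rot ?N (psubst f \<gamma>)"
    by (rule psubst_rot[OF expands_ord_ge[OF \<delta> h_pos \<gamma>]])
  with 1 leads_rot[OF leads_F[OF \<gamma>], of ?N] show ?thesis by (simp add: leads_iff)
qed

end

lemma coeff_zero_linear_factors:
  fixes xs :: "'a :: idom list"
  shows "coeff (\<Prod>x\<leftarrow>xs. [:- x, 1:]) 0 \<noteq> 0 \<longleftrightarrow> 0 \<notin> set xs"
  by (simp add: poly_0_coeff_0[symmetric] poly_prod_list_eq_0)

section \<open>Arithmetic of N, n and M, and the edge polynomial\<close>

context tree_ball
begin

context
  fixes N m n L M :: nat
  assumes N: "N = pindex l" and pos: "m > 0" "n > 0" "L > 0" "M > 0"
    and cop: "coprime m n" "coprime L M"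
    and h: "h = of_nat m / of_nat (n * N)" and q: "q = of_nat L / of_nat M"
begin

lemma N_pos: "N > 0"
  unfolding N by (rule pindex_l_pos)

text \<open>\<open>M * q\<close> is the integer \<open>L\<close>. So conjugation changes leading
  coefficients by M-th roots of unity only, and their M-th powers agree in all balls of the
  orbit.\<close>

lemma chi_NMq: "chi (of_nat k * q) ^ M = 1"
proof -
  have "of_nat M * (of_nat k * q) = of_nat (k * L)" using pos by (simp add: q)
  then show ?thesis by (simp only: chi_of_nat_mult[symmetric] chi_of_nat)
qed

lemma chi_Nh: "of_nat N * h = of_nat m / of_nat n"
  using N_pos pos by (simp add: h)

lemma F_zeta: "poly F (chi (of_nat m / of_nat n) * c) = chi (of_nat N * q) * poly F c"
  using F_rot unfolding N[symmetric] chi_Nh .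

text \<open>After \<open>n\<close> rotations by e^(2 pi i m/n) the point returns, so
  \<open>chi (N * q) ^ n = 1\<close> by comparison at a point where \<open>F\<close> is nonzero. The
  point 0 is fixed by a single rotation. As \<open>L\<close> and \<open>M\<close> are coprime,
  integrality becomes divisibility.\<close>

lemma M_dvd: "M dvd n * N" "poly F 0 \<noteq> 0 \<Longrightarrow> M dvd N"
proof -
  have iter: "poly F (chi (of_nat m / of_nat n) ^ k * c) = chi (of_nat N * q) ^ k * poly F c" for k c
    by (induction k) (simp_all add: mult.assoc F_zeta)
  have "finite {c. poly F c = 0}" using F_nonzero by (rule poly_roots_finite)
  then obtain c where "c \<notin> {c. poly F c = 0}" using ex_new_if_finite infinite_UNIV_char_0 by blast
  then have c: "poly F c \<noteq> 0" by simp
  have "of_nat n * (of_nat m / of_nat n) = (of_nat m :: rat)" using pos by simp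
  then have "chi (of_nat m / of_nat n) ^ n = 1"
    by (simp only: chi_of_nat_mult[symmetric] chi_of_nat)
  then have "chi (of_nat N * q) ^ n = 1" using iter[of n c] c by simp
  then have "of_nat n * (of_nat N * q) \<in> \<int>"
    by (simp only: chi_of_nat_mult[symmetric] chi_eq_1_iff)
  then have "(of_nat ((n * N) * L) / of_nat M :: rat) \<in> \<int>" by (simp add: q mult_ac)
  then show "M dvd n * N" using pos cop by (rule_tac coprime_of_nat_div_in_Ints)
  assume "poly F 0 \<noteq> 0"
  then have "chi (of_nat N * q) = 1" using F_zeta[of 0] by simp
  then have "(of_nat (N * L) / of_nat M :: rat) \<in> \<int>" by (simp add: q chi_eq_1_iff)
  then show "M dvd N" using pos cop by (rule_tac coprime_of_nat_div_in_Ints)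
qed

text \<open>\<open>F ^ M\<close> is invariant under rotation by e^(2 pi i m/n), a primitive n-th
  root of unity since \<open>m\<close> and \<open>n\<close> are coprime; only exponents divisible by
  \<open>n\<close> survive.\<close>

lemma H_poly_B: "pcompose (H_poly f B n M) (monom 1 n) = F ^ M"
proof -
  let ?\<omega> = "chi (of_nat m / of_nat n)"
  have "poly (pcompose (F ^ M) [:0, ?\<omega>:]) c = poly (F ^ M) c" for c
  proof -
    have "poly (pcompose (F ^ M) [:0, ?\<omega>:]) c = poly F (?\<omega> * c) ^ M"
      by (simp add: poly_pcompose mult.commute)
    also have "\<dots> = poly F c ^ M" by (simp add: F_zeta power_mult_distrib chi_NMq)
    finally show ?thesis by simp
  qed
  then have inv: "pcompose (F ^ M) [:0, ?\<omega>:] = F ^ M" by (intro poly_ext)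
  have "n dvd k" if "coeff (F ^ M) k \<noteq> 0" for k
  proof -
    have "?\<omega> ^ k * coeff (F ^ M) k = coeff (F ^ M) k"
      using arg_cong[OF inv, of "\<lambda>p. coeff p k"] by (simp add: coeff_pcompose_linear)
    with that have "?\<omega> ^ k = 1" by simp
    then have "of_nat k * (of_nat m / of_nat n) \<in> (\<int> :: rat set)"
      by (simp only: chi_of_nat_mult[symmetric] chi_eq_1_iff)
    then have "(of_nat (k * m) / of_nat n :: rat) \<in> \<int>" by simp
    then show ?thesis using pos cop by (rule_tac coprime_of_nat_div_in_Ints)
  qed
  then obtain H where H: "pcompose H (monom 1 n) = F ^ M"
    by (rule pcompose_monom_exists[OF pos(2)])
  have "\<exists>!H. pcompose H (monom 1 n) = F ^ M"
    using H pcompose_monom_eq_iff[OF pos(2)] by metis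
  then show ?thesis unfolding H_poly_def F_poly_B by (rule theI')
qed

definition ws :: "complex list" where "ws = map (\<lambda>\<phi>. pcoeff \<phi> q) \<phi>s"

lemma coeff_disc_orbit:
  "coeff (disc_orbit f \<gamma>s D B) j $ i = pcoeff (coeff (\<Prod>\<phi>\<leftarrow>\<phi>s. [:- \<phi>, 1:]) j) (of_nat i)"
  unfolding disc_orbit_B[symmetric] coeff_map_poly[of of_fps, OF of_fps_0] pcoeff_of_fps_of_nat ..

lemma leads_coeff_disc_orbit:
  "leads (coeff (\<Prod>\<phi>\<leftarrow>\<phi>s. [:- \<phi>, 1:]) j) (q * (of_nat (length ws) - of_nat j))
     (coeff (\<Prod>w\<leftarrow>ws. [:- w, 1:]) j)"
proof -
  have "leads (coeff (\<Prod>\<phi>\<leftarrow>\<phi>s. [:- \<phi>, 1:]) j) (q * (of_nat (length \<phi>s) - of_nat j))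
      (coeff (\<Prod>\<phi>\<leftarrow>\<phi>s. [:- pcoeff \<phi> q, 1:]) j)"
    by (rule leads_coeff_linear_factors) (rule leads_\<phi>s(1))
  then show ?thesis by (simp add: ws_def comp_def)
qed

lemma zero_notin_ws: "0 \<notin> set ws"
  using leads_\<phi>s(2) by (auto simp: ws_def)

text \<open>Such a coefficient is the leading coefficient of a power series in u with integer
  exponents, so \<open>q * (length ws - j)\<close> is an integer.\<close>

lemma coeff_ws_dvd:
  assumes "coeff (\<Prod>w\<leftarrow>ws. [:- w, 1:]) j \<noteq> 0"
  shows "M dvd length ws - j" "j \<le> length ws"
proof -
  let ?Q = "\<Prod>\<phi>\<leftarrow>\<phi>s. [:- \<phi>, 1:]"
  show j: "j \<le> length ws"
    using assms le_degree[of "\<Prod>w\<leftarrow>ws. [:- w, 1:]" j] by (simp add: lead_coeff_linear_factors)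
  have "pcoeff (coeff ?Q j) (q * (of_nat (length ws) - of_nat j)) \<noteq> 0"
    using leads_coeff_disc_orbit[of j] assms by (simp add: leads_iff)
  moreover have "coeff ?Q j = of_fps (coeff (disc_orbit f \<gamma>s D B) j)"
    unfolding disc_orbit_B[symmetric] coeff_map_poly[of of_fps, OF of_fps_0] ..
  ultimately have "pcoeff (of_fps (coeff (disc_orbit f \<gamma>s D B) j)) (q * (of_nat (length ws) - of_nat j)) \<noteq> 0"
    by (simp only: not_False_eq_True)
  then have "q * (of_nat (length ws) - of_nat j) * of_nat 1 \<in> \<nat>"
    using pcoeff_of_root_eq_0 by blast
  then have "q * (of_nat (length ws) - of_nat j) \<in> \<nat>" by simp
  then have "q * of_nat (length ws - j) \<in> \<int>"
    using j by (auto simp: of_nat_diff elim: Nats_cases)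
  then have "(of_nat ((length ws - j) * L) / of_nat M :: rat) \<in> \<int>"
    by (simp add: q mult.commute)
  then show "M dvd length ws - j" using pos cop by (rule_tac coprime_of_nat_div_in_Ints)
qed

text \<open>The invariance under conjugation makes the edge polynomial \<open>\<Prod> (v - w)\<close> a polynomial in
  \<open>v\<^sup>M\<close>.\<close>

lemma edge_polynomial:
  obtains ts where "(\<Prod>w\<leftarrow>ws. [:- w, 1:]) = (\<Prod>t\<leftarrow>ts. monom 1 M - [:t:])"
    "length ws = M * length ts" "0 \<notin> set ts"
    "\<And>a. a \<noteq> 0 \<Longrightarrow> M * count (mset ts) a = size {#w \<in># mset ws. w ^ M = a#}"
proof -
  let ?P = "\<Prod>w\<leftarrow>ws. [:- w, 1:]"
  have P0: "coeff ?P 0 \<noteq> 0" using zero_notin_ws coeff_zero_linear_factors by blast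
  \<comment> \<open>The constant term is nonzero, so \<open>M\<close> divides
    \<open>length ws\<close> and hence \<open>j\<close> itself, not only the difference.\<close>
  then have "M dvd length ws" using coeff_ws_dvd(1)[of 0] by simp
  then have "M dvd j" if "coeff ?P j \<noteq> 0" for j
    using coeff_ws_dvd[OF that] by (metis dvd_diffD1)
  then obtain R where R: "pcompose R (monom 1 M) = ?P"
    by (rule pcompose_monom_exists[OF pos(4)])
  have deg: "degree (monom 1 M :: complex poly) = M" by (simp add: degree_monom_eq)
  have "lead_coeff ?P = lead_coeff R"
    unfolding R[symmetric] using pos(4) deg by (subst lead_coeff_comp) auto
  then have monic: "lead_coeff R = 1" by (simp only: lead_coeff_linear_factors(1))
  obtain ts where ts: "mset ts = proots R" by (metis ex_mset)
  have "R = (\<Prod>x\<in>#mset ts. [:- x, 1:])"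
    unfolding ts using complex_poly_decompose_multiset[of R] monic by simp
  then have R_ts: "R = (\<Prod>t\<leftarrow>ts. [:- t, 1:])" by (simp flip: prod_mset_prod_list)
  have P: "?P = (\<Prod>t\<leftarrow>ts. monom 1 M - [:t:])"
    unfolding R[symmetric] R_ts by (rule pcompose_linear_factors)
  have "degree ?P = degree R * M" unfolding R[symmetric] by (simp add: degree_pcompose deg)
  then have len: "length ws = M * length ts"
    unfolding R_ts lead_coeff_linear_factors by simp
  have "coeff R 0 \<noteq> 0" using P0 unfolding R[symmetric] coeff_pcompose_monom[OF pos(4)] by simp
  then have "0 \<notin> set ts" unfolding R_ts coeff_zero_linear_factors .
  moreover have "M * count (mset ts) a = size {#w \<in># mset ws. w ^ M = a#}" for a
  proof -
    have "R \<noteq> 0" using monic by auto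
    from size_filter_proots_pcompose_monom[OF pos(4) this, of "\<lambda>t. t = a"]
    have "size {#w \<in># mset ws. w ^ M = a#} = M * size {#t \<in># mset ts. t = a#}"
      unfolding R proots_linear_factors ts .
    also have "size {#t \<in># mset ts. t = a#} = count (mset ts) a"
      using size_filter_eq_count_image[of "\<lambda>t. t" a "mset ts"] by simp
    finally show ?thesis by simp
  qed
  ultimately show ?thesis using that P len by blast
qed

definition \<nu> :: "complex \<Rightarrow> nat" where
  "\<nu> a = size {#z \<in># proots (pderiv F). poly F z ^ M = a#}"

text \<open>M-th powers do not see the conjugation, so all \<open>N\<close> blocks contribute
  equally. Since \<open>a \<noteq> 0\<close>, the \<gamma> counted in the ball are automatically
  among those leaving the tree there.\<close>

lemma count_ws:
  assumes "a \<noteq> 0"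
  shows "size {#w \<in># mset ws. w ^ M = a#} = N * \<nu> a"
proof -
  have "size {#\<phi> \<in># image_mset (\<lambda>\<gamma>. rot k (psubst f \<gamma>)) (mset \<Gamma>). pcoeff \<phi> q ^ M = a#} = \<nu> a" for k
  proof -
    have "{#\<gamma> \<in># mset \<Gamma>. pcoeff (rot k (psubst f \<gamma>)) q ^ M = a#} =
        {#\<gamma> \<in># mset \<Gamma>. poly F (lc \<gamma>) ^ M = a#}"
    proof (rule filter_mset_cong[OF refl])
      fix \<gamma> assume "\<gamma> \<in># mset \<Gamma>"
      then have "pcoeff (rot k (psubst f \<gamma>)) q = poly F (lc \<gamma>) * chi (of_nat k * q)"
        using leads_\<Gamma>[of \<gamma> k] by (simp add: leads_iff)
      then show "(pcoeff (rot k (psubst f \<gamma>)) q ^ M = a) = (poly F (lc \<gamma>) ^ M = a)"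
        by (simp add: power_mult_distrib chi_NMq)
    qed
    also have "\<dots> = {#\<gamma> \<in># filter_mset near (mset \<gamma>s). poly F (lc \<gamma>) ^ M = a#}"
      unfolding \<Gamma>_def mset_filter filter_filter_mset
      using assms pos(4) by (intro filter_mset_cong refl) (auto simp: leaves_at_B_iff)
    finally show ?thesis
      by (simp add: \<nu>_def proots_deriv_F filter_mset_image_mset)
  qed
  then have "size {#\<phi> \<in># (\<Sum>k<K. image_mset (\<lambda>\<gamma>. rot k (psubst f \<gamma>)) (mset \<Gamma>)).
      pcoeff \<phi> q ^ M = a#} = K * \<nu> a" for K
    by (induction K) simp_all
  then have "size {#\<phi> \<in># mset \<phi>s. pcoeff \<phi> q ^ M = a#} = N * \<nu> a"
    unfolding mset_\<phi>s N .
  then show ?thesis by (simp add: ws_def filter_mset_image_mset)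
qed

lemma nondegenerate_disc_orbit_iff:
  "nondegenerate (fps_of_poly (disc_orbit f \<gamma>s D B)) \<longleftrightarrow> (\<forall>a. a \<noteq> 0 \<longrightarrow> N * \<nu> a \<le> M)"
  and M_dvd_\<nu>: "a \<noteq> 0 \<Longrightarrow> M dvd N * \<nu> a"
proof -
  obtain ts where P: "(\<Prod>w\<leftarrow>ws. [:- w, 1:]) = (\<Prod>t\<leftarrow>ts. monom 1 M - [:t:])"
    and len: "length ws = M * length ts" and ts0: "0 \<notin> set ts"
    and count': "\<And>a. a \<noteq> 0 \<Longrightarrow> M * count (mset ts) a = size {#w \<in># mset ws. w ^ M = a#}"
    by (rule edge_polynomial) blast
  have count: "M * count (mset ts) a = N * \<nu> a" if "a \<noteq> 0" for a
    using count'[OF that] count_ws[OF that] by simp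
  show "M dvd N * \<nu> a" if "a \<noteq> 0" using count[OF that] by (metis dvd_triv_left)
  \<comment> \<open>\<open>F\<close> has two distinct roots, hence a critical point with nonzero
    value. So some \<gamma> leaves the tree at \<open>B\<close>, and the diagram does have a compact
    edge.\<close>
  have "{#z \<in># proots (pderiv F). poly F z \<noteq> 0#} \<noteq> {#}"
  proof
    assume "{#z \<in># proots (pderiv F). poly F z \<noteq> 0#} = {#}"
    then have "card {z. poly F z = 0} = 1"
      using size_noncritical_roots[OF degree_F] by (metis add_0 size_empty)
    then obtain z where z: "{z. poly F z = 0} = {z}" by (rule card_1_singletonE)
    have "lc \<alpha>0 \<in> {z. poly F z = 0}" "lc \<alpha>1 \<in> {z. poly F z = 0}"
      using F_roots by simp_all
    then show False unfolding z using near_contact(3) by simp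
  qed
  then obtain z where z: "z \<in># proots (pderiv F)" "poly F z \<noteq> 0" by auto
  then have "poly F z ^ M \<noteq> 0" "\<nu> (poly F z ^ M) \<noteq> 0"
    by (auto simp: \<nu>_def)
  then have "ts \<noteq> []" using count N_pos by fastforce
  have "nondegenerate (fps_of_poly (disc_orbit f \<gamma>s D B)) \<longleftrightarrow> distinct ts"
  proof (rule nondegenerate_iff_distinct)
    show "L > 0" "M > 0" "coprime L M" "ts \<noteq> []" "0 \<notin> set ts" by fact+
  next
    fix i j
    assume "fps_of_poly (disc_orbit f \<gamma>s D B) $ j $ i \<noteq> 0"
    then have "\<not> of_nat i < q * (of_nat (length ws) - of_nat j)"
      using leads_coeff_disc_orbit[of j] by (auto simp: coeff_disc_orbit leads_iff dest: ord_ge_pcoeff)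
    then have "of_nat L * (of_nat (length ws) - of_nat j) \<le> (of_nat (i * M) :: rat)"
      using pos by (simp add: q field_simps)
    then have "(of_nat (L * length ws) :: rat) \<le> of_nat (i * M + j * L)"
      by (simp add: algebra_simps)
    then have "L * length ws \<le> i * M + j * L" unfolding of_nat_le_iff .
    then show "L * M * length ts \<le> i * M + j * L" by (simp add: len mult_ac)
  next
    fix i j
    assume "i * M + j * L = L * M * length ts"
    then have "i * M + j * L = L * length ws" by (simp add: len mult_ac)
    then have "(of_nat (i * M + j * L) :: rat) = of_nat (L * length ws)" by (simp only:)
    then have "of_nat i = q * (of_nat (length ws) - of_nat j)"
      using pos by (simp add: q field_simps)
    then show "fps_of_poly (disc_orbit f \<gamma>s D B) $ j $ i = coeff (\<Prod>t\<leftarrow>ts. monom 1 M - [:t:]) j"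
      using leads_coeff_disc_orbit[of j] by (simp add: coeff_disc_orbit leads_iff P)
  qed
  also have "\<dots> \<longleftrightarrow> (\<forall>a. count (mset ts) a \<le> 1)"
    unfolding distinct_count_atmost_1
    by (metis One_nat_def count_greater_eq_one_iff le_antisym le_0_eq less_or_eq_imp_le linorder_not_less
        not_in_iff order_refl set_mset_mset zero_less_one)
  also have "\<dots> \<longleftrightarrow> (\<forall>a. a \<noteq> 0 \<longrightarrow> count (mset ts) a \<le> 1)"
    using ts0 by (metis count_mset_0_iff zero_le)
  also have "\<dots> \<longleftrightarrow> (\<forall>a. a \<noteq> 0 \<longrightarrow> M * count (mset ts) a \<le> M * 1)"
    using pos(4) by simp
  finally show "nondegenerate (fps_of_poly (disc_orbit f \<gamma>s D B)) \<longleftrightarrow>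
      (\<forall>a. a \<noteq> 0 \<longrightarrow> N * \<nu> a \<le> M)"
    by (simp add: count)
qed

lemma nondegenerate_disc_orbit:
  "card {t. poly (H_poly f B n M) t = 0} = 1 \<Longrightarrow>
     nondegenerate (fps_of_poly (disc_orbit f \<gamma>s D B)) \<longleftrightarrow> (n - 1) * N = M"
  "card {t. poly (H_poly f B n M) t = 0} \<noteq> 1 \<Longrightarrow>
     nondegenerate (fps_of_poly (disc_orbit f \<gamma>s D B)) \<longleftrightarrow>
       n * N = M \<and> nonzero_critical_values_simple (H_poly f B n M)"
  unfolding nondegenerate_disc_orbit_iff \<nu>_def
  using critical_multiplicity_criterion[OF H_poly_B pos(2,4) N_pos F_roots near_contact(3)
      F_nonzero M_dvd M_dvd_\<nu>[unfolded \<nu>_def]]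
  by blast+

end

end

theorem theorem5p7:
  fixes f u u' :: "complex fps fps"
    and \<alpha>s \<gamma>s :: "puiseux list"
    and B :: "puiseux set"
    and D N m n L M :: nat
  assumes "f \<in> germs" and "reduced_germ f"
    and "fps_nth (fps_nth f 0) 0 = 0" and "\<exists>j. fps_nth (fps_nth f j) 0 \<noteq> 0"
    and "u \<in> unit_germs" and "u' \<in> unit_germs"
    and "set \<alpha>s \<subseteq> frac_series" and "set \<gamma>s \<subseteq> frac_series"
    and "distinct \<alpha>s" and "length \<gamma>s + 1 = length \<alpha>s"
    and "germ_to_puiseux f = germ_to_puiseux u * (\<Prod>\<alpha>\<leftarrow>\<alpha>s. fps_X - fps_const \<alpha>)"
    and "germ_to_puiseux (fps_deriv f) =
           germ_to_puiseux u' * (\<Prod>\<gamma>\<leftarrow>\<gamma>s. fps_X - fps_const \<gamma>)"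
    and "D > 0" and "set \<alpha>s \<union> set \<gamma>s \<subseteq> cpuiseux_root D"
    and "B \<in> tree f"
    and "N = pindex (lam B)"
    and "m > 0" and "n > 0" and "L > 0" and "M > 0"
    and "gcd m n = 1" and "gcd L M = 1"
    and "height B = of_nat m / of_nat (n * N)"
    and "q_exp f B = of_nat L / of_nat M"
  shows "(card {t. poly (H_poly f B n M) t = 0} = 1 \<longrightarrow>
            (nondegenerate (fps_of_poly (disc_orbit f \<gamma>s D B)) \<longleftrightarrow> (n - 1) * N = M)) \<and>
         (card {t. poly (H_poly f B n M) t = 0} \<noteq> 1 \<longrightarrow>
            (nondegenerate (fps_of_poly (disc_orbit f \<gamma>s D B)) \<longleftrightarrow>
               n * N = M \<and> nonzero_critical_values_simple (H_poly f B n M)))"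
proof -
  have unit: "u $ 0 $ 0 \<noteq> 0" "u' $ 0 $ 0 \<noteq> 0" using assms(5,6) by (simp_all add: unit_germs_def)
  have "Zer f = set \<alpha>s" by (rule Zer_eq_roots[OF assms(11) unit(1) assms(7)])
  then obtain \<alpha> \<alpha>' h where \<alpha>: "\<alpha> \<in> set \<alpha>s" "\<alpha>' \<in> set \<alpha>s" "contact \<alpha> \<alpha>' = Fin h"
    and B: "B = pball \<alpha> h"
    using assms(15) unfolding tree_def by blast
  interpret tree_ball f u u' \<alpha>s \<gamma>s D \<alpha> \<alpha>' h
    by unfold_locales (use assms unit \<alpha> in simp_all)
  have B_eq: "B = local.B" by (simp add: B B_def)
  have prems: "N = pindex l" "coprime m n" "coprime L M"
    "h = of_nat m / of_nat (n * N)" "q = of_nat L / of_nat M"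
    using assms(16,21-24) unfolding B_eq height_B lam_B q_exp_B by (simp_all add: coprime_iff_gcd_eq_1)
  show ?thesis
    unfolding B_eq
    using nondegenerate_disc_orbit[OF prems(1) assms(17-20) prems(2-5)] by blast
qed

end
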